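(* Let $\lambda_0,\lambda_1>0$, $\gamma_0>0>\gamma_1$ and $t>0$, let $\Gamma$ be the associated telegraph process, $m_t=\min_{u\in[0,t]}\Gamma(u)$ and $M_t=\max_{u\in[0,t]}\Gamma(u)$. Then, on $x>0$, $$\mathrm P_0\{\Gamma(t)\in \mathrm dx,\ m_t=0\}=e^{-\lambda_0t}\delta_{\gamma_0t}(\mathrm dx)+\frac{\lambda_0}{\gamma_0}\left[\frac{x}{\xi_0(t,x)}\mathcal I_0(t,x)+\Big(\lambda_1x-\gamma_1\frac{\xi_1(t,x)}{\xi_0(t,x)}\Big)\mathcal I_1(t,x)\right]\theta(t,x)\mathbf 1_{\{0<x<\gamma_0t\}}\,\mathrm dx.$$ Moreover, the density $g^-(t,x;n)$, $n\ge1$, of the measure $\mathrm P_1\{\Gamma(t)\in\mathrm dx,\ M_t=0,\ N(t)=n\}$ on $\gamma_1t<x<0$ is given, for $n\ge0$, by $$g^-(t,x;2n+1)=\frac{\lambda_1}{\xi_1(t,x)}\frac{z(t,x)^n}{n!^2}\theta(t,x)\cdot\frac1{\gamma_1}\Big(x-\frac{\gamma_0}{n+1}\xi_0(t,x)\Big),\qquad g^-(t,x;2n+2)=\lambda_0\lambda_1\frac{z(t,x)^n}{n!(n+1)!}\theta(t,x)\cdot\frac{x}{\gamma_1},$$ and, on $x<0$, $$\mathrm P_1\{\Gamma(t)\in \mathrm dx,\ M_t=0\}=e^{-\lambda_1t}\delta_{\gamma_1t}(\mathrm dx)+\frac{\lambda_1}{\gamma_1}\left[\frac{x}{\xi_1(t,x)}\mathcal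 I_0(t,x)+\Big(\lambda_0x-\gamma_0\frac{\xi_0(t,x)}{\xi_1(t,x)}\Big)\mathcal I_1(t,x)\right]\theta(t,x)\mathbf 1_{\{\gamma_1t<x<0\}}\,\mathrm dx.$$
   Context: $\varepsilon=\varepsilon(t)\in\{0,1\}$, $t\ge0$, is a two-state continuous-time Markov process which leaves state $i$ at rate $\lambda_i$ and switches to state $1-i$. $\mathrm P_i\{\cdot\}=\mathrm P\{\cdot\mid\varepsilon(0)=i\}$. $N(t)$ is the number of switchings of $\varepsilon$ up to time $t$, $N(0)=0$. The telegraph process is $\Gamma(t)=\int_0^t\gamma_{\varepsilon(s)}\,\mathrm ds$. Notation: $$\xi_0(t,x)=\frac{x-\gamma_1t}{\gamma_0-\gamma_1},\qquad \xi_1(t,x)=t-\xi_0(t,x)=\frac{\gamma_0t-x}{\gamma_0-\gamma_1},$$ $$z(t,x)=\lambda_0\lambda_1\xi_0(t,x)\xi_1(t,x),\qquad \theta(t,x)=\frac{\exp(-\lambda_0\xi_0(t,x)-\lambda_1\xi_1(t,x))}{\gamma_0-\gamma_1},$$ $$\mathcal I_0(t,x)=\sum_{n=0}^\infty\frac{z(t,x)^n}{n!^2},\qquad \mathcal I_1(t,x)=\sum_{n=0}^\infty\frac{z(t,x)^n}{n!(n+1)!}.$$ $\delta_a$ is the Dirac measure at $a$. *)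

theory Defs
  imports "HOL-Probability.Probability"
begin

text \<open>
  States are the numbers \<open>0, 1 :: nat\<close>, so that \<open>1 - i\<close> is the other state.  Times are reals, and
  only times \<open>\<ge> 0\<close> are constrained.  \<open>p h i j\<close> is the probability of going from \<open>i\<close> to \<open>j\<close> in time
  \<open>h\<close>.  The last clause says \<open>p h i (1 - i) = lam i * h + o(h)\<close>; since the rows sum to 1, the
  generator is the matrix with rows \<open>(- lam 0, lam 0)\<close> and \<open>(lam 1, - lam 1)\<close>.
\<close>

definition transition_function :: "(nat \<Rightarrow> real) \<Rightarrow> (real \<Rightarrow> nat \<Rightarrow> nat \<Rightarrow> real) \<Rightarrow> bool" where
  "transition_function lam p \<longleftrightarrow>
     (\<forall>h\<ge>0. \<forall>i\<in>{0,1}. \<forall>j\<in>{0,1}. 0 \<le> p h i j) \<and>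
     (\<forall>h\<ge>0. \<forall>i\<in>{0,1}. (\<Sum>j\<in>{0,1}. p h i j) = 1) \<and>
     (\<forall>i\<in>{0,1}. \<forall>j\<in>{0,1}. p 0 i j = (if i = j then 1 else 0)) \<and>
     (\<forall>s\<ge>0. \<forall>h\<ge>0. \<forall>i\<in>{0,1}. \<forall>j\<in>{0,1}. p (s + h) i j = (\<Sum>k\<in>{0,1}. p s i k * p h k j)) \<and>
     (\<forall>i\<in>{0,1}. ((\<lambda>h. p h i (1 - i) / h) \<longlongrightarrow> lam i) (at_right 0))"

text \<open>
  The switching times in \<open>(0, t]\<close> of a right-continuous path with values in a discrete space are its
  points of discontinuity.
\<close>

definition switchings :: "(real \<Rightarrow> nat) \<Rightarrow> real \<Rightarrow> real set" where
  "switchings e t = {s \<in> {0<..t}. \<not> isCont e s}"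

text \<open>
  A homogeneous two-state Markov process with switching rates \<open>lam\<close> and right-continuous step paths.
  The initial distribution is arbitrary.
\<close>

locale two_state_markov_process = prob_space M
  for M :: "'a measure" +
  fixes lam :: "nat \<Rightarrow> real" and \<epsilon> :: "real \<Rightarrow> 'a \<Rightarrow> nat"
  assumes random_variable_state: "t \<ge> 0 \<Longrightarrow> \<epsilon> t \<in> measurable M (count_space {0,1})"
    and right_continuous: "\<omega> \<in> space M \<Longrightarrow> t \<ge> 0 \<Longrightarrow> continuous (at_right t) (\<lambda>s. \<epsilon> s \<omega>)"
    and finite_switchings: "\<omega> \<in> space M \<Longrightarrow> finite (switchings (\<lambda>s. \<epsilon> s \<omega>) t)"
    and markov:
      "\<exists>p. transition_function lam p \<and>
        (\<forall>n (\<tau> :: nat \<Rightarrow> real) (i :: nat \<Rightarrow> nat). \<forall>j\<in>{0,1}.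
           0 \<le> \<tau> 0 \<longrightarrow> (\<forall>k\<le>n. \<tau> k < \<tau> (Suc k)) \<longrightarrow>
           \<P>(\<omega> in M. \<forall>k\<le>n. \<epsilon> (\<tau> k) \<omega> = i k) > 0 \<longrightarrow>
           \<P>(\<omega> in M. \<epsilon> (\<tau> (Suc n)) \<omega> = j \<bar> \<forall>k\<le>n. \<epsilon> (\<tau> k) \<omega> = i k)
             = p (\<tau> (Suc n) - \<tau> n) (i n) j)"

definition switch_count :: "(real \<Rightarrow> 'a \<Rightarrow> nat) \<Rightarrow> real \<Rightarrow> 'a \<Rightarrow> nat" where
  "switch_count \<epsilon> t \<omega> = card (switchings (\<lambda>s. \<epsilon> s \<omega>) t)"

definition telegraph :: "(nat \<Rightarrow> real) \<Rightarrow> (real \<Rightarrow> 'a \<Rightarrow> nat) \<Rightarrow> real \<Rightarrow> 'a \<Rightarrow> real" where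
  "telegraph \<gamma> \<epsilon> t \<omega> = integral {0..t} (\<lambda>s. \<gamma> (\<epsilon> s \<omega>))"

text \<open>
  The paths of the telegraph process are continuous, so the infimum and the supremum over \<open>[0, t]\<close>
  are attained.
\<close>

definition running_min :: "(real \<Rightarrow> 'a \<Rightarrow> real) \<Rightarrow> real \<Rightarrow> 'a \<Rightarrow> real" where
  "running_min X t \<omega> = (INF u\<in>{0..t}. X u \<omega>)"

definition running_max :: "(real \<Rightarrow> 'a \<Rightarrow> real) \<Rightarrow> real \<Rightarrow> 'a \<Rightarrow> real" where
  "running_max X t \<omega> = (SUP u\<in>{0..t}. X u \<omega>)"

definition xi0 :: "(nat \<Rightarrow> real) \<Rightarrow> real \<Rightarrow> real \<Rightarrow> real" where
  "xi0 \<gamma> t x = (x - \<gamma> 1 * t) / (\<gamma> 0 - \<gamma> 1)"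

definition xi1 :: "(nat \<Rightarrow> real) \<Rightarrow> real \<Rightarrow> real \<Rightarrow> real" where
  "xi1 \<gamma> t x = t - xi0 \<gamma> t x"

definition zfun :: "(nat \<Rightarrow> real) \<Rightarrow> (nat \<Rightarrow> real) \<Rightarrow> real \<Rightarrow> real \<Rightarrow> real" where
  "zfun lam \<gamma> t x = lam 0 * lam 1 * xi0 \<gamma> t x * xi1 \<gamma> t x"

definition theta :: "(nat \<Rightarrow> real) \<Rightarrow> (nat \<Rightarrow> real) \<Rightarrow> real \<Rightarrow> real \<Rightarrow> real" where
  "theta lam \<gamma> t x = exp (- lam 0 * xi0 \<gamma> t x - lam 1 * xi1 \<gamma> t x) / (\<gamma> 0 - \<gamma> 1)"

definition I0 :: "(nat \<Rightarrow> real) \<Rightarrow> (nat \<Rightarrow> real) \<Rightarrow> real \<Rightarrow> real \<Rightarrow> real" where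
  "I0 lam \<gamma> t x = (\<Sum>n. zfun lam \<gamma> t x ^ n / (fact n)\<^sup>2)"

definition I1 :: "(nat \<Rightarrow> real) \<Rightarrow> (nat \<Rightarrow> real) \<Rightarrow> real \<Rightarrow> real \<Rightarrow> real" where
  "I1 lam \<gamma> t x = (\<Sum>n. zfun lam \<gamma> t x ^ n / (fact n * fact (n + 1)))"

text \<open>
  An identity between a finite measure and \<open>c \<delta>\<^sub>a(dx) + f(x) dx\<close> on the Borel set \<open>S\<close>.  Integrability
  is part of the claim because a Bochner integral that does not exist is 0.
\<close>

definition atom_plus_density_on ::
    "real set \<Rightarrow> (real set \<Rightarrow> real) \<Rightarrow> real \<Rightarrow> real \<Rightarrow> (real \<Rightarrow> real) \<Rightarrow> bool" where
  "atom_plus_density_on S \<mu> c a f \<longleftrightarrow>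
     set_integrable lborel S f \<and>
     (\<forall>A\<in>sets borel. A \<subseteq> S \<longrightarrow> \<mu> A = c * indicator A a + (LINT x:A|lborel. f x))"

definition density_on :: "real set \<Rightarrow> (real set \<Rightarrow> real) \<Rightarrow> (real \<Rightarrow> real) \<Rightarrow> bool" where
  "density_on S \<mu> f \<longleftrightarrow>
     set_integrable lborel S f \<and>
     (\<forall>A\<in>sets borel. A \<subseteq> S \<longrightarrow> \<mu> A = (LINT x:A|lborel. f x))"

end

(*
  Reduce both halves to a path that starts in a state with positive velocity and has to stay
  nonnegative; the statement about the maximum is the same statement for the velocities - gamma.
  Decompose at the last switching before t: until then the path has made one switching fewer, the
  switching happens at rate lam i, and no further switching occurs with probability
  exp (- lam (1 - i) (t - s)).  On a grid of mesh t / K this is the Markov property for the whole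
  past, and the limit is an integral recursion in the number of switchings.  In the coordinates
  a = xi_0, b = xi_1 one of the two stays fixed during the last flight, so that the recursion for
  the densities becomes the integration of a polynomial in the other coordinate:
  (d/du) u^m (u - c b) = (m + 1) u^(m-1) (u - c b m / (m + 1)) after a switch to the upward state
  (the recursion starts at u = c b, where the path leaves 0), and similarly downwards.
*)

theory Submission
  imports Defs
begin

section \<open>Step paths\<close>

text \<open>The Markov property is assumed for finitely many observation times only, while the
  recursion conditions on an event of the whole path up to \<open>s\<close>. Hence the extension to
  the sigma-algebra of the past. The switching count is defined through discontinuities, so even its
  measurability has to come from a grid. The Riemann sums sample an event probability at the left
  end of each cell although paths are continuous only from the right; this is harmless because a
  fixed time is almost surely not a switching time. In the recursion the constraint is imposed only
  up to the last switching: the end point then has a density on the whole line, and its law can be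
  identified on half-lines. Since the initial law is arbitrary, everything is computed jointly with
  the event of starting in \<open>i0\<close>, and conditioning comes last. The coordinates xi_0 and
  xi_1 are the times spent in the two states, so the exponential weight of a path depends on its end
  point alone.\<close>

locale step_path =
  fixes e :: "real \<Rightarrow> nat"
  assumes state: "0 \<le> u \<Longrightarrow> e u \<in> {0,1}"
    and right_cont: "0 \<le> u \<Longrightarrow> continuous (at_right u) e"
    and finite_switchings: "finite (switchings e u)"
begin

abbreviation N :: "real \<Rightarrow> nat" where
  "N u \<equiv> card (switchings e u)"

lemma state_other: "0 \<le> u \<Longrightarrow> 0 \<le> s \<Longrightarrow> e u \<noteq> e s \<Longrightarrow> e u = 1 - e s"
  using state[of u] state[of s] by auto

lemma eventually_right_const:
  assumes "0 \<le> u"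
  shows "\<exists>d>u. \<forall>s\<in>{u..<d}. e s = e u"
proof -
  have "\<forall>\<^sub>F s in at_right u. e s = e u"
    using right_cont[OF assms] by (simp add: continuous_within tendsto_discrete)
  then obtain d where "d > u" "\<forall>s>u. s < d \<longrightarrow> e s = e u"
    by (auto simp: eventually_at_right_field)
  then show ?thesis
    by (metis atLeastLessThan_iff le_less)
qed

text \<open>On \<open>{a..b}\<close> the map is continuous, where right continuity takes care of the
  end point \<open>a\<close>; its image is connected, and a connected subset of a discrete space is
  a point.\<close>

lemma const_if_isCont:
  assumes "0 \<le> a" and cont: "\<And>s. a < s \<Longrightarrow> s \<le> b \<Longrightarrow> isCont e s" and "s \<in> {a..b}"
  shows "e s = e a"
proof (rule ccontr)
  assume ne: "e s \<noteq> e a"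
  with assms have "a < b" by (cases "a = b") auto
  have "continuous_on {a..b} e"
    unfolding continuous_on_eq_continuous_within
  proof
    fix x assume "x \<in> {a..b}"
    show "continuous (at x within {a..b}) e"
    proof (cases "x = a")
      case True
      then show ?thesis
        using right_cont[OF assms(1)] at_within_Icc_at_right[OF \<open>a < b\<close>] by simp
    next
      case False
      then have "isCont e x"
        using \<open>x \<in> {a..b}\<close> by (intro cont) auto
      then show ?thesis
        by (rule continuous_at_imp_continuous_within)
    qed
  qed
  then have "connected (e ` {a..b})"
    by (rule connected_continuous_image) simp
  moreover have "open {e a}" "open (- {e a})"
    by (simp_all add: Topological_Spaces.open_discrete)
  moreover have "{e a} \<inter> - {e a} \<inter> e ` {a..b} = {}" "e ` {a..b} \<subseteq> {e a} \<union> - {e a}"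
    by auto
  moreover have "{e a} \<inter> e ` {a..b} \<noteq> {}" "- {e a} \<inter> e ` {a..b} \<noteq> {}"
    using ne assms(3) \<open>a < b\<close> by auto
  ultimately show False
    unfolding connected_def by blast
qed

lemma isCont_if_const:
  assumes "0 \<le> s" "r < s" and const: "\<And>u. r \<le> u \<Longrightarrow> u \<le> s \<Longrightarrow> e u = c"
  shows "isCont e s"
proof -
  have "e s = c" using const assms by auto
  have "\<forall>\<^sub>F u in at_left s. e u = e s"
    unfolding eventually_at_left_field
    using assms(2) const \<open>e s = c\<close> by (intro exI[of _ r]) auto
  then have "continuous (at_left s) e"
    by (simp add: continuous_within tendsto_discrete)
  then show ?thesis
    using right_cont[OF assms(1)] continuous_at_split by blast
qed

lemma switchings_mono: "s \<le> t \<Longrightarrow> switchings e s \<subseteq> switchings e t"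
  by (auto simp: switchings_def)

lemma N_mono: "s \<le> t \<Longrightarrow> N s \<le> N t"
  by (intro card_mono finite_switchings switchings_mono)

lemma N_eq_0_iff:
  assumes "0 \<le> t"
  shows "N t = 0 \<longleftrightarrow> (\<forall>u\<in>{0..t}. e u = e 0)"
proof
  assume "N t = 0"
  then have "switchings e t = {}"
    using finite_switchings by auto
  then have "\<And>s. 0 < s \<Longrightarrow> s \<le> t \<Longrightarrow> isCont e s"
    by (auto simp: switchings_def)
  then show "\<forall>u\<in>{0..t}. e u = e 0"
    using const_if_isCont[of 0 t] by blast
next
  assume const: "\<forall>u\<in>{0..t}. e u = e 0"
  have "isCont e s" if "0 < s" "s \<le> t" for s
  proof (rule isCont_if_const[of s 0 "e 0"])
    fix u assume "0 \<le> u" "u \<le> s"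
    then show "e u = e 0"
      using that by (intro const[rule_format]) simp
  qed (use that in auto)
  then have "switchings e t = {}"
    by (auto simp: switchings_def)
  then show "N t = 0" by simp
qed

text \<open>The pathwise inductions on the count go through this decomposition: at \<open>r\<close>
  the count is one lower, and on each of the two pieces the path is constant. The two states differ
  because otherwise the path would be constant on \<open>{r..\<sigma>}\<close> and hence continuous
  at \<open>\<sigma>\<close>.\<close>

lemma last_switching:
  assumes "0 \<le> t" "N t = Suc n"
  obtains r \<sigma> where "0 \<le> r" "r < \<sigma>" "\<sigma> \<le> t"
    "\<forall>u\<in>{r..<\<sigma>}. N u = n \<and> e u = 1 - e t"
    "\<forall>u\<in>{\<sigma>..t}. N u = Suc n \<and> e u = e t"
proof -
  define \<sigma> where "\<sigma> = Max (switchings e t)"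
  have ne: "switchings e t \<noteq> {}"
    using assms(2) by auto
  have \<sigma>: "\<sigma> \<in> switchings e t"
    unfolding \<sigma>_def using finite_switchings ne by (rule Max_in)
  have \<sigma>_max: "s \<le> \<sigma>" if "s \<in> switchings e t" for s
    unfolding \<sigma>_def using finite_switchings that by (rule Max_ge)
  have \<sigma>t: "0 < \<sigma>" "\<sigma> \<le> t" "\<not> isCont e \<sigma>"
    using \<sigma> by (auto simp: switchings_def)
  \<comment> \<open>The previous switching, or 0 if \<open>\<sigma>\<close> is the only one.\<close>
  define r where "r = Max (insert 0 (switchings e t - {\<sigma>}))"
  have "r \<in> insert 0 (switchings e t - {\<sigma>})"
    unfolding r_def by (rule Max_in) (simp_all add: finite_switchings)
  then have r: "0 \<le> r" "r < \<sigma>"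
    using \<sigma>_max \<sigma>t by (auto simp: switchings_def less_le)
  have r_max: "s \<le> r" if "s \<in> switchings e t" "s \<noteq> \<sigma>" for s
    unfolding r_def using that by (intro Max_ge) (auto simp: finite_switchings)
  have after: "e u = e \<sigma>" if "\<sigma> \<le> u" "u \<le> t" for u
  proof (rule const_if_isCont[of \<sigma> t])
    fix s assume "\<sigma> < s" "s \<le> t"
    then show "isCont e s"
      using \<sigma>_max[of s] \<sigma>t by (force simp: switchings_def)
  qed (use that \<sigma>t in auto)
  have before: "e u = e r" if "r \<le> u" "u < \<sigma>" for u
  proof (rule const_if_isCont[of r u])
    fix s assume "r < s" "s \<le> u"
    then show "isCont e s"
      using r_max[of s] \<sigma>t r that by (force simp: switchings_def)
  qed (use that r in auto)
  have "e r \<noteq> e \<sigma>"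
  proof
    assume "e r = e \<sigma>"
    have "isCont e \<sigma>"
    proof (rule isCont_if_const[of \<sigma> r "e r"])
      fix u assume "r \<le> u" "u \<le> \<sigma>"
      then show "e u = e r"
        using before \<open>e r = e \<sigma>\<close> by (cases "u = \<sigma>") auto
    qed (use r in auto)
    then show False using \<sigma>t by simp
  qed
  moreover have "e \<sigma> = e t"
    using after[of t] \<sigma>t by simp
  ultimately have er: "e r = 1 - e t"
    using state_other[of r \<sigma>] r by simp
  have N_before: "N u = n" if "r \<le> u" "u < \<sigma>" for u
  proof -
    have "switchings e u = switchings e t - {\<sigma>}"
    proof (intro equalityI subsetI)
      fix s assume "s \<in> switchings e t - {\<sigma>}"
      then show "s \<in> switchings e u"
        using r_max[of s] that by (auto simp: switchings_def)
    qed (use that \<sigma>t in \<open>auto simp: switchings_def\<close>)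
    then show ?thesis
      using assms(2) \<sigma> finite_switchings by (simp add: card_Diff_singleton)
  qed
  have N_after: "N u = Suc n" if "\<sigma> \<le> u" "u \<le> t" for u
  proof -
    have "switchings e u = switchings e t"
    proof (intro equalityI subsetI)
      fix s assume "s \<in> switchings e t"
      then show "s \<in> switchings e u"
        using \<sigma>_max[of s] that by (auto simp: switchings_def)
    qed (use that in \<open>auto simp: switchings_def\<close>)
    then show ?thesis
      using assms(2) by simp
  qed
  have B: "\<forall>u\<in>{r..<\<sigma>}. N u = n \<and> e u = 1 - e t"
  proof
    fix u assume "u \<in> {r..<\<sigma>}"
    then show "N u = n \<and> e u = 1 - e t"
      using before[of u] N_before[of u] er by simp
  qed
  have A: "\<forall>u\<in>{\<sigma>..t}. N u = Suc n \<and> e u = e t"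
  proof
    fix u assume "u \<in> {\<sigma>..t}"
    then show "N u = Suc n \<and> e u = e t"
      using after[of u] N_after[of u] \<open>e \<sigma> = e t\<close> by simp
  qed
  show thesis
    by (rule that[OF r \<sigma>t(2) B A])
qed

text \<open>Each switching flips the state, so the count alone fixes the final state. Later the
  clause about the state can therefore be traded for the one about the count.\<close>

lemma parity: "0 \<le> t \<Longrightarrow> e t = (if even (N t) then e 0 else 1 - e 0)"
proof -
  have "N t = n \<Longrightarrow> 0 \<le> t \<Longrightarrow> e t = (if even n then e 0 else 1 - e 0)" for n
  proof (induction n arbitrary: t)
    case 0
    then have "\<forall>u\<in>{0..t}. e u = e 0"
      using N_eq_0_iff[of t] by blast
    from this[rule_format, of t] show ?case
      using \<open>0 \<le> t\<close> by simp
  next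
    case (Suc n)
    obtain r \<sigma> where r: "0 \<le> r" "r < \<sigma>" "\<sigma> \<le> t"
      and bef: "\<forall>u\<in>{r..<\<sigma>}. N u = n \<and> e u = 1 - e t"
      and aft: "\<forall>u\<in>{\<sigma>..t}. N u = Suc n \<and> e u = e t"
      by (rule last_switching[OF Suc.prems(2) Suc.prems(1)])
    have "N r = n" "e r = 1 - e t"
      using bef[rule_format, of r] r(2) by simp_all
    moreover from Suc.IH[OF this(1) r(1)] have "e r = (if even n then e 0 else 1 - e 0)" .
    moreover have "e t = 1 - e r"
      using \<open>e r = 1 - e t\<close> state[OF Suc.prems(2)] by auto
    ultimately show ?case
      using state[of 0] by (cases "even n") auto
  qed
  then show "0 \<le> t \<Longrightarrow> e t = (if even (N t) then e 0 else 1 - e 0)"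
    by blast
qed

text \<open>
  The mesh \<open>t / K\<close> only has to be smaller than the gap between the last two switchings.
\<close>

lemma eventually_grid_detects_last_switching:
  fixes X :: "real \<Rightarrow> bool"
  assumes "0 < t" "i \<in> {0,1}"
    and X: "\<And>r \<sigma>. \<lbrakk>0 \<le> r; r < \<sigma>; \<sigma> \<le> t; N t = Suc n; e t = 1 - i;
         \<forall>u\<in>{r..<\<sigma>}. N u = n \<and> e u = i;
         \<forall>u\<in>{\<sigma>..t}. N u = Suc n \<and> e u = 1 - i\<rbrakk>
       \<Longrightarrow> \<forall>\<^sub>F s in at_left \<sigma>. X s = Y"
  shows "\<forall>\<^sub>F K in sequentially.
     (\<exists>k<K. N (real k * t / K) = n \<and> e (real k * t / K) = i \<and> X (real k * t / K)
        \<and> (\<forall>u\<in>{real (Suc k) * t / K..t}. e u = 1 - i))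
     \<longleftrightarrow> N t = Suc n \<and> e t = 1 - i \<and> Y"
proof (cases "N t")
  case 0
  then have const: "\<forall>u\<in>{0..t}. e u = e 0"
    using N_eq_0_iff[of t] assms(1) by (metis less_imp_le)
  show ?thesis
  proof (rule eventuallyI)
    fix K :: nat
    have False if "k < K" "e (real k * t / K) = i" "\<forall>u\<in>{real (Suc k) * t / K..t}. e u = 1 - i" for k
    proof -
      have "real k * t / K \<in> {0..t}" "t \<in> {real (Suc k) * t / K..t}"
        using that(1) assms(1) by (auto simp: field_simps simp flip: of_nat_Suc)
      then have "e (real k * t / K) = e t" "e t = 1 - i"
        using const[rule_format, of "real k * t / K"] const[rule_format, of t] that(3) assms(1)
        by simp_all
      then show False
        using that(2) assms(2) by auto
    qed
    then show "(\<exists>k<K. N (real k * t / K) = n \<and> e (real k * t / K) = i \<and> X (real k * t / K)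
        \<and> (\<forall>u\<in>{real (Suc k) * t / K..t}. e u = 1 - i)) \<longleftrightarrow> N t = Suc n \<and> e t = 1 - i \<and> Y"
      using 0 by auto
  qed
next
  case (Suc m)
  obtain r \<sigma> where r: "0 \<le> r" "r < \<sigma>" "\<sigma> \<le> t"
    and bef: "\<forall>u\<in>{r..<\<sigma>}. N u = m \<and> e u = 1 - e t"
    and aft: "\<forall>u\<in>{\<sigma>..t}. N u = Suc m \<and> e u = e t"
    by (rule last_switching[OF less_imp_le[OF assms(1)] Suc])
  define b where "b = (m = n \<and> e t = 1 - i)"
  \<comment> \<open>The hypothesis on \<open>X\<close> concerns only paths that end in
    \<open>1 - i\<close> after exactly \<open>Suc n\<close> switchings. For all others the grid test
    fails whatever \<open>X\<close> is, so any \<open>d\<close> will do.\<close>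
  have "\<exists>d<\<sigma>. \<forall>s>d. s < \<sigma> \<longrightarrow> (b \<longrightarrow> X s = Y)"
  proof (cases b)
    case True
    then have *: "m = n" "e t = 1 - i" "1 - e t = i"
      using assms(2) by (auto simp: b_def)
    have "\<forall>\<^sub>F s in at_left \<sigma>. X s = Y"
      by (rule X[of r]) (use r bef aft Suc * in simp_all)
    then show ?thesis
      by (auto simp: eventually_at_left_field)
  next
    case False
    then show ?thesis
      by (intro exI[of _ "\<sigma> - 1"]) auto
  qed
  then obtain d where d: "d < \<sigma>" "\<And>s. d < s \<Longrightarrow> s < \<sigma> \<Longrightarrow> b \<Longrightarrow> X s = Y"
    by metis
  \<comment> \<open>A cell that contains \<open>\<sigma>\<close> and is shorter than
    \<open>\<delta>\<close> starts after both \<open>d\<close> and \<open>r\<close>, where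
    \<open>X\<close> has its limit value and the count is \<open>m\<close>.\<close>
  define \<delta> where "\<delta> = \<sigma> - max d r"
  have "\<delta> > 0" using d r by (auto simp: \<delta>_def)
  have "(\<lambda>K. t / real K) \<longlonglongrightarrow> 0"
    by (rule lim_const_over_n)
  then have "\<forall>\<^sub>F K in sequentially. t / real K < \<delta>"
    using \<open>\<delta> > 0\<close> by (rule order_tendstoD)
  then show ?thesis
    using eventually_gt_at_top[of 0]
  proof eventually_elim
    case (elim K)
    define s where "s k = real k * t / K" for k
    have s_Suc: "s (Suc k) = s k + t / K" for k
      by (simp add: s_def add_divide_distrib algebra_simps)
    have s_le: "s k \<le> t" if "k \<le> K" for k
      using that assms(1) elim by (simp add: s_def field_simps)
    have s0: "0 \<le> s k" for k
      using assms(1) by (simp add: s_def)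
    have left: "(\<exists>k<K. N (s k) = n \<and> e (s k) = i \<and> X (s k) \<and> (\<forall>u\<in>{s (Suc k)..t}. e u = 1 - i))
        \<longleftrightarrow> m = n \<and> e t = 1 - i \<and> Y" (is "?L \<longleftrightarrow> ?R")
    proof
      assume ?L
      then obtain k where k: "k < K" "N (s k) = n" "e (s k) = i" "X (s k)"
        "\<And>u. s (Suc k) \<le> u \<Longrightarrow> u \<le> t \<Longrightarrow> e u = 1 - i"
        by auto
      have "e t = 1 - i"
        using k(5)[of t] s_le[of "Suc k"] k(1) by simp
      have "s k < \<sigma>"
      proof (rule ccontr)
        assume "\<not> s k < \<sigma>"
        then have "e (s k) = e t"
          using aft[rule_format, of "s k"] s_le[of k] k(1) by simp
        then show False
          using k(3) \<open>e t = 1 - i\<close> assms(2) by auto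
      qed
      moreover have "\<sigma> \<le> s (Suc k)"
      proof (rule ccontr)
        assume "\<not> \<sigma> \<le> s (Suc k)"
        \<comment> \<open>If the cell ended before \<open>\<sigma>\<close>, this point would lie
          before \<open>\<sigma>\<close>, where the state is the old one, but not before the end of
          the cell, from where on it has to be the new one.\<close>
        define u where "u = max r (s (Suc k))"
        have "e u = 1 - e t" "e u = 1 - i"
          using bef[rule_format, of u] k(5)[of u] \<open>\<not> \<sigma> \<le> s (Suc k)\<close> r(1-3) by (auto simp: u_def)
        then show False
          using \<open>e t = 1 - i\<close> assms(2) by auto
      qed
      ultimately have "max d r < s k"
        using elim(1) s_Suc[of k] unfolding \<delta>_def by linarith
      then have "N (s k) = m"
        using bef[rule_format, of "s k"] \<open>s k < \<sigma>\<close> by simp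
      then have "m = n" using k(2) by simp
      then have "X (s k) = Y"
        using d(2)[of "s k"] \<open>s k < \<sigma>\<close> \<open>max d r < s k\<close> \<open>e t = 1 - i\<close> by (simp add: b_def)
      then show ?R
        using k \<open>m = n\<close> \<open>e t = 1 - i\<close> by simp
    next
      assume R: ?R
      \<comment> \<open>The left-open cell that contains \<open>\<sigma>\<close>. Ceiling minus one,
        and not the floor, puts a \<open>\<sigma>\<close> on the grid at the right end of its cell,
        where the new state is already attained.\<close>
      define k where "k = nat (\<lceil>\<sigma> * K / t\<rceil> - 1)"
      have pos: "0 < \<sigma> * K / t" "\<sigma> * K / t \<le> K"
        using r assms(1) elim by (auto simp: field_simps)
      have c1: "\<lceil>\<sigma> * K / t\<rceil> \<ge> 1"
        using pos by simp
      then have rk: "real k = of_int \<lceil>\<sigma> * K / t\<rceil> - 1"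
        by (simp add: k_def)
      then have "real k < \<sigma> * K / t" "\<sigma> * K / t \<le> real k + 1"
        by linarith+
      then have sk: "s k < \<sigma>" "\<sigma> \<le> s (Suc k)"
        using elim assms(1) by (auto simp: s_def field_simps)
      have "\<lceil>\<sigma> * K / t\<rceil> \<le> int K"
        using pos(2) by (simp add: ceiling_le_iff)
      then have "k < K"
        using c1 unfolding k_def by linarith
      have "max d r < s k"
        using elim(1) s_Suc[of k] sk unfolding \<delta>_def by linarith
      have "N (s k) = m \<and> e (s k) = 1 - e t"
        using bef[rule_format, of "s k"] sk \<open>max d r < s k\<close> by simp
      moreover have "X (s k) = Y"
        using d(2)[of "s k"] sk \<open>max d r < s k\<close> R by (simp add: b_def)
      moreover have "\<forall>u\<in>{s (Suc k)..t}. e u = 1 - i"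
        using aft sk(2) R by simp
      ultimately show ?L
        using R \<open>k < K\<close> assms(2) by (intro exI[of _ k]) auto
    qed
    show ?case
      using left Suc unfolding s_def by (simp del: of_nat_Suc)
  qed
qed

text \<open>By continuity the last switching \<open>\<sigma>\<close> up to \<open>s\<close> is not
  \<open>s\<close> itself, so the constant piece that follows it is a nontrivial interval ending at
  \<open>s\<close>.\<close>

lemma eventually_left_not_switching:
  assumes "0 < s" "isCont e s"
  obtains r where "0 \<le> r" "r < s" "\<forall>u\<in>{r..s}. e u = e s \<and> N u = N s"
proof (cases "N s")
  case 0
  then have "\<forall>u\<in>{0..s}. e u = e 0"
    using N_eq_0_iff[of s] assms(1) by (metis less_imp_le)
  then have "\<forall>u\<in>{0..s}. e u = e s"
    using assms(1) by (metis atLeastAtMost_iff less_imp_le order_refl)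
  moreover have "N u = N s" if "u \<le> s" for u
    using N_mono[OF that] 0 by simp
  ultimately have const: "\<forall>u\<in>{0..s}. e u = e s \<and> N u = N s"
    by (metis atLeastAtMost_iff)
  show thesis
    by (rule that[OF order_refl assms(1) const])
next
  case (Suc m)
  obtain r \<sigma> where r: "0 \<le> r" "r < \<sigma>" "\<sigma> \<le> s"
    and bef: "\<forall>u\<in>{r..<\<sigma>}. N u = m \<and> e u = 1 - e s"
    and aft: "\<forall>u\<in>{\<sigma>..s}. N u = Suc m \<and> e u = e s"
    by (rule last_switching[OF less_imp_le[OF assms(1)] Suc])
  have "\<forall>\<^sub>F u in at_left s. e u = e s"
    using assms(2) unfolding continuous_at_split    by (simp add: continuous_within tendsto_discrete)
  then obtain d where d: "d < s" "\<And>u. d < u \<Longrightarrow> u < s \<Longrightarrow> e u = e s"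
    by (auto simp: eventually_at_left_field)
  have "\<sigma> \<noteq> s"
  proof
    assume "\<sigma> = s"
    \<comment> \<open>A point in both left neighbourhoods of \<open>s\<close>: continuity makes its
      state \<open>e s\<close>, a switching at \<open>s\<close> makes it the other one.\<close>
    define u where "u = (max d r + s) / 2"
    have "d < u" "u < s" "r < u" using d(1) r(2) \<open>\<sigma> = s\<close> by (auto simp: u_def max_def)
    then have "e u = e s" "e u = 1 - e s"
      using d(2)[of u] bef[rule_format, of u] \<open>\<sigma> = s\<close> by simp_all
    then show False using state[of s] assms(1) by auto
  qed
  then have "0 \<le> \<sigma>" "\<sigma> < s"
    using r by auto
  moreover have "\<forall>u\<in>{\<sigma>..s}. e u = e s \<and> N u = N s"
    using aft unfolding Suc by blast
  ultimately show thesis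
    by (rule that)
qed


section \<open>The position as the integral of the velocity\<close>

abbreviation G :: "(nat \<Rightarrow> real) \<Rightarrow> real \<Rightarrow> real" where
  "G v u \<equiv> integral {0..u} (\<lambda>s. v (e s))"

text \<open>The interval is half-open because at a switching the state is already the new one; for
  the integral the end point is a single exceptional point.\<close>

lemma has_integral_const_left:
  fixes v :: "nat \<Rightarrow> real"
  assumes "\<forall>u\<in>{a..<b}. e u = c" "a \<le> b"
  shows "((\<lambda>s. v (e s)) has_integral v c * (b - a)) {a..b}"
proof (rule has_integral_spike_finite[of "{b}"])
  show "((\<lambda>s. v c) has_integral v c * (b - a)) {a..b}"
    using has_integral_const_real[of "v c" a b] assms(2) by (simp add: mult.commute)
qed (use assms(1) in auto)

lemma velocity_integrable:
  fixes v :: "nat \<Rightarrow> real"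
  assumes "0 \<le> a"
  shows "(\<lambda>s. v (e s)) integrable_on {a..b}"
proof -
  have "N t = n \<Longrightarrow> 0 \<le> t \<Longrightarrow> (\<lambda>s. v (e s)) integrable_on {0..t}" for n t
  proof (induction n arbitrary: t)
    case 0
    then have "\<forall>u\<in>{0..t}. e u = e 0"
      using N_eq_0_iff[of t] by blast
    then have "\<forall>u\<in>{0..<t}. e u = e 0"
      by (metis atLeastAtMost_iff atLeastLessThan_iff less_imp_le)
    from has_integral_const_left[OF this] 0 show ?case
      by (auto simp: integrable_on_def)
  next
    case (Suc n)
    obtain r \<sigma> where r: "0 \<le> r" "r < \<sigma>" "\<sigma> \<le> t"
      and bef: "\<forall>u\<in>{r..<\<sigma>}. N u = n \<and> e u = 1 - e t"
      and aft: "\<forall>u\<in>{\<sigma>..t}. N u = Suc n \<and> e u = e t"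
      by (rule last_switching[OF Suc.prems(2) Suc.prems(1)])
    have "(\<lambda>s. v (e s)) integrable_on {0..r}"
      using bef[rule_format, of r] r by (intro Suc.IH) simp_all
    moreover have "(\<lambda>s. v (e s)) integrable_on {r..\<sigma>}"
      using has_integral_const_left[of r \<sigma> "1 - e t" v] bef r unfolding integrable_on_def by (metis less_imp_le)
    ultimately have "(\<lambda>s. v (e s)) integrable_on {0..\<sigma>}"
      using r Henstock_Kurzweil_Integration.integrable_combine[of 0 r \<sigma> "\<lambda>s. v (e s)"] by simp
    moreover have "\<forall>u\<in>{\<sigma>..<t}. e u = e t"
      using aft by (metis atLeastAtMost_iff atLeastLessThan_iff less_imp_le)
    then have "(\<lambda>s. v (e s)) integrable_on {\<sigma>..t}"
      using has_integral_const_left[of \<sigma> t "e t" v] r unfolding integrable_on_def by metis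
    ultimately show ?case
      using r Henstock_Kurzweil_Integration.integrable_combine[of 0 \<sigma> t "\<lambda>s. v (e s)"] by simp
  qed
  from this[of "max 0 b"] have "(\<lambda>s. v (e s)) integrable_on {0..max 0 b}"
    by simp
  then show ?thesis
    by (rule integrable_subinterval_real) (use assms in auto)
qed

lemma G_linear:
  assumes "0 \<le> a" "a \<le> b" "\<forall>u\<in>{a..<b}. e u = c"
  shows "G v b = G v a + v c * (b - a)"
proof -
  have "G v a + integral {a..b} (\<lambda>s. v (e s)) = G v b"
    using assms velocity_integrable by (intro Henstock_Kurzweil_Integration.integral_combine) auto
  then show ?thesis
    using integral_unique[OF has_integral_const_left[OF assms(3,2), of v]] by simp
qed

lemma G_continuous: "continuous_on {0..t} (G v)"
  by (intro indefinite_integral_continuous_1 velocity_integrable) simp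

lemma G_tendsto_left:
  assumes "0 \<le> r" "r < \<sigma>"
  shows "(G v \<longlongrightarrow> G v \<sigma>) (at_left \<sigma>)"
proof -
  have "(G v \<longlongrightarrow> G v \<sigma>) (at \<sigma> within {0..\<sigma>})"
    using G_continuous[of \<sigma> v] assms by (simp add: continuous_on_def)
  then show ?thesis
    using assms by (simp add: at_within_Icc_at_left)
qed

lemma G_nonneg_left:
  assumes "0 \<le> r" "r < \<sigma>" "\<And>u. 0 \<le> u \<Longrightarrow> u < \<sigma> \<Longrightarrow> 0 \<le> G v u"
  shows "0 \<le> G v \<sigma>"
proof (rule tendsto_lowerbound[OF G_tendsto_left[OF assms(1,2)]])
  show "\<forall>\<^sub>F u in at_left \<sigma>. 0 \<le> G v u"
    unfolding eventually_at_left_field using assms by (intro exI[of _ r]) auto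
qed simp

text \<open>The factor \<open>v i - v (1 - i)\<close> orients the half-line: the condition is
  \<open>y < x\<close> or \<open>x < y\<close> for the extrapolated end point \<open>x\<close>,
  according to the sign of the velocity jump.\<close>

definition reach :: "(nat \<Rightarrow> real) \<Rightarrow> nat \<Rightarrow> real \<Rightarrow> real \<Rightarrow> real \<Rightarrow> bool" where
  "reach v i t y s \<longleftrightarrow> (\<forall>u\<in>{0..s}. 0 \<le> G v u) \<and>
     (v i - v (1 - i)) * y < (v i - v (1 - i)) * (G v s + v (1 - i) * (t - s))"

text \<open>
  While the state is \<open>i\<close>, the derivative of \<open>(v i - v (1 - i)) * (G v s + v (1 - i) * (t - s))\<close> in \<open>s\<close>
  is a square.  So this quantity increases to its limit, and no path is lost on the boundary of
  the open half-line.
\<close>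

lemma eventually_reach_left:
  assumes r: "0 \<le> r" "r < \<sigma>" and const: "\<forall>u\<in>{r..<\<sigma>}. e u = i"
  shows "\<forall>\<^sub>F s in at_left \<sigma>. reach v i t y s = reach v i t y \<sigma>"
proof (cases "\<forall>u\<in>{0..\<sigma>}. 0 \<le> G v u")
  case False
  \<comment> \<open>By continuity, a violation somewhere up to \<open>\<sigma>\<close> entails one
    strictly before \<open>\<sigma>\<close>, and that one is seen at every later
    \<open>s\<close>.\<close>
  have "\<exists>u. 0 \<le> u \<and> u < \<sigma> \<and> G v u < 0"
  proof (rule ccontr)
    assume *: "\<nexists>u. 0 \<le> u \<and> u < \<sigma> \<and> G v u < 0"
    then have "0 \<le> G v \<sigma>"
      by (intro G_nonneg_left[OF r]) force
    then show False
      using * False by (metis atLeastAtMost_iff le_less not_le)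
  qed
  then obtain u where u: "0 \<le> u" "u < \<sigma>" "G v u < 0" by blast
  have "\<forall>\<^sub>F s in at_left \<sigma>. \<not> reach v i t y s"
    unfolding eventually_at_left_field
  proof (intro exI[of _ u] conjI allI impI u)
    fix s assume "u < s" "s < \<sigma>"
    then show "\<not> reach v i t y s"
      using u unfolding reach_def by (metis atLeastAtMost_iff less_imp_le not_le)
  qed
  moreover have "\<not> reach v i t y \<sigma>"
    using False unfolding reach_def by blast
  ultimately show ?thesis
    by simp
next
  case True
  define w where "w = v i - v (1 - i)"
  define f where "f s = w * (G v s + v (1 - i) * (t - s))" for s
  have f: "f s = f \<sigma> - w\<^sup>2 * (\<sigma> - s)" if "r \<le> s" "s < \<sigma>" for s
  proof -
    have G\<sigma>: "G v \<sigma> = G v s + v i * (\<sigma> - s)"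
      using that const r by (intro G_linear) auto
    show ?thesis
      unfolding f_def w_def G\<sigma> by (simp add: power2_eq_square algebra_simps)
  qed
  have reach: "reach v i t y s \<longleftrightarrow> w * y < f s" if "s \<le> \<sigma>" for s
    using that True unfolding reach_def f_def w_def by auto
  show ?thesis
  proof (cases "w * y < f \<sigma>")
    case True
    have "((\<lambda>s. f \<sigma> - w\<^sup>2 * (\<sigma> - s)) \<longlongrightarrow> f \<sigma> - w\<^sup>2 * (\<sigma> - \<sigma>)) (at_left \<sigma>)"
      by (intro tendsto_intros)
    then have "\<forall>\<^sub>F s in at_left \<sigma>. w * y < f \<sigma> - w\<^sup>2 * (\<sigma> - s)"
      using True by (intro order_tendstoD(1)) auto
    then have "\<forall>\<^sub>F s in at_left \<sigma>. w * y < f \<sigma> - w\<^sup>2 * (\<sigma> - s) \<and> r < s \<and> s < \<sigma>"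
      using r by (auto simp: eventually_conj_iff eventually_at_left_field)
    then show ?thesis
      by eventually_elim (use f reach True in auto)
  next
    case False
    have "\<forall>\<^sub>F s in at_left \<sigma>. r < s \<and> s < \<sigma>"
      using r by (auto simp: eventually_at_left_field)
    then show ?thesis
    proof eventually_elim
      case (elim s)
      then have "f s \<le> f \<sigma>"
        using f[of s] by simp
      then show ?case
        using False reach elim by auto
    qed
  qed
qed

text \<open>For a path with \<open>Suc n\<close> switchings this is nonnegativity up to the last
  switching, expressed by the count so that the random time of that switching is not
  mentioned.\<close>

definition nonneg_until_last :: "(nat \<Rightarrow> real) \<Rightarrow> nat \<Rightarrow> real \<Rightarrow> bool" where
  "nonneg_until_last v n t \<longleftrightarrow> (\<forall>u\<in>{0..t}. N u \<le> n \<longrightarrow> 0 \<le> G v u)"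

text \<open>At \<open>\<sigma>\<close> the count is already \<open>Suc n\<close>; nonnegativity at
  that point is recovered as a left limit.\<close>

lemma nonneg_until_last_iff:
  assumes r: "0 \<le> r" "r < \<sigma>" "\<sigma> \<le> t"
    and bef: "\<forall>u\<in>{r..<\<sigma>}. N u = n"
    and aft: "\<forall>u\<in>{\<sigma>..t}. N u = Suc n"
  shows "nonneg_until_last v n t \<longleftrightarrow> (\<forall>u\<in>{0..\<sigma>}. 0 \<le> G v u)"
proof
  assume *: "nonneg_until_last v n t"
  have "0 \<le> G v u" if "0 \<le> u" "u < \<sigma>" for u
  proof -
    have "N u \<le> N (max r u)"
      by (intro N_mono) simp
    also have "\<dots> = n"
      using bef r that by simp
    finally show ?thesis
      using * that r by (simp add: nonneg_until_last_def)
  qed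
  with G_nonneg_left[OF r(1,2)] show "\<forall>u\<in>{0..\<sigma>}. 0 \<le> G v u"
    by (metis atLeastAtMost_iff le_less)
next
  assume *: "\<forall>u\<in>{0..\<sigma>}. 0 \<le> G v u"
  show "nonneg_until_last v n t"
    unfolding nonneg_until_last_def
  proof (intro ballI impI)
    fix u assume u: "u \<in> {0..t}" "N u \<le> n"
    then have "u < \<sigma>"
      using aft[rule_format, of u] by force
    then show "0 \<le> G v u"
      using * u by simp
  qed
qed

text \<open>After the last switching the path is a straight segment, whose minimum is at one of its
  ends. So beyond \<open>\<sigma>\<close> only the final time adds a condition.\<close>

lemma nonneg_iff:
  assumes "0 \<le> t" "N t = Suc n"
  shows "(\<forall>u\<in>{0..t}. 0 \<le> G v u) \<longleftrightarrow> nonneg_until_last v n t \<and> 0 \<le> G v t"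
proof
  assume *: "nonneg_until_last v n t \<and> 0 \<le> G v t"
  obtain r \<sigma> where r: "0 \<le> r" "r < \<sigma>" "\<sigma> \<le> t"
    and bef: "\<forall>u\<in>{r..<\<sigma>}. N u = n \<and> e u = 1 - e t"
    and aft: "\<forall>u\<in>{\<sigma>..t}. N u = Suc n \<and> e u = e t"
    by (rule last_switching[OF assms])
  have G\<sigma>: "\<forall>u\<in>{0..\<sigma>}. 0 \<le> G v u"
    using nonneg_until_last_iff[of r \<sigma> t n v] * r bef aft by blast
  have lin: "G v u = G v \<sigma> + v (e t) * (u - \<sigma>)" if "\<sigma> \<le> u" "u \<le> t" for u
  proof (rule G_linear)
    show "\<forall>s\<in>{\<sigma>..<u}. e s = e t"
      using aft that by (metis atLeastAtMost_iff atLeastLessThan_iff less_imp_le order.trans)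
  qed (use r that in auto)
  show "\<forall>u\<in>{0..t}. 0 \<le> G v u"
  proof
    fix u assume u: "u \<in> {0..t}"
    show "0 \<le> G v u"
    proof (cases "u \<le> \<sigma>")
      case False
      have 0: "0 \<le> G v \<sigma>" "0 \<le> G v t"
        using G\<sigma> r * by auto
      have 1: "G v u = G v \<sigma> + v (e t) * (u - \<sigma>)" "G v t = G v \<sigma> + v (e t) * (t - \<sigma>)"
        by (rule lin; use u False r in auto)+
      show ?thesis
      proof (cases "0 \<le> v (e t)")
        case True
        then show ?thesis using 0 1 False by simp
      next
        case neg: False
        have "v (e t) * (t - \<sigma>) \<le> v (e t) * (u - \<sigma>)"
          using neg u by (intro mult_left_mono_neg) auto
        then show ?thesis using 0 1 by linarith
      qed
    qed (use G\<sigma> u in auto)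
  qed
qed (use assms in \<open>auto simp: nonneg_until_last_def\<close>)

text \<open>Extrapolation from a grid point before \<open>\<sigma>\<close> with the new velocity
  misses the true end point by the movement between that point and \<open>\<sigma>\<close>. The left
  limit of \<open>reach\<close> at \<open>\<sigma>\<close> absorbs this error, and extrapolation
  from \<open>\<sigma>\<close> itself is exact.\<close>

lemma eventually_grid_reach:
  assumes "0 < t" "i \<in> {0,1}"
  shows "\<forall>\<^sub>F K in sequentially.
     (\<exists>k<K. N (real k * t / K) = n \<and> e (real k * t / K) = i \<and> reach v i t y (real k * t / K)
        \<and> (\<forall>u\<in>{real (Suc k) * t / K..t}. e u = 1 - i))
     \<longleftrightarrow> N t = Suc n \<and> e t = 1 - i \<and> nonneg_until_last v n t
        \<and> (v i - v (1 - i)) * y < (v i - v (1 - i)) * G v t"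
proof (rule eventually_grid_detects_last_switching[OF assms])
  fix r \<sigma> assume r: "0 \<le> r" "r < \<sigma>" "\<sigma> \<le> t" and "N t = Suc n" "e t = 1 - i"
    and bef: "\<forall>u\<in>{r..<\<sigma>}. N u = n \<and> e u = i"
    and aft: "\<forall>u\<in>{\<sigma>..t}. N u = Suc n \<and> e u = 1 - i"
  have "G v t = G v \<sigma> + v (1 - i) * (t - \<sigma>)"
  proof (rule G_linear)
    show "\<forall>s\<in>{\<sigma>..<t}. e s = 1 - i"
      using aft by (metis atLeastAtMost_iff atLeastLessThan_iff less_imp_le)
  qed (use r in auto)
  moreover have "nonneg_until_last v n t \<longleftrightarrow> (\<forall>u\<in>{0..\<sigma>}. 0 \<le> G v u)"
    using bef aft by (intro nonneg_until_last_iff[OF r]) blast+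
  ultimately have "reach v i t y \<sigma> \<longleftrightarrow> nonneg_until_last v n t
        \<and> (v i - v (1 - i)) * y < (v i - v (1 - i)) * G v t"
    by (simp add: reach_def)
  moreover have "\<forall>\<^sub>F s in at_left \<sigma>. reach v i t y s = reach v i t y \<sigma>"
    using bef by (intro eventually_reach_left[OF r(1,2)]) blast
  ultimately show "\<forall>\<^sub>F s in at_left \<sigma>. reach v i t y s =
      (nonneg_until_last v n t \<and> (v i - v (1 - i)) * y < (v i - v (1 - i)) * G v t)"
    by simp
qed

text \<open>If \<open>e s = i\<close>, the path has state \<open>i\<close> just before
  \<open>s\<close>, which is the situation of \<open>eventually_reach_left\<close>; otherwise both
  sides fail because of the state.\<close>

lemma eventually_left_event:
  assumes "0 < s" "isCont e s"
  shows "\<forall>\<^sub>F u in at_left s. (N u = n \<and> e u = i \<and> reach v i t y u)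
     \<longleftrightarrow> (N s = n \<and> e s = i \<and> reach v i t y s)"
proof -
  obtain r where r: "0 \<le> r" "r < s" and const: "\<forall>u\<in>{r..s}. e u = e s \<and> N u = N s"
    by (rule eventually_left_not_switching[OF assms])
  have ev: "\<forall>\<^sub>F u in at_left s. e u = e s \<and> N u = N s"
    unfolding eventually_at_left_field
    by (intro exI[of _ r]) (use r const in \<open>metis atLeastAtMost_iff less_imp_le\<close>)
  show ?thesis
  proof (cases "e s = i")
    case True
    then have "\<forall>u\<in>{r..<s}. e u = i"
      using const by (metis atLeastAtMost_iff atLeastLessThan_iff less_imp_le)
    from eventually_reach_left[OF r this, of v t y] ev show ?thesis
      by eventually_elim (simp only:)
  next
    case False
    from ev show ?thesis
      by eventually_elim (simp add: False)
  qed
qed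

end

section \<open>The Markov property for the whole past\<close>

text \<open>Both \<open>1 - q h\<close> and \<open>exp (- l * h)\<close> lie in the unit interval,
  so their powers with exponent \<open>Suc n\<close> differ by at most \<open>Suc n\<close> times
  the difference of the bases. That difference is o(h), since both have the same first-order
  term.\<close>

lemma tendsto_power_exp:
  fixes q :: "real \<Rightarrow> real"
  assumes q: "((\<lambda>h. q h / h) \<longlongrightarrow> l) (at_right 0)" and "0 < T"
    and q01: "\<And>h. 0 < h \<Longrightarrow> 0 \<le> q h \<and> q h \<le> 1" and "0 \<le> l"
  shows "(\<lambda>n. (1 - q (T / Suc n)) ^ Suc n) \<longlonglongrightarrow> exp (- l * T)"
proof -
  have "(\<lambda>n. T / real (Suc n)) \<longlonglongrightarrow> 0"
    using LIMSEQ_Suc[OF lim_const_over_n[of T]] by simp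
  then have h: "filterlim (\<lambda>n. T / real (Suc n)) (at_right 0) sequentially"
    using \<open>0 < T\<close> by (simp add: filterlim_at)
  have 1: "(\<lambda>n. q (T / Suc n) / (T / Suc n)) \<longlonglongrightarrow> l"
    using filterlim_compose[OF q h] .
  have "((\<lambda>h. (exp (- l * h) - 1) / h) \<longlongrightarrow> - l) (at 0)"
  proof -
    have "((\<lambda>h. exp (- l * h)) has_real_derivative (- l)) (at 0)"
      by (auto intro!: derivative_eq_intros)
    then show ?thesis
      by (simp add: has_field_derivative_def has_derivative_at DERIV_def flip: has_field_derivative_def)
  qed
  then have "((\<lambda>h. (exp (- l * h) - 1) / h) \<longlongrightarrow> - l) (at_right 0)"
    by (rule filterlim_mono) (simp_all add: at_le)
  from filterlim_compose[OF this h]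
  have 2: "(\<lambda>n. (exp (- l * (T / Suc n)) - 1) / (T / Suc n)) \<longlonglongrightarrow> - l" .
  \<comment> \<open>With \<open>h = T / Suc n\<close>, this is exactly \<open>Suc n\<close> times
    the distance of the two bases.\<close>
  have "(\<lambda>n. T * \<bar>q (T / Suc n) / (T / Suc n) + (exp (- l * (T / Suc n)) - 1) / (T / Suc n)\<bar>) \<longlonglongrightarrow> T * \<bar>l + - l\<bar>"
    by (intro tendsto_intros 1 2)
  then have 3: "(\<lambda>n. T * \<bar>q (T / Suc n) / (T / Suc n) + (exp (- l * (T / Suc n)) - 1) / (T / Suc n)\<bar>) \<longlonglongrightarrow> 0"
    by simp
  have "(\<lambda>n. (1 - q (T / Suc n)) ^ Suc n - exp (- l * T)) \<longlonglongrightarrow> 0"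
  proof (rule tendsto_0_le[OF 3, where K = 1], intro eventuallyI)
    fix n
    define h where "h = T / Suc n"
    have "h > 0" using \<open>0 < T\<close> by (simp add: h_def)
    have "exp (- l * T) = exp (- l * h) ^ Suc n"
      by (simp add: h_def flip: exp_of_nat_mult del: power_Suc)
    moreover have "norm ((1 - q h) ^ Suc n - exp (- l * h) ^ Suc n) \<le> Suc n * norm (1 - q h - exp (- l * h))"
      using q01[OF \<open>h > 0\<close>] \<open>0 \<le> l\<close> \<open>h > 0\<close> by (intro norm_power_diff) auto
    moreover have "Suc n * norm (1 - q h - exp (- l * h)) = T * \<bar>q h / h + (exp (- l * h) - 1) / h\<bar>"
    proof -
      have "q h / h + (exp (- l * h) - 1) / h = - (1 - q h - exp (- l * h)) / h"
        by (simp add: diff_divide_distrib add_divide_distrib)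
      then have "\<bar>q h / h + (exp (- l * h) - 1) / h\<bar> = \<bar>1 - q h - exp (- l * h)\<bar> / h"
        using \<open>h > 0\<close> by (simp only: abs_divide abs_minus_cancel abs_of_pos)
      moreover have "T = Suc n * h" by (simp add: h_def)
      ultimately show ?thesis
        using \<open>h > 0\<close> by simp
    qed
    ultimately show "norm ((1 - q (T / Suc n)) ^ Suc n - exp (- l * T))
        \<le> norm (T * \<bar>q (T / Suc n) / (T / Suc n) + (exp (- l * (T / Suc n)) - 1) / (T / Suc n)\<bar>) * 1"
      using \<open>0 < T\<close> unfolding h_def[symmetric] by (simp del: power_Suc of_nat_Suc)
  qed
  then show ?thesis
    by (rule LIM_zero_cancel)
qed

text \<open>Dominated convergence of the indicators. The grid events are not monotone in the mesh,
  so continuity of the measure along monotone sequences would not apply.\<close>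

lemma (in prob_space) prob_tendsto:
  assumes "\<And>K. A K \<in> events" "B \<in> events" "AE \<omega> in M. \<forall>\<^sub>F K in sequentially. \<omega> \<in> A K \<longleftrightarrow> \<omega> \<in> B"
  shows "(\<lambda>K. prob (A K)) \<longlonglongrightarrow> prob B"
proof -
  have "(\<lambda>K. \<integral>\<omega>. indicator (A K) \<omega> \<partial>M) \<longlonglongrightarrow> (\<integral>\<omega>. indicator B \<omega> \<partial>M :: real)"
  proof (rule integral_dominated_convergence[where w = "\<lambda>_. 1"])
    show "AE \<omega> in M. (\<lambda>K. indicator (A K) \<omega> :: real) \<longlonglongrightarrow> indicator B \<omega>"
      using assms(3)
    proof eventually_elim
      case (elim \<omega>)
      then have "\<forall>\<^sub>F K in sequentially. indicator (A K) \<omega> = (indicator B \<omega> :: real)"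
        by eventually_elim (simp add: indicator_def)
      then show ?case
        by (rule tendsto_eventually)
    qed
  qed (use assms in \<open>auto simp: indicator_def\<close>)
  then show ?thesis
    using assms by simp
qed

locale two_state_transitions = two_state_markov_process +
  fixes p :: "real \<Rightarrow> nat \<Rightarrow> nat \<Rightarrow> real"
  assumes lam_pos: "0 < lam 0" "0 < lam 1"
    and transition: "transition_function lam p"
    and markov_p: "\<lbrakk>j \<in> {0,1}; 0 \<le> \<tau> 0; \<forall>k\<le>n. \<tau> k < \<tau> (Suc k);
        \<P>(\<omega> in M. \<forall>k\<le>n. \<epsilon> (\<tau> k) \<omega> = i k) > 0\<rbrakk>
      \<Longrightarrow> \<P>(\<omega> in M. \<epsilon> (\<tau> (Suc n)) \<omega> = j \<bar> \<forall>k\<le>n. \<epsilon> (\<tau> k) \<omega> = i k) = p (\<tau> (Suc n) - \<tau> n) (i n) j"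
begin

lemma state_01: "\<omega> \<in> space M \<Longrightarrow> 0 \<le> u \<Longrightarrow> \<epsilon> u \<omega> \<in> {0,1}"
  using measurable_space[OF random_variable_state] by auto

lemma path: "\<omega> \<in> space M \<Longrightarrow> step_path (\<lambda>s. \<epsilon> s \<omega>)"
  using state_01 right_continuous finite_switchings by (intro step_path.intro) auto

lemma state_event: "0 \<le> u \<Longrightarrow> {\<omega> \<in> space M. \<epsilon> u \<omega> = j} \<in> events"
proof -
  assume "0 \<le> u"
  then have "\<epsilon> u -` ({j} \<inter> {0,1}) \<inter> space M \<in> events"
    by (intro measurable_sets[OF random_variable_state]) auto
  also have "\<epsilon> u -` ({j} \<inter> {0,1}) \<inter> space M = {\<omega> \<in> space M. \<epsilon> u \<omega> = j}"
    using state_01[OF _ \<open>0 \<le> u\<close>] by auto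
  finally show ?thesis .
qed

section \<open>The natural filtration and the Markov property with respect to it\<close>

text \<open>The empty set is included so that two contradictory cylinders still intersect in a
  member of the family.\<close>

definition cylinders :: "real \<Rightarrow> 'a set set" where
  "cylinders s = insert {} {{\<omega> \<in> space M. \<forall>u\<in>U. \<epsilon> u \<omega> = f u} | U f. finite U \<and> U \<subseteq> {0..s}}"

definition past :: "real \<Rightarrow> 'a measure" where
  "past s = sigma (space M) (cylinders s)"

lemma cylinders_subset: "cylinders s \<subseteq> Pow (space M)"
  by (auto simp: cylinders_def)

lemma space_past [simp]: "space (past s) = space M"
  using cylinders_subset by (simp add: past_def space_measure_of)

lemma sets_past: "sets (past s) = sigma_sets (space M) (cylinders s)"
  using cylinders_subset by (simp add: past_def sets_measure_of)

lemma cylinder_event: "finite U \<Longrightarrow> U \<subseteq> {0..} \<Longrightarrow> {\<omega> \<in> space M. \<forall>u\<in>U. \<epsilon> u \<omega> = f u} \<in> events"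
  by (intro sets.sets_Collect_finite_All state_event) auto

lemma past_subset_events: "E \<in> sets (past s) \<Longrightarrow> E \<in> events"
proof -
  have "cylinders s \<subseteq> events"
    unfolding cylinders_def by (auto intro!: cylinder_event)
  then have "sigma_sets (space M) (cylinders s) \<subseteq> events"
    by (rule sets.sigma_sets_subset)
  then show "E \<in> sets (past s) \<Longrightarrow> E \<in> events"
    by (auto simp: sets_past)
qed

lemma past_mono: "s \<le> t \<Longrightarrow> E \<in> sets (past s) \<Longrightarrow> E \<in> sets (past t)"
proof -
  assume "s \<le> t"
  then have "cylinders s \<subseteq> cylinders t"
    unfolding cylinders_def by force
  then have "sigma_sets (space M) (cylinders s) \<subseteq> sigma_sets (space M) (cylinders t)"
    by (rule sigma_sets_mono')
  then show "E \<in> sets (past s) \<Longrightarrow> E \<in> sets (past t)"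
    by (auto simp: sets_past)
qed

lemma state_past: "0 \<le> u \<Longrightarrow> u \<le> s \<Longrightarrow> {\<omega> \<in> space M. \<epsilon> u \<omega> = j} \<in> sets (past s)"
proof -
  assume "0 \<le> u" "u \<le> s"
  then have "{\<omega> \<in> space M. \<forall>u\<in>{u}. \<epsilon> u \<omega> = (\<lambda>_. j) u} \<in> cylinders s"
    unfolding cylinders_def by (intro insertI2 CollectI exI[of _ "{u}"] exI[of _ "\<lambda>_. j"] conjI refl) auto
  then show ?thesis
    unfolding sets_past by (intro sigma_sets.Basic) simp
qed

text \<open>A common point \<open>\<omega>\<close> of two cylinders supplies one prescription,
  \<open>\<lambda>u. \<epsilon> u \<omega>\<close>, that serves on the union of their time
  sets.\<close>

lemma Int_stable_cylinders: "Int_stable (cylinders s)"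
proof (rule Int_stableI)
  fix A B assume AB: "A \<in> cylinders s" "B \<in> cylinders s"
  show "A \<inter> B \<in> cylinders s"
  proof (cases "A \<inter> B = {}")
    case True
    then show ?thesis by (simp add: cylinders_def)
  next
    case False
    then obtain \<omega> where \<omega>: "\<omega> \<in> A" "\<omega> \<in> B" by blast
    obtain U f where A: "A = {\<omega> \<in> space M. \<forall>u\<in>U. \<epsilon> u \<omega> = f u}" "finite U" "U \<subseteq> {0..s}"
      using AB(1) \<omega> unfolding cylinders_def by auto
    obtain V g where B: "B = {\<omega> \<in> space M. \<forall>u\<in>V. \<epsilon> u \<omega> = g u}" "finite V" "V \<subseteq> {0..s}"
      using AB(2) \<omega> unfolding cylinders_def by auto
    have "A \<inter> B = {\<omega>' \<in> space M. \<forall>u\<in>U \<union> V. \<epsilon> u \<omega>' = \<epsilon> u \<omega>}"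
      using \<omega> unfolding A B by auto
    moreover have "finite (U \<union> V)" "U \<union> V \<subseteq> {0..s}"
      using A B by auto
    ultimately show ?thesis
      unfolding cylinders_def by (intro insertI2 CollectI exI conjI)
  qed
qed

text \<open>The assumption is about increasing tuples and conditional probabilities. Sorting
  \<open>U\<close> gives the tuple, with its maximum \<open>s\<close> in last place; multiplying out
  makes a null condition read 0 = 0.\<close>

lemma markov_cylinder:
  assumes "finite U" "U \<subseteq> {0..s}" "s \<in> U" "0 < h" "j \<in> {0,1}"
  shows "prob {\<omega> \<in> space M. (\<forall>u\<in>U. \<epsilon> u \<omega> = f u) \<and> \<epsilon> (s + h) \<omega> = j}
       = prob {\<omega> \<in> space M. \<forall>u\<in>U. \<epsilon> u \<omega> = f u} * p h (f s) j"
proof -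
  define xs where "xs = sorted_list_of_set U"
  define n where "n = length xs - 1"
  \<comment> \<open>The entries of \<open>xs\<close> up to index \<open>n\<close>, followed by the
    future time \<open>s + h\<close> at index \<open>Suc n\<close>.\<close>
  define \<tau> where "\<tau> k = (if k \<le> n then xs ! k else s + h)" for k
  have xs: "set xs = U" "sorted_wrt (<) xs"
    using assms(1) unfolding xs_def by auto
  then have "xs \<noteq> []" using assms(3) by auto
  then have len: "length xs = Suc n" by (simp add: n_def)
  have le: "k \<le> n \<Longrightarrow> xs ! k \<in> U" for k
    using xs len by (metis le_imp_less_Suc nth_mem)
  obtain m where m: "m \<le> n" "xs ! m = s"
    using assms(3) xs(1) len by (metis in_set_conv_nth less_Suc_eq_le)
  have "m = n"
  proof (rule ccontr)
    assume "m \<noteq> n"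
    then have "xs ! m < xs ! n"
      using m xs(2) len by (intro sorted_wrt_nth_less[of "(<)" xs]) auto
    then show False
      using m(2) le[of n] assms(2) by auto
  qed
  have \<tau>n: "\<tau> n = s" "\<tau> (Suc n) = s + h"
    using m \<open>m = n\<close> by (auto simp: \<tau>_def)
  have "0 \<le> \<tau> 0"
    using le[of 0] assms(2) by (auto simp: \<tau>_def)
  moreover have "\<forall>k\<le>n. \<tau> k < \<tau> (Suc k)"
  proof (intro allI impI)
    fix k assume "k \<le> n"
    show "\<tau> k < \<tau> (Suc k)"
    proof (cases "k = n")
      case True
      then show ?thesis using \<tau>n assms(4) by simp
    next
      case False
      then have "xs ! k < xs ! Suc k"
        using \<open>k \<le> n\<close> xs(2) len by (intro sorted_wrt_nth_less[of "(<)" xs]) auto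
      then show ?thesis
        using False \<open>k \<le> n\<close> by (simp add: \<tau>_def)
    qed
  qed
  moreover have eq: "(\<forall>k\<le>n. \<epsilon> (\<tau> k) \<omega> = f (\<tau> k)) \<longleftrightarrow> (\<forall>u\<in>U. \<epsilon> u \<omega> = f u)" for \<omega>
  proof -
    have "U = (\<lambda>k. \<tau> k) ` {..n}"
    proof
      show "U \<subseteq> \<tau> ` {..n}"
        using xs(1) len by (auto simp: \<tau>_def image_iff in_set_conv_nth less_Suc_eq_le Bex_def)
      show "\<tau> ` {..n} \<subseteq> U"
        using le by (auto simp: \<tau>_def)
    qed
    then show ?thesis by auto
  qed
  ultimately have *: "prob {\<omega> \<in> space M. \<forall>u\<in>U. \<epsilon> u \<omega> = f u} > 0 \<Longrightarrow>
      \<P>(\<omega> in M. \<epsilon> (s + h) \<omega> = j \<bar> \<forall>u\<in>U. \<epsilon> u \<omega> = f u) = p h (f s) j"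
    using markov_p[of j \<tau> n "\<lambda>k. f (\<tau> k)"] assms(5) \<tau>n by simp
  show ?thesis
  proof (cases "prob {\<omega> \<in> space M. \<forall>u\<in>U. \<epsilon> u \<omega> = f u} > 0")
    case True
    then show ?thesis
      using *[OF True] by (simp add: cond_prob_def field_simps conj_commute)
  next
    case False
    then have 0: "prob {\<omega> \<in> space M. \<forall>u\<in>U. \<epsilon> u \<omega> = f u} = 0"
      by (simp add: zero_less_measure_iff)
    have "prob {\<omega> \<in> space M. (\<forall>u\<in>U. \<epsilon> u \<omega> = f u) \<and> \<epsilon> (s + h) \<omega> = j} \<le> prob {\<omega> \<in> space M. \<forall>u\<in>U. \<epsilon> u \<omega> = f u}"
      by (rule finite_measure_mono) (use assms(1,2) in \<open>auto intro!: cylinder_event\<close>)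
    then show ?thesis
      using 0 measure_nonneg[of M] by (simp add: order_antisym)
  qed
qed

text \<open>Both sides are finite measures in \<open>E\<close>, and they agree on an
  intersection-stable generator, so a Dynkin argument extends the identity to the whole past. The
  condition \<open>\<epsilon> s \<omega> = i\<close> turns a cylinder into one that contains the
  time \<open>s\<close>, as \<open>markov_cylinder\<close> requires.\<close>

lemma markov_past:
  assumes "E \<in> sets (past s)" "0 \<le> s" "0 < h" "j \<in> {0,1}"
  shows "prob {\<omega> \<in> space M. \<omega> \<in> E \<and> \<epsilon> s \<omega> = i \<and> \<epsilon> (s + h) \<omega> = j}
       = prob {\<omega> \<in> space M. \<omega> \<in> E \<and> \<epsilon> s \<omega> = i} * p h i j"
proof -
  define B where "B = {\<omega> \<in> space M. \<epsilon> s \<omega> = i \<and> \<epsilon> (s + h) \<omega> = j}"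
  define C where "C = {\<omega> \<in> space M. \<epsilon> s \<omega> = i}"
  have B: "B \<in> events"
    unfolding B_def by (intro sets.sets_Collect state_event) (use assms in auto)
  have C: "C \<in> events"
    unfolding C_def by (intro state_event) (use assms in auto)
  have cyl: "prob (A \<inter> B) = prob (A \<inter> C) * p h i j" if A: "A \<in> cylinders s" for A
  proof (cases "A \<inter> C = {}")
    case True
    moreover have "A \<inter> B \<subseteq> A \<inter> C"
      by (auto simp: B_def C_def)
    ultimately show ?thesis by auto
  next
    case False
    then obtain U f where Uf: "A = {\<omega> \<in> space M. \<forall>u\<in>U. \<epsilon> u \<omega> = f u}" "finite U" "U \<subseteq> {0..s}"
      using A unfolding cylinders_def by auto
    from False obtain \<omega> where \<omega>: "\<omega> \<in> A" "\<omega> \<in> C" by blast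
    have "A \<inter> C = {\<omega>' \<in> space M. \<forall>u\<in>insert s U. \<epsilon> u \<omega>' = \<epsilon> u \<omega>}"
      "A \<inter> B = {\<omega>' \<in> space M. (\<forall>u\<in>insert s U. \<epsilon> u \<omega>' = \<epsilon> u \<omega>) \<and> \<epsilon> (s + h) \<omega>' = j}"
      using \<omega> unfolding Uf B_def C_def by auto
    moreover have "\<epsilon> s \<omega> = i"
      using \<omega> by (simp add: C_def)
    ultimately show ?thesis
      using markov_cylinder[of "insert s U" s h j "\<lambda>u. \<epsilon> u \<omega>"] Uf assms by simp
  qed
  have "prob (E \<inter> B) = prob (E \<inter> C) * p h i j"
    using Int_stable_cylinders cylinders_subset assms(1)[unfolded sets_past]
  proof (induction rule: sigma_sets_induct_disjoint)
    case (basic A)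
    then show ?case by (intro cyl)
  next
    case empty
    then show ?case by simp
  next
    case (compl A)
    then have A: "A \<in> events"
      using past_subset_events[of A s] by (simp add: sets_past)
    \<comment> \<open>The cylinder over no times; it gives the identity for the total mass, from
      which complements are subtracted.\<close>
    have "space M \<in> cylinders s"
      unfolding cylinders_def by (intro insertI2 CollectI exI[of _ "{}"]) auto
    from cyl[OF this] have BC: "prob B = prob C * p h i j"
      using B C by (simp add: sets.Int_space_eq1)
    have "(space M - A) \<inter> B = B - A \<inter> B" "(space M - A) \<inter> C = C - A \<inter> C"
      by (auto simp: B_def C_def)
    then show ?case
      using A B C BC compl(2) by (simp add: finite_measure_Diff algebra_simps)
  next
    case (union A)
    then have A: "A k \<in> events" for k
      using past_subset_events[of "A k" s] by (auto simp: sets_past)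
    have sums: "(\<lambda>k. prob (A k \<inter> D)) sums prob (\<Union> (range A) \<inter> D)" if "D \<in> events" for D
    proof -
      have "(\<lambda>k. prob (A k \<inter> D)) sums prob (\<Union>k. A k \<inter> D)"
        using A that union(1) by (intro finite_measure_UNION) (auto simp: disjoint_family_on_def)
      then show ?thesis by simp
    qed
    have "(\<lambda>k. prob (A k \<inter> C) * p h i j) sums (prob (\<Union> (range A) \<inter> C) * p h i j)"
      by (intro sums_mult2 sums C)
    then have "(\<lambda>k. prob (A k \<inter> B)) sums (prob (\<Union> (range A) \<inter> C) * p h i j)"
      using union(3) by simp
    with sums[OF B] show ?case
      using sums_unique2 by blast
  qed
  moreover have "E \<inter> B = {\<omega> \<in> space M. \<omega> \<in> E \<and> \<epsilon> s \<omega> = i \<and> \<epsilon> (s + h) \<omega> = j}"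
    "E \<inter> C = {\<omega> \<in> space M. \<omega> \<in> E \<and> \<epsilon> s \<omega> = i}"
    by (auto simp: B_def C_def)
  ultimately show ?thesis by simp
qed

section \<open>Events over time intervals, and the probability of staying\<close>

text \<open>A failure before \<open>b\<close> persists for a while to the right and so meets a
  rational time. A failure at \<open>b\<close> alone need not, hence \<open>b\<close> joins the
  countable set of test times.\<close>

lemma past_ball:
  assumes ab: "0 \<le> a" "a \<le> b"
    and P: "\<And>u. a \<le> u \<Longrightarrow> u \<le> b \<Longrightarrow> {\<omega> \<in> space M. P u \<omega>} \<in> sets (past b)"
    and right: "\<And>\<omega> u. \<lbrakk>\<omega> \<in> space M; a \<le> u; u < b; \<not> P u \<omega>\<rbrakk> \<Longrightarrow> \<exists>d>u. \<forall>s\<in>{u..<d}. \<not> P s \<omega>"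
  shows "{\<omega> \<in> space M. \<forall>u\<in>{a..b}. P u \<omega>} \<in> sets (past b)"
proof -
  define D where "D = insert b (\<rat> \<inter> {a..b})"
  have "countable D"
    unfolding D_def using countable_rat by blast
  then have "{\<omega> \<in> space (past b). \<forall>u\<in>D. P u \<omega>} \<in> sets (past b)"
    by (intro sets.sets_Collect_countable_All') (use P ab in \<open>auto simp: D_def\<close>)
  moreover have "(\<forall>u\<in>D. P u \<omega>) \<longleftrightarrow> (\<forall>u\<in>{a..b}. P u \<omega>)" if \<omega>: "\<omega> \<in> space M" for \<omega>
  proof
    assume D: "\<forall>u\<in>D. P u \<omega>"
    show "\<forall>u\<in>{a..b}. P u \<omega>"
    proof (rule ballI, rule ccontr)
      fix u assume u: "u \<in> {a..b}" "\<not> P u \<omega>"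
      then have "u < b" using D unfolding D_def by (metis atLeastAtMost_iff insertI1 le_less)
      then obtain d where d: "d > u" "\<forall>s\<in>{u..<d}. \<not> P s \<omega>"
        using right[OF \<omega>, of u] u by auto
      obtain s where s: "s \<in> \<rat>" "u < s" "s < min b d"
        using Rats_dense_in_real[of u "min b d"] d(1) \<open>u < b\<close> by auto
      have "P s \<omega>"
        using D s u by (auto simp: D_def)
      moreover have "s \<in> {u..<d}" using s by auto
      ultimately show False using d by blast
    qed
  next
    assume "\<forall>u\<in>{a..b}. P u \<omega>"
    then show "\<forall>u\<in>D. P u \<omega>"
      using ab by (auto simp: D_def)
  qed
  ultimately show ?thesis
    by (auto cong: conj_cong)
qed

lemma past_stay:
  assumes "0 \<le> a" "a \<le> b"
  shows "{\<omega> \<in> space M. \<forall>u\<in>{a..b}. \<epsilon> u \<omega> = i} \<in> sets (past b)"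
proof (rule past_ball[OF assms])
  fix \<omega> u assume "\<omega> \<in> space M" "a \<le> u" and ne: "\<epsilon> u \<omega> \<noteq> i"
  then interpret step_path "\<lambda>s. \<epsilon> s \<omega>"
    by (intro path)
  obtain d where "d > u" "\<forall>s\<in>{u..<d}. \<epsilon> s \<omega> = \<epsilon> u \<omega>"
    using eventually_right_const[of u] \<open>0 \<le> a\<close> \<open>a \<le> u\<close> by auto
  then show "\<exists>d>u. \<forall>s\<in>{u..<d}. \<epsilon> s \<omega> \<noteq> i"
    using ne by (intro exI[of _ d]) metis
qed (use assms state_past in auto)

text \<open>Gives measurability to an event that is known only as the eventual outcome of grid
  tests.\<close>

lemma past_eventually:
  assumes "\<And>K :: nat. {\<omega> \<in> space M. P K \<omega>} \<in> sets (past t)"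
    and "\<And>\<omega>. \<omega> \<in> space M \<Longrightarrow> \<forall>\<^sub>F K in sequentially. P K \<omega> \<longleftrightarrow> Q \<omega>"
  shows "{\<omega> \<in> space M. Q \<omega>} \<in> sets (past t)"
proof -
  have "{\<omega> \<in> space (past t). \<forall>\<^sub>F K in sequentially. P K \<omega>} \<in> sets (past t)"
    using assms(1) by (intro sets_Collect_eventually_sequentially) simp
  moreover have "(\<forall>\<^sub>F K in sequentially. P K \<omega>) \<longleftrightarrow> Q \<omega>" if "\<omega> \<in> space M" for \<omega>
  proof -
    have "(\<forall>\<^sub>F K in sequentially. P K \<omega>) \<longleftrightarrow> (\<forall>\<^sub>F K in sequentially. Q \<omega>)"
      using assms(2)[OF that] by (rule eventually_subst)
    then show ?thesis by simp
  qed
  ultimately show ?thesis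
    by (auto cong: conj_cong)
qed

lemma transition_props:
  assumes "i \<in> {0,1}" "0 \<le> h"
  shows "0 \<le> p h i (1 - i)" "p h i (1 - i) \<le> 1" "p h i i = 1 - p h i (1 - i)"
    "((\<lambda>h. p h i (1 - i) / h) \<longlongrightarrow> lam i) (at_right 0)"
proof -
  have nn: "0 \<le> p h i 0" "0 \<le> p h i 1" and sum: "p h i 0 + p h i 1 = 1"
    and lim: "((\<lambda>h. p h i (1 - i) / h) \<longlongrightarrow> lam i) (at_right 0)"
    using transition assms unfolding transition_function_def by auto
  show "((\<lambda>h. p h i (1 - i) / h) \<longlongrightarrow> lam i) (at_right 0)" by (fact lim)
  show "0 \<le> p h i (1 - i)" "p h i (1 - i) \<le> 1" "p h i i = 1 - p h i (1 - i)"
    using assms(1) nn sum by auto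
qed

text \<open>Staying at all points of a grid with \<open>Suc K\<close> steps has probability
  \<open>p h i i\<close> to the power \<open>Suc K\<close> times that of the start, with an
  exponential limit. Right continuity ensures that a path which leaves \<open>i\<close> is caught by
  every sufficiently fine grid.\<close>

lemma prob_stay:
  assumes E: "E \<in> sets (past s)" and s: "0 \<le> s" "s \<le> t" and i: "i \<in> {0,1}"
  shows "prob {\<omega> \<in> space M. \<omega> \<in> E \<and> (\<forall>u\<in>{s..t}. \<epsilon> u \<omega> = i)}
    = prob {\<omega> \<in> space M. \<omega> \<in> E \<and> \<epsilon> s \<omega> = i} * exp (- lam i * (t - s))"
proof (cases "s = t")
  case True
  then show ?thesis by simp
next
  case False
  with s have "s < t" by simp
  define A where "A h m = {\<omega> \<in> space M. \<omega> \<in> E \<and> (\<forall>k\<le>m. \<epsilon> (s + real k * h) \<omega> = i)}" for h and m :: nat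
  have A_past: "A h m \<in> sets (past (s + real m * h))" if "0 < h" for h m
  proof -
    have "E \<in> sets (past (s + real m * h))"
      using that E by (intro past_mono[OF _ E]) simp
    moreover have "{\<omega> \<in> space (past (s + real m * h)). \<forall>k\<in>{..m}. \<epsilon> (s + real k * h) \<omega> = i} \<in> sets (past (s + real m * h))"
      using that s by (intro sets.sets_Collect_finite_All) (auto intro!: state_past mult_right_mono)
    ultimately have "E \<inter> {\<omega> \<in> space (past (s + real m * h)). \<forall>k\<in>{..m}. \<epsilon> (s + real k * h) \<omega> = i} \<in> sets (past (s + real m * h))"
      by (rule sets.Int)
    also have "E \<inter> {\<omega> \<in> space (past (s + real m * h)). \<forall>k\<in>{..m}. \<epsilon> (s + real k * h) \<omega> = i} = A h m"
      by (auto simp: A_def)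
    finally show ?thesis .
  qed
  have A_prob: "prob (A h m) = prob {\<omega> \<in> space M. \<omega> \<in> E \<and> \<epsilon> s \<omega> = i} * (p h i i) ^ m" if "0 < h" for h m
  proof (induction m)
    case 0
    then show ?case by (simp add: A_def)
  next
    case (Suc m)
    have "A h (Suc m) = {\<omega> \<in> space M. \<omega> \<in> A h m \<and> \<epsilon> (s + real m * h) \<omega> = i \<and> \<epsilon> (s + real m * h + h) \<omega> = i}"
      by (auto simp: A_def le_Suc_eq algebra_simps)
    moreover have "{\<omega> \<in> space M. \<omega> \<in> A h m \<and> \<epsilon> (s + real m * h) \<omega> = i} = A h m"
      by (auto simp: A_def)
    ultimately have "prob (A h (Suc m)) = prob (A h m) * p h i i"
      using markov_past[OF A_past[OF that, of m], of h i i] that s i by simp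
    then show ?case using Suc by simp
  qed
  define h where "h K = (t - s) / real (Suc K)" for K :: nat
  have h: "0 < h K" for K
    using \<open>s < t\<close> by (simp add: h_def)
  define B where "B = {\<omega> \<in> space M. \<omega> \<in> E \<and> (\<forall>u\<in>{s..t}. \<epsilon> u \<omega> = i)}"
  have "B = E \<inter> {\<omega> \<in> space M. \<forall>u\<in>{s..t}. \<epsilon> u \<omega> = i}"
    by (auto simp: B_def)
  then have B: "B \<in> events"
    using past_subset_events[OF E] past_subset_events[OF past_stay[OF s, of i]] by (simp only: sets.Int)
  have "(\<lambda>K. prob (A (h K) (Suc K))) \<longlonglongrightarrow> prob B"
  proof (rule prob_tendsto)
    show "AE \<omega> in M. \<forall>\<^sub>F K in sequentially. \<omega> \<in> A (h K) (Suc K) \<longleftrightarrow> \<omega> \<in> B"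
    proof (intro AE_I2)
      fix \<omega> assume \<omega>: "\<omega> \<in> space M"
      have in_range: "s + real k * h K \<in> {s..t}" if "k \<le> Suc K" for k K
      proof -
        have "real k * h K \<le> real (Suc K) * h K"
          using that h[of K] by (intro mult_right_mono) auto
        also have "\<dots> = t - s" by (simp add: h_def)
        finally show ?thesis using h[of K] by simp
      qed
      show "\<forall>\<^sub>F K in sequentially. \<omega> \<in> A (h K) (Suc K) \<longleftrightarrow> \<omega> \<in> B"
      proof (cases "\<omega> \<in> B \<or> \<omega> \<notin> E")
        case True
        then show ?thesis
          using in_range by (intro eventuallyI) (auto simp: A_def B_def)
      next
        case False
        then obtain u where u: "s \<le> u" "u \<le> t" "\<epsilon> u \<omega> \<noteq> i"
          using \<omega> by (auto simp: B_def)
        interpret step_path "\<lambda>s. \<epsilon> s \<omega>"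
          by (intro path \<omega>)
        show ?thesis
        \<comment> \<open>To the right of \<open>t\<close> nothing is tested, but \<open>t\<close>
          itself is the last point of every grid.\<close>
        proof (cases "u = t")
          case True
          have "s + real (Suc K) * h K = t" for K by (simp add: h_def)
          then have "\<omega> \<notin> A (h K) (Suc K)" for K
            using u True unfolding A_def by force
          then show ?thesis using False by simp
        next
          case ut: False
          obtain d where d: "d > u" and const: "\<forall>x\<in>{u..<d}. \<epsilon> x \<omega> = \<epsilon> u \<omega>"
            using eventually_right_const[of u] u s by auto
          \<comment> \<open>The minimum with \<open>t\<close> keeps the grid point found below
            inside the tested range.\<close>
          define d' where "d' = min d t"
          have d': "d' > u" using d u ut by (auto simp: d'_def)
          have "(\<lambda>K. (t - s) / real (Suc K)) \<longlonglongrightarrow> 0"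
            using LIMSEQ_Suc[OF lim_const_over_n[of "t - s"]] by simp
          then have "\<forall>\<^sub>F K in sequentially. h K < d' - u"
            using d' unfolding h_def by (intro order_tendstoD) auto
          then show ?thesis
          proof eventually_elim
            case (elim K)
            \<comment> \<open>The first grid point at or after \<open>u\<close>; it is closer to
              \<open>u\<close> than one mesh width, so the path still has the wrong state
              there.\<close>
            define k where "k = nat \<lceil>(u - s) / h K\<rceil>"
            have "0 \<le> (u - s) / h K"
              using h[of K] u by (intro divide_nonneg_pos) auto
            then have k: "(u - s) / h K \<le> real k" "real k < (u - s) / h K + 1"
              unfolding k_def by linarith+
            then have "u \<le> s + real k * h K" "s + real k * h K < u + h K"
              using h[of K] by (auto simp: field_simps)
            then have k2: "u \<le> s + real k * h K" "s + real k * h K < d" "s + real k * h K < t"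
              using elim by (auto simp: d'_def)
            have "real k * h K < real (Suc K) * h K"
              using k2(3) by (simp add: h_def)
            then have "real k < real (Suc K)"
              using h[of K] by (metis mult_less_cancel_right_pos)
            then have "k \<le> Suc K" by simp
            moreover have "\<epsilon> (s + real k * h K) \<omega> \<noteq> i"
              using const[rule_format, of "s + real k * h K"] k2 u by simp
            ultimately show ?case
              using False by (auto simp: A_def)
          qed
        qed
      qed
    qed
    show "A (h K) (Suc K) \<in> events" for K
      using A_past[OF h] past_subset_events by blast
  qed (fact B)
  moreover have "(\<lambda>K. prob (A (h K) (Suc K))) \<longlonglongrightarrow> prob {\<omega> \<in> space M. \<omega> \<in> E \<and> \<epsilon> s \<omega> = i} * exp (- lam i * (t - s))"
  proof -
    have "(\<lambda>K. (1 - p ((t - s) / Suc K) i (1 - i)) ^ Suc K) \<longlonglongrightarrow> exp (- lam i * (t - s))"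
      using lam_pos i \<open>s < t\<close> transition_props[OF i] by (intro tendsto_power_exp) auto
    then show ?thesis
      unfolding A_prob[OF h] h_def[symmetric] using transition_props(3)[OF i less_imp_le[OF h]]
      by (intro tendsto_mult_left) simp
  qed
  ultimately show ?thesis
    unfolding B_def by (rule LIMSEQ_unique)
qed

end

section \<open>Measurability\<close>

text \<open>Writes a Riemann sum as an integral, so that its limit can be taken by dominated
  convergence. The cells are open on the left, as for the cell of the last switching.\<close>

lemma has_bochner_integral_step_function:
  fixes g :: "nat \<Rightarrow> real"
  assumes "0 < h"
  shows "has_bochner_integral lborel
     (\<lambda>s. indicator {0<..real m * h} s * g (nat (\<lceil>s / h\<rceil> - 1))) (h * (\<Sum>k<m. g k))"
proof (induction m)
  case 0
  then show ?case
    by (simp add: has_bochner_integral_zero)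
next
  case (Suc m)
  have "has_bochner_integral lborel (indicator {real m * h<..real (Suc m) * h}) (measure lborel {real m * h<..real (Suc m) * h})"
    using assms by (intro has_bochner_integral_real_indicator) auto
  moreover have "measure lborel {real m * h<..real (Suc m) * h} = h"
    using assms by (simp add: algebra_simps)
  ultimately have "has_bochner_integral lborel (\<lambda>s. indicator {real m * h<..real (Suc m) * h} s * g m) (h * g m)"
    by (intro has_bochner_integral_mult_left) simp_all
  from has_bochner_integral_add[OF Suc this]
  have "has_bochner_integral lborel (\<lambda>s. indicator {0<..real m * h} s * g (nat (\<lceil>s / h\<rceil> - 1))
      + indicator {real m * h<..real (Suc m) * h} s * g m) (h * (\<Sum>k<Suc m. g k))"
    by (simp add: algebra_simps)
  also have "(\<lambda>s. indicator {0<..real m * h} s * g (nat (\<lceil>s / h\<rceil> - 1))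
      + indicator {real m * h<..real (Suc m) * h} s * g m)
    = (\<lambda>s. indicator {0<..real (Suc m) * h} s * g (nat (\<lceil>s / h\<rceil> - 1)))"
  proof
    fix s
    have le: "real m * h \<le> real (Suc m) * h" "0 \<le> real m * h"
      using assms by (auto simp: algebra_simps)
    consider "s \<le> real m * h" | "real m * h < s" "s \<le> real (Suc m) * h" | "real (Suc m) * h < s"
      by linarith
    then show "indicator {0<..real m * h} s * g (nat (\<lceil>s / h\<rceil> - 1))
      + indicator {real m * h<..real (Suc m) * h} s * g m
      = indicator {0<..real (Suc m) * h} s * g (nat (\<lceil>s / h\<rceil> - 1))"
    proof cases
      case 1
      then show ?thesis using le by (auto simp: indicator_def)
    next
      case 2
      then have "real m < s / h" "s / h \<le> real (Suc m)"
        using assms by (simp_all only: pos_less_divide_eq pos_divide_le_eq)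
      then have "\<lceil>s / h\<rceil> = int (Suc m)"
        by (intro ceiling_unique) auto
      then have "nat (\<lceil>s / h\<rceil> - 1) = m" by simp
      then show ?thesis using 2 le by (auto simp: indicator_def)
    next
      case 3
      then show ?thesis using le by (auto simp: indicator_def)
    qed
  qed
  finally show ?case .
qed

context two_state_transitions
begin

lemma sets_grid:
  assumes "0 \<le> t" "\<And>k. k < K \<Longrightarrow> {\<omega> \<in> space M. Q k \<omega>} \<in> sets (past (real k * t / K))"
  shows "{\<omega> \<in> space M. \<exists>k<K. Q k \<omega> \<and> (\<forall>u\<in>{real (Suc k) * t / real K..t}. \<epsilon> u \<omega> = j)} \<in> sets (past t)"
proof -
  have "{\<omega> \<in> space (past t). Q k \<omega> \<and> (\<forall>u\<in>{real (Suc k) * t / real K..t}. \<epsilon> u \<omega> = j)} \<in> sets (past t)" if "k < K" for k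
  proof (rule sets.sets_Collect_conj)
    have "real k * t \<le> real K * t" "real (Suc k) * t \<le> real K * t"
      using that \<open>0 \<le> t\<close> by (auto intro!: mult_right_mono simp del: of_nat_Suc)
    then have "real k * t / K \<le> t" "real (Suc k) * t / K \<le> t"
      using that by (auto simp: divide_le_eq mult.commute simp del: of_nat_Suc)
    then show "{\<omega> \<in> space (past t). Q k \<omega>} \<in> sets (past t)"
      "{\<omega> \<in> space (past t). \<forall>u\<in>{real (Suc k) * t / real K..t}. \<epsilon> u \<omega> = j} \<in> sets (past t)"
      using past_mono[OF _ assms(2)[OF that], of t] past_stay[of "real (Suc k) * t / K" t j] \<open>0 \<le> t\<close>
      by (simp_all del: of_nat_Suc)
  qed
  then have "{\<omega> \<in> space (past t). \<exists>k\<in>{..<K}. Q k \<omega> \<and> (\<forall>u\<in>{real (Suc k) * t / real K..t}. \<epsilon> u \<omega> = j)} \<in> sets (past t)"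
    by (intro sets.sets_Collect_finite_Ex) auto
  then show ?thesis
    by (simp only: space_past Bex_def lessThan_iff)
qed

text \<open>A count of discontinuities is not visibly measurable. A count of \<open>Suc n\<close> is
  detected by a grid point with count \<open>n\<close> in the other state, after whose cell the
  state is constant, so induction on the count applies.\<close>

lemma switch_count_past: "0 \<le> t \<Longrightarrow> {\<omega> \<in> space M. switch_count \<epsilon> t \<omega> = n} \<in> sets (past t)"
proof (induction n arbitrary: t)
  case 0
  have eq: "{\<omega> \<in> space M. switch_count \<epsilon> t \<omega> = 0} =
      {\<omega> \<in> space M. \<forall>u\<in>{0..t}. \<epsilon> u \<omega> = 0} \<union> {\<omega> \<in> space M. \<forall>u\<in>{0..t}. \<epsilon> u \<omega> = 1}"
  proof -
    have "switch_count \<epsilon> t \<omega> = 0 \<longleftrightarrow> (\<forall>u\<in>{0..t}. \<epsilon> u \<omega> = 0) \<or> (\<forall>u\<in>{0..t}. \<epsilon> u \<omega> = 1)" if "\<omega> \<in> space M" for \<omega>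
    proof -
      interpret step_path "\<lambda>s. \<epsilon> s \<omega>"
        by (intro path that)
      have "switch_count \<epsilon> t \<omega> = 0 \<longleftrightarrow> (\<forall>u\<in>{0..t}. \<epsilon> u \<omega> = \<epsilon> 0 \<omega>)"
        unfolding switch_count_def by (rule N_eq_0_iff[OF 0])
      moreover have "\<epsilon> 0 \<omega> = 0 \<or> \<epsilon> 0 \<omega> = 1"
        using state[of 0] by simp
      moreover have "0 \<in> {0..t}" using 0 by simp
      ultimately show ?thesis by metis
    qed
    then show ?thesis by blast
  qed
  show ?case
    unfolding eq by (intro sets.Un past_stay order_refl 0)
next
  case (Suc n)
  show ?case
  proof (cases "t = 0")
    case True
    then have "{\<omega> \<in> space M. switch_count \<epsilon> t \<omega> = Suc n} = {}"
      by (auto simp: switch_count_def switchings_def)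
    then show ?thesis by (simp only: sets.empty_sets)
  next
    case False
    with Suc have "0 < t" by simp
    have *: "{\<omega> \<in> space M. switch_count \<epsilon> t \<omega> = Suc n \<and> \<epsilon> t \<omega> = 1 - i} \<in> sets (past t)" if i: "i \<in> {0,1}" for i
    proof (rule past_eventually)
      fix K :: nat
      have step: "{\<omega> \<in> space (past (real k * t / K)). switch_count \<epsilon> (real k * t / K) \<omega> = n \<and> \<epsilon> (real k * t / K) \<omega> = i} \<in> sets (past (real k * t / K))" for k
        using Suc.IH[of "real k * t / K"] state_past[of "real k * t / K" "real k * t / K" i] \<open>0 < t\<close>
        by (intro sets.sets_Collect_conj) auto
      show "{\<omega> \<in> space M. \<exists>k<K. (switch_count \<epsilon> (real k * t / K) \<omega> = n \<and> \<epsilon> (real k * t / K) \<omega> = i)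
          \<and> (\<forall>u\<in>{real (Suc k) * t / real K..t}. \<epsilon> u \<omega> = 1 - i)} \<in> sets (past t)"
        using step[unfolded space_past] \<open>0 < t\<close>
        by (intro sets_grid[of t K "\<lambda>k \<omega>. switch_count \<epsilon> (real k * t / K) \<omega> = n \<and> \<epsilon> (real k * t / K) \<omega> = i"]) simp_all
    next
      fix \<omega> assume "\<omega> \<in> space M"
      then interpret step_path "\<lambda>s. \<epsilon> s \<omega>"
        by (intro path)
      have "\<forall>\<^sub>F K in sequentially.
        (\<exists>k<K. N (real k * t / K) = n \<and> \<epsilon> (real k * t / K) \<omega> = i \<and> True
          \<and> (\<forall>u\<in>{real (Suc k) * t / K..t}. \<epsilon> u \<omega> = 1 - i))
        \<longleftrightarrow> N t = Suc n \<and> \<epsilon> t \<omega> = 1 - i \<and> True"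
        by (rule eventually_grid_detects_last_switching[OF \<open>0 < t\<close> i, of n "\<lambda>_. True" True]) simp
      then show "\<forall>\<^sub>F K in sequentially.
         (\<exists>k<K. (switch_count \<epsilon> (real k * t / K) \<omega> = n \<and> \<epsilon> (real k * t / K) \<omega> = i)
          \<and> (\<forall>u\<in>{real (Suc k) * t / real K..t}. \<epsilon> u \<omega> = 1 - i))
         \<longleftrightarrow> switch_count \<epsilon> t \<omega> = Suc n \<and> \<epsilon> t \<omega> = 1 - i"
        unfolding switch_count_def by (simp del: of_nat_Suc add: conj_assoc)
    qed
    have "{\<omega> \<in> space M. switch_count \<epsilon> t \<omega> = Suc n} =
       {\<omega> \<in> space M. switch_count \<epsilon> t \<omega> = Suc n \<and> \<epsilon> t \<omega> = 1 - 0} \<union>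
       {\<omega> \<in> space M. switch_count \<epsilon> t \<omega> = Suc n \<and> \<epsilon> t \<omega> = 1 - 1}"
      using state_01[of _ t] \<open>0 < t\<close> by force
    then show ?thesis
      using sets.Un[OF *[of 0] *[of 1]] by simp
  qed
qed

text \<open>The path at time \<open>u\<close> is the limit of its values at discretised times to the
  right of \<open>u\<close>. This makes the state jointly measurable in the sample and the time, and
  integration over time then preserves measurability.\<close>

lemma telegraph_measurable_past:
  fixes v :: "nat \<Rightarrow> real"
  assumes "0 \<le> s"
  shows "telegraph v \<epsilon> s \<in> borel_measurable (past s)"
proof -
  \<comment> \<open>The next grid time strictly after \<open>u\<close>, since right continuity sees
    only that side. Truncation at \<open>s\<close> keeps all observations in \<open>past s\<close>,
    and truncation at 0 keeps them at nonnegative times.\<close>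
  define c where "c K u = max 0 (min s ((of_int \<lfloor>u * real (Suc K)\<rfloor> + 1) / real (Suc K)))" for K u
  define F where "F \<omega> u = indicator {0..s} u * v (\<epsilon> u \<omega>)" for \<omega> u
  have meas: "(\<lambda>x. indicator {0..s} (snd x) * v (\<epsilon> (c K (snd x)) (fst x))) \<in> borel_measurable (past s \<Otimes>\<^sub>M lborel)" for K
  proof -
    have "(\<lambda>x. (\<lambda>z::int. \<lambda>x. v (\<epsilon> (max 0 (min s ((of_int z + 1) / real (Suc K)))) (fst x))) \<lfloor>snd x * real (Suc K)\<rfloor> x) \<in> borel_measurable (past s \<Otimes>\<^sub>M lborel)"
    proof (rule measurable_compose_countable[where g = "\<lambda>x. \<lfloor>snd x * real (Suc K)\<rfloor>"
          and f = "\<lambda>z x. v (\<epsilon> (max 0 (min s ((of_int z + 1) / real (Suc K)))) (fst x))"])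
      fix z :: int
      define r where "r = max 0 (min s ((of_int z + 1) / real (Suc K)))"
      have "\<epsilon> r \<in> measurable (past s) (count_space UNIV)"
        using state_past[of r s] \<open>0 \<le> s\<close>
        by (intro measurable_count_space_eq2_countable[THEN iffD2]) (auto simp: r_def vimage_def Int_def conj_commute)
      then show "(\<lambda>x. v (\<epsilon> (max 0 (min s ((of_int z + 1) / real (Suc K)))) (fst x))) \<in> borel_measurable (past s \<Otimes>\<^sub>M lborel)"
        unfolding r_def[symmetric] by measurable
      show "(\<lambda>x. \<lfloor>snd x * real (Suc K)\<rfloor>) \<in> measurable (past s \<Otimes>\<^sub>M lborel) (count_space UNIV)"
        by (intro measurable_compose[OF _ measurable_real_floor] borel_measurable_times borel_measurable_const) simp
    qed
    then show ?thesis
      unfolding c_def by measurable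
  qed
  have lim: "(\<lambda>K. indicator {0..s} (snd x) * v (\<epsilon> (c K (snd x)) (fst x))) \<longlonglongrightarrow> case_prod F x"
    if "x \<in> space (past s \<Otimes>\<^sub>M lborel)" for x
  proof -
    from that obtain \<omega> u where x: "x = (\<omega>, u)" "\<omega> \<in> space M"
      by (auto simp: space_pair_measure)
    interpret step_path "\<lambda>s. \<epsilon> s \<omega>"
      by (intro path x)
    show ?thesis
    proof (cases "u \<in> {0..s}")
      case False
      then show ?thesis by (simp add: x F_def)
    next
      case True
      have "\<forall>\<^sub>F K in sequentially. \<epsilon> (c K u) \<omega> = \<epsilon> u \<omega>"
      proof (cases "u = s")
        case True
        \<comment> \<open>At the right end the truncation makes the approximation exact.\<close>
        have "c K u = s" for K
        proof -
          have "s * real (Suc K) < of_int \<lfloor>s * real (Suc K)\<rfloor> + 1"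
            by linarith
          then have "s < (of_int \<lfloor>s * real (Suc K)\<rfloor> + 1) / real (Suc K)"
            by (subst pos_less_divide_eq) simp_all
          then show ?thesis
            using True \<open>0 \<le> s\<close> by (simp add: c_def)
        qed
        then show ?thesis using True by simp
      next
        case False
        obtain d where d: "d > u" and const: "\<forall>x\<in>{u..<d}. \<epsilon> x \<omega> = \<epsilon> u \<omega>"
          using eventually_right_const[of u] \<open>u \<in> {0..s}\<close> by auto
        have "(\<lambda>K. 1 / real (Suc K)) \<longlonglongrightarrow> 0"
          using LIMSEQ_Suc[OF lim_const_over_n[of 1]] by simp
        then have "\<forall>\<^sub>F K in sequentially. 1 / real (Suc K) < d - u"
          using d by (intro order_tendstoD) auto
        then show ?thesis
        proof eventually_elim
          case (elim K)
          define b where "b = (of_int \<lfloor>u * real (Suc K)\<rfloor> + 1) / real (Suc K)"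
          have "u * real (Suc K) < of_int \<lfloor>u * real (Suc K)\<rfloor> + 1" "of_int \<lfloor>u * real (Suc K)\<rfloor> + 1 \<le> u * real (Suc K) + 1"
            by linarith+
          then have "u < b" "b \<le> u + 1 / real (Suc K)"
            unfolding b_def by (subst pos_less_divide_eq pos_divide_le_eq; simp add: distrib_right)+
          moreover have "c K u = max 0 (min s b)"
            by (simp only: c_def b_def)
          ultimately have "c K u \<in> {u..<d}"
            using elim \<open>u \<in> {0..s}\<close> by (simp add: max_def min_def)
          then show ?case
            using const by blast
        qed
      qed
      then have "\<forall>\<^sub>F K in sequentially. indicator {0..s} (snd x) * v (\<epsilon> (c K (snd x)) (fst x)) = F \<omega> u"
        by eventually_elim (simp add: x F_def)
      then show ?thesis
        unfolding x by (simp add: tendsto_eventually)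
    qed
  qed
  have F_meas: "case_prod F \<in> borel_measurable (past s \<Otimes>\<^sub>M lborel)"
    by (rule borel_measurable_LIMSEQ_real[OF lim meas])
  have "(\<lambda>\<omega>. \<integral>u. F \<omega> u \<partial>lborel) \<in> borel_measurable (past s)"
    by (rule lborel.borel_measurable_lebesgue_integral[OF F_meas])
  moreover have "(\<integral>u. F \<omega> u \<partial>lborel) = telegraph v \<epsilon> s \<omega>" if \<omega>: "\<omega> \<in> space M" for \<omega>
  proof -
    have "F \<omega> \<in> borel_measurable lborel"
      using measurable_Pair2[OF F_meas, of \<omega>] \<omega> by simp
    have "set_integrable lborel {0..s} (\<lambda>u. v (\<epsilon> u \<omega>))"
      unfolding set_integrable_def
    proof (rule Bochner_Integration.integrable_bound)
      show "integrable lborel (\<lambda>u. indicator {0..s} u *\<^sub>R (\<bar>v 0\<bar> + \<bar>v 1\<bar>))"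
        by (intro integrable_scaleR_left integrable_real_indicator) (auto simp: emeasure_lborel_Icc_eq)
      show "AE u in lborel. norm (indicator {0..s} u *\<^sub>R v (\<epsilon> u \<omega>)) \<le> norm (indicator {0..s} u *\<^sub>R (\<bar>v 0\<bar> + \<bar>v 1\<bar>))"
      proof (intro AE_I2)
        fix u
        show "norm (indicator {0..s} u *\<^sub>R v (\<epsilon> u \<omega>)) \<le> norm (indicator {0..s} u *\<^sub>R (\<bar>v 0\<bar> + \<bar>v 1\<bar>))"
        proof (cases "u \<in> {0..s}")
          case True
          then have "\<epsilon> u \<omega> = 0 \<or> \<epsilon> u \<omega> = 1"
            using state_01[OF \<omega>, of u] by simp
          then show ?thesis
            using True by auto
        qed simp
      qed
      show "(\<lambda>u. indicator {0..s} u *\<^sub>R v (\<epsilon> u \<omega>)) \<in> borel_measurable lborel"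
        using \<open>F \<omega> \<in> borel_measurable lborel\<close> by (simp add: F_def[abs_def])
    qed
    from set_borel_integral_eq_integral(2)[OF this]
    show ?thesis
      by (simp add: F_def telegraph_def set_lebesgue_integral_def)
  qed
  ultimately show ?thesis
    by (subst measurable_cong[where g = "\<lambda>\<omega>. \<integral>u. F \<omega> u \<partial>lborel"]) simp_all
qed

lemma telegraph_measurable_past':
  assumes "0 \<le> u" "u \<le> s"
  shows "telegraph v \<epsilon> u \<in> borel_measurable (past s)"
proof (rule measurable_from_subalg)
  show "subalgebra (past s) (past u)"
    unfolding subalgebra_def using past_mono[OF assms(2)] by auto
  show "telegraph v \<epsilon> u \<in> borel_measurable (past u)"
    by (rule telegraph_measurable_past[OF assms(1)])
qed

lemma telegraph_measurable:
  assumes "0 \<le> s"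
  shows "telegraph v \<epsilon> s \<in> borel_measurable M"
proof (rule measurable_from_subalg)
  show "subalgebra M (past s)"
    unfolding subalgebra_def using past_subset_events by auto
  show "telegraph v \<epsilon> s \<in> borel_measurable (past s)"
    by (rule telegraph_measurable_past[OF assms])
qed

lemma nonneg_past:
  assumes "0 \<le> s"
  shows "{\<omega> \<in> space M. \<forall>u\<in>{0..s}. 0 \<le> telegraph v \<epsilon> u \<omega>} \<in> sets (past s)"
proof (rule past_ball[OF order_refl assms])
  fix u assume "0 \<le> u" "u \<le> s"
  then have [measurable]: "telegraph v \<epsilon> u \<in> borel_measurable (past s)"
    by (rule telegraph_measurable_past')
  have "{\<omega> \<in> space (past s). 0 \<le> telegraph v \<epsilon> u \<omega>} \<in> sets (past s)"
    by measurable
  then show "{\<omega> \<in> space M. 0 \<le> telegraph v \<epsilon> u \<omega>} \<in> sets (past s)"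
    by simp
next
  fix \<omega> u assume \<omega>: "\<omega> \<in> space M" and u: "0 \<le> u" "u < s" and neg: "\<not> 0 \<le> telegraph v \<epsilon> u \<omega>"
  interpret step_path "\<lambda>s. \<epsilon> s \<omega>"
    by (intro path \<omega>)
  have "((\<lambda>u. telegraph v \<epsilon> u \<omega>) \<longlongrightarrow> telegraph v \<epsilon> u \<omega>) (at u within {0..s})"
    using G_continuous[of s v] u unfolding continuous_on_def telegraph_def by auto
  then have "((\<lambda>u. telegraph v \<epsilon> u \<omega>) \<longlongrightarrow> telegraph v \<epsilon> u \<omega>) (at u within {u..s})"
    by (rule tendsto_within_subset) (use u in auto)
  then have "((\<lambda>u. telegraph v \<epsilon> u \<omega>) \<longlongrightarrow> telegraph v \<epsilon> u \<omega>) (at_right u)"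
    using u by (simp add: at_within_Icc_at_right)
  then have "\<forall>\<^sub>F x in at_right u. telegraph v \<epsilon> x \<omega> < 0"
    using neg by (intro order_tendstoD) auto
  then obtain d where d: "d > u" "\<And>x. u < x \<Longrightarrow> x < d \<Longrightarrow> telegraph v \<epsilon> x \<omega> < 0"
    by (auto simp: eventually_at_right_field)
  then show "\<exists>d>u. \<forall>x\<in>{u..<d}. \<not> 0 \<le> telegraph v \<epsilon> x \<omega>"
    using neg by (intro exI[of _ d]) (metis atLeastLessThan_iff le_less not_le)
qed

end

section \<open>Decomposition at the last switching\<close>

context two_state_transitions
begin

text \<open>The path is constant on \<open>{a k..s}\<close> with probability at least
  \<open>exp (- (lam 0 + lam 1) * (s / real (Suc k)))\<close>, which tends to 1; a switching at
  \<open>s\<close> excludes this for every \<open>k\<close>.\<close>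

lemma AE_isCont:
  assumes "0 < s"
  shows "AE \<omega> in M. isCont (\<lambda>u. \<epsilon> u \<omega>) s"
proof -
  define a where "a k = s - s / real (Suc k)" for k
  have a: "0 \<le> a k" "a k < s" for k
  proof -
    have "s / real (Suc k) \<le> s / 1"
      using assms by (intro divide_left_mono) auto
    then show "0 \<le> a k" by (simp add: a_def)
    show "a k < s" using assms by (simp add: a_def)
  qed
  define S where "S k i = {\<omega> \<in> space M. \<forall>u\<in>{a k..s}. \<epsilon> u \<omega> = i}" for k and i :: nat
  have S: "S k i \<in> events" for k i
    unfolding S_def using past_stay[OF a(1) less_imp_le[OF a(2)]] past_subset_events by blast
  define J where "J = (\<Inter>k. space M - (S k 0 \<union> S k 1))"
  have J: "J \<in> events"
    unfolding J_def using S by (intro sets.countable_INT) auto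
  have le: "prob J \<le> 1 - exp (- (lam 0 + lam 1) * (s / real (Suc k)))" for k
  proof -
    have S_prob: "prob (S k i) = prob {\<omega> \<in> space M. \<epsilon> (a k) \<omega> = i} * exp (- lam i * (s / real (Suc k)))" if "i \<in> {0,1}" for i
    proof -
      have "space M \<in> sets (past (a k))"
        using sets.top[of "past (a k)"] by simp
      from prob_stay[OF this a(1) less_imp_le[OF a(2)] that]
      show ?thesis
        unfolding S_def by (simp add: a_def)
    qed
    have "prob {\<omega> \<in> space M. \<epsilon> (a k) \<omega> = 0} + prob {\<omega> \<in> space M. \<epsilon> (a k) \<omega> = 1}
        = prob ({\<omega> \<in> space M. \<epsilon> (a k) \<omega> = 0} \<union> {\<omega> \<in> space M. \<epsilon> (a k) \<omega> = 1})"
      using a[of k] by (intro finite_measure_Union[symmetric] state_event) auto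
    also have "{\<omega> \<in> space M. \<epsilon> (a k) \<omega> = 0} \<union> {\<omega> \<in> space M. \<epsilon> (a k) \<omega> = 1} = space M"
      using state_01[OF _ a(1)[of k]] by auto
    finally have one: "prob {\<omega> \<in> space M. \<epsilon> (a k) \<omega> = 0} + prob {\<omega> \<in> space M. \<epsilon> (a k) \<omega> = 1} = 1"
      by (simp add: prob_space)
    \<comment> \<open>A lower bound for staying that serves both states, so that the law of the
      state at \<open>a k\<close> drops out.\<close>
    define E where "E = exp (- (lam 0 + lam 1) * (s / real (Suc k)))"
    have E_le: "E \<le> exp (- lam i * (s / real (Suc k)))" if "i \<in> {0,1}" for i
    proof -
      have "- (lam 0 + lam 1) * (s / real (Suc k)) \<le> - lam i * (s / real (Suc k))"
        using that lam_pos assms by (intro mult_right_mono) auto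
      then show ?thesis by (simp add: E_def)
    qed
    have "S k 0 \<inter> S k 1 = {}"
      unfolding S_def using less_imp_le[OF a(2)[of k]] by (auto dest!: bspec[of _ _ s])
    then have "prob (S k 0 \<union> S k 1) = prob (S k 0) + prob (S k 1)"
      by (intro finite_measure_Union S)
    moreover have "prob (S k i) \<ge> prob {\<omega> \<in> space M. \<epsilon> (a k) \<omega> = i} * E" if "i \<in> {0,1}" for i
      unfolding S_prob[OF that] by (intro mult_left_mono E_le that measure_nonneg)
    from this[of 0] this[of 1] have "prob (S k 0) + prob (S k 1) \<ge> (prob {\<omega> \<in> space M. \<epsilon> (a k) \<omega> = 0} + prob {\<omega> \<in> space M. \<epsilon> (a k) \<omega> = 1}) * E"
      by (simp add: distrib_right)
    ultimately have "prob (S k 0 \<union> S k 1) \<ge> E"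
      using one by simp
    moreover have "prob J \<le> prob (space M - (S k 0 \<union> S k 1))"
      using S by (intro finite_measure_mono) (auto simp: J_def)
    moreover have "prob (space M - (S k 0 \<union> S k 1)) = 1 - prob (S k 0 \<union> S k 1)"
      using S by (intro prob_compl) auto
    ultimately show ?thesis unfolding E_def by linarith
  qed
  have "(\<lambda>k. 1 - exp (- (lam 0 + lam 1) * (s / real (Suc k)))) \<longlonglongrightarrow> 1 - exp (- (lam 0 + lam 1) * 0)"
    using LIMSEQ_Suc[OF lim_const_over_n[of s]] by (intro tendsto_intros) simp
  then have "prob J \<le> 1 - exp (- (lam 0 + lam 1) * 0)"
    using le by (intro LIMSEQ_le_const) auto
  then have "prob J = 0"
    using measure_nonneg[of M J] by (intro antisym) auto
  show ?thesis
  proof (rule AE_I)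
    show "J \<in> events" by (fact J)
    show "emeasure M J = 0"
      using \<open>prob J = 0\<close> by (simp add: emeasure_eq_measure)
    show "{\<omega> \<in> space M. \<not> isCont (\<lambda>u. \<epsilon> u \<omega>) s} \<subseteq> J"
    proof
      fix \<omega> assume \<omega>: "\<omega> \<in> {\<omega> \<in> space M. \<not> isCont (\<lambda>u. \<epsilon> u \<omega>) s}"
      then interpret step_path "\<lambda>u. \<epsilon> u \<omega>"
        by (intro path) simp
      have "\<omega> \<notin> S k i" for k i
      proof
        assume "\<omega> \<in> S k i"
        then have "isCont (\<lambda>u. \<epsilon> u \<omega>) s"
          using assms a[of k] by (intro isCont_if_const[of s "a k" i]) (auto simp: S_def)
        then show False using \<omega> by simp
      qed
      then show "\<omega> \<in> J"
        using \<omega> by (auto simp: J_def)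
    qed
  qed
qed

text \<open>
  The last condition says on which side of \<open>y\<close> the path is at time \<open>t\<close> if its velocity is
  \<open>v (1 - i)\<close> from time \<open>s\<close> on.
\<close>

definition reach_event :: "(nat \<Rightarrow> real) \<Rightarrow> nat \<Rightarrow> nat \<Rightarrow> nat \<Rightarrow> real \<Rightarrow> real \<Rightarrow> real \<Rightarrow> 'a set" where
  "reach_event v i0 n i t y s = {\<omega> \<in> space M. \<epsilon> 0 \<omega> = i0 \<and> switch_count \<epsilon> s \<omega> = n \<and> \<epsilon> s \<omega> = i \<and>
     (\<forall>u\<in>{0..s}. 0 \<le> telegraph v \<epsilon> u \<omega>) \<and>
     (v i - v (1 - i)) * y < (v i - v (1 - i)) * (telegraph v \<epsilon> s \<omega> + v (1 - i) * (t - s))}"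

text \<open>The guard on the count releases the path from the constraint after its last switching,
  as in \<open>nonneg_until_last\<close>.\<close>

definition switched_event :: "(nat \<Rightarrow> real) \<Rightarrow> nat \<Rightarrow> nat \<Rightarrow> nat \<Rightarrow> real \<Rightarrow> real \<Rightarrow> 'a set" where
  "switched_event v i0 n i t y = {\<omega> \<in> space M. \<epsilon> 0 \<omega> = i0 \<and> switch_count \<epsilon> t \<omega> = Suc n \<and> \<epsilon> t \<omega> = 1 - i \<and>
     (\<forall>u\<in>{0..t}. switch_count \<epsilon> u \<omega> \<le> n \<longrightarrow> 0 \<le> telegraph v \<epsilon> u \<omega>) \<and>
     (v i - v (1 - i)) * y < (v i - v (1 - i)) * telegraph v \<epsilon> t \<omega>}"

lemma reach_event_past:
  assumes "0 \<le> s"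
  shows "reach_event v i0 n i t y s \<in> sets (past s)"
proof -
  have [measurable]: "telegraph v \<epsilon> s \<in> borel_measurable (past s)"
    by (rule telegraph_measurable_past[OF assms])
  have "{\<omega> \<in> space (past s). (v i - v (1 - i)) * y < (v i - v (1 - i)) * (telegraph v \<epsilon> s \<omega> + v (1 - i) * (t - s))} \<in> sets (past s)"
    by measurable
  note past_events = this state_past[OF order_refl assms, of i0, folded space_past[of s]]
    state_past[OF assms order_refl, of i, folded space_past[of s]]
    switch_count_past[OF assms, of n, folded space_past[of s]] nonneg_past[OF assms, of v, folded space_past[of s]]
  have "{\<omega> \<in> space (past s). \<epsilon> 0 \<omega> = i0 \<and> switch_count \<epsilon> s \<omega> = n \<and> \<epsilon> s \<omega> = i \<and>
     (\<forall>u\<in>{0..s}. 0 \<le> telegraph v \<epsilon> u \<omega>) \<and>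
     (v i - v (1 - i)) * y < (v i - v (1 - i)) * (telegraph v \<epsilon> s \<omega> + v (1 - i) * (t - s))} \<in> sets (past s)"
    by (intro sets.sets_Collect_conj past_events)
  then show ?thesis
    unfolding reach_event_def space_past .
qed

section \<open>The last switching located on a grid\<close>

context
  fixes v :: "nat \<Rightarrow> real" and i0 n i :: nat and t y :: real
  assumes t: "0 < t" and i: "i \<in> {0,1}"
begin

abbreviation F :: "real \<Rightarrow> real" where
  "F s \<equiv> prob (reach_event v i0 n i t y s)"

definition grid_event :: "nat \<Rightarrow> nat \<Rightarrow> 'a set" where
  "grid_event K k = {\<omega> \<in> space M. \<omega> \<in> reach_event v i0 n i t y (real k * t / K) \<and>
     (\<forall>u\<in>{real (Suc k) * t / K..t}. \<epsilon> u \<omega> = 1 - i)}"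

lemma grid_points:
  assumes "k < K"
  shows "0 \<le> real k * t / K" "real (Suc k) * t / K \<le> t" "real k * t / K + t / K = real (Suc k) * t / K" "0 < t / K"
proof -
  have "real (Suc k) * t \<le> real K * t"
    using assms t by (intro mult_right_mono) auto
  then show "real (Suc k) * t / K \<le> t"
    using assms by (simp add: divide_le_eq mult.commute del: of_nat_Suc)
  show "real k * t / K + t / K = real (Suc k) * t / K"
    by (simp add: add_divide_distrib distrib_right)
qed (use assms t in auto)

lemma grid_union_past: "(\<Union>k<K. grid_event K k) \<in> sets (past t)"
proof -
  have "{\<omega> \<in> space M. \<exists>k<K. \<omega> \<in> reach_event v i0 n i t y (real k * t / K) \<and>
      (\<forall>u\<in>{real (Suc k) * t / real K..t}. \<epsilon> u \<omega> = 1 - i)} \<in> sets (past t)"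
  proof (rule sets_grid)
    fix k assume "k < K"
    have "{\<omega> \<in> space M. \<omega> \<in> reach_event v i0 n i t y (real k * t / K)} = reach_event v i0 n i t y (real k * t / K)"
      by (auto simp: reach_event_def)
    then show "{\<omega> \<in> space M. \<omega> \<in> reach_event v i0 n i t y (real k * t / K)} \<in> sets (past (real k * t / K))"
      using reach_event_past[OF grid_points(1)[OF \<open>k < K\<close>]] by simp
  qed (use t in simp)
  also have "{\<omega> \<in> space M. \<exists>k<K. \<omega> \<in> reach_event v i0 n i t y (real k * t / K) \<and>
      (\<forall>u\<in>{real (Suc k) * t / real K..t}. \<epsilon> u \<omega> = 1 - i)} = (\<Union>k<K. grid_event K k)"
    by (auto simp: grid_event_def)
  finally show ?thesis .
qed

lemma grid_event_past:
  assumes "k < K"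
  shows "grid_event K k \<in> sets (past t)"
proof -
  have "reach_event v i0 n i t y (real k * t / K) \<in> sets (past t)"
    using grid_points[OF assms] by (intro past_mono[OF _ reach_event_past]) auto
  moreover have "{\<omega> \<in> space M. \<forall>u\<in>{real (Suc k) * t / K..t}. \<epsilon> u \<omega> = 1 - i} \<in> sets (past t)"
    using grid_points(2)[OF assms] t by (intro past_stay) auto
  moreover have "grid_event K k = reach_event v i0 n i t y (real k * t / K) \<inter> {\<omega> \<in> space M. \<forall>u\<in>{real (Suc k) * t / K..t}. \<epsilon> u \<omega> = 1 - i}"
    by (auto simp: grid_event_def)
  ultimately show ?thesis
    by (simp only: sets.Int)
qed

text \<open>The three factors are peeled off from the end: staying after the cell, one transition
  across the cell, and the past at its left end.\<close>

lemma prob_grid_event: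
  assumes "k < K"
  shows "prob (grid_event K k) = p (t / K) i (1 - i) * (exp (- lam (1 - i) * (t - real (Suc k) * t / K)) * F (real k * t / K))"
proof -
  define s where "s = real k * t / K"
  define h where "h = t / K"
  define E where "E = reach_event v i0 n i t y s"
  note grid = grid_points[OF assms, folded s_def h_def]
  have E: "E \<in> sets (past s)"
    unfolding E_def by (rule reach_event_past[OF grid(1)])
  have "prob (grid_event K k) = prob {\<omega> \<in> space M. \<omega> \<in> E \<and> (\<forall>u\<in>{s + h..t}. \<epsilon> u \<omega> = 1 - i)}"
    unfolding grid_event_def E_def s_def[symmetric] grid(3) ..
  also have "\<dots> = prob {\<omega> \<in> space M. \<omega> \<in> E \<and> \<epsilon> (s + h) \<omega> = 1 - i} * exp (- lam (1 - i) * (t - (s + h)))"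
    using E grid i by (intro prob_stay past_mono[OF _ E]) auto
  also have "{\<omega> \<in> space M. \<omega> \<in> E \<and> \<epsilon> (s + h) \<omega> = 1 - i} = {\<omega> \<in> space M. \<omega> \<in> E \<and> \<epsilon> s \<omega> = i \<and> \<epsilon> (s + h) \<omega> = 1 - i}"
    by (auto simp: E_def reach_event_def)
  also have "prob \<dots> = prob {\<omega> \<in> space M. \<omega> \<in> E \<and> \<epsilon> s \<omega> = i} * p h i (1 - i)"
    using i grid by (intro markov_past E) auto
  also have "{\<omega> \<in> space M. \<omega> \<in> E \<and> \<epsilon> s \<omega> = i} = E"
    by (auto simp: E_def reach_event_def)
  finally have "prob (grid_event K k) = prob E * p h i (1 - i) * exp (- lam (1 - i) * (t - (s + h)))" .
  then show ?thesis
    unfolding grid(3) by (simp only: E_def s_def h_def mult_ac)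
qed

text \<open>After its own cell a path of the event has state \<open>1 - i\<close>, but a later cell
  would have to start in state \<open>i\<close>.\<close>

lemma disjoint_grid_events: "disjoint_family_on (grid_event K) {..<K}"
proof -
  have "grid_event K k \<inter> grid_event K l = {}" if "k < l" "l < K" for k l
  proof -
    have "real (Suc k) * t \<le> real l * t"
      using that t by (intro mult_right_mono) auto
    then have "real (Suc k) * t / K \<le> real l * t / K"
      by (intro divide_right_mono) auto
    moreover have "real l * t / K \<le> t"
      using grid_points[OF that(2)] by linarith
    ultimately have "\<epsilon> (real l * t / K) \<omega> = 1 - i" if "\<omega> \<in> grid_event K k" for \<omega>
      using that by (auto simp: grid_event_def)
    moreover have "\<epsilon> (real l * t / K) \<omega> = i" if "\<omega> \<in> grid_event K l" for \<omega>
      using that by (auto simp: grid_event_def reach_event_def)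
    ultimately show ?thesis using i by fastforce
  qed
  then show ?thesis
    unfolding disjoint_family_on_def by (metis Int_commute lessThan_iff nat_neq_iff)
qed

lemma eventually_grid_union:
  assumes \<omega>: "\<omega> \<in> space M"
  shows "\<forall>\<^sub>F K in sequentially. \<omega> \<in> (\<Union>k<K. grid_event K k) \<longleftrightarrow> \<omega> \<in> switched_event v i0 n i t y"
proof -
  interpret step_path "\<lambda>s. \<epsilon> s \<omega>"
    by (intro path \<omega>)
  from eventually_grid_reach[OF t i, of n v y] show ?thesis
  proof eventually_elim
    case (elim K)
    have "\<omega> \<in> (\<Union>k<K. grid_event K k) \<longleftrightarrow> \<epsilon> 0 \<omega> = i0 \<and> (\<exists>k<K. N (real k * t / K) = n \<and> \<epsilon> (real k * t / K) \<omega> = i \<and>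
        reach v i t y (real k * t / K) \<and> (\<forall>u\<in>{real (Suc k) * t / K..t}. \<epsilon> u \<omega> = 1 - i))"
      using \<omega> unfolding grid_event_def reach_event_def reach_def telegraph_def switch_count_def by blast
    also have "\<dots> \<longleftrightarrow> \<omega> \<in> switched_event v i0 n i t y"
      unfolding elim using \<omega>
      unfolding switched_event_def nonneg_until_last_def telegraph_def switch_count_def by blast
    finally show ?case .
  qed
qed

lemma switched_event_past: "switched_event v i0 n i t y \<in> sets (past t)"
proof -
  have "{\<omega> \<in> space M. \<omega> \<in> switched_event v i0 n i t y} \<in> sets (past t)"
  proof (rule past_eventually)
    fix K :: nat
    have "{\<omega> \<in> space M. \<omega> \<in> (\<Union>k<K. grid_event K k)} = (\<Union>k<K. grid_event K k)"
      by (auto simp: grid_event_def)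
    then show "{\<omega> \<in> space M. \<omega> \<in> (\<Union>k<K. grid_event K k)} \<in> sets (past t)"
      using grid_union_past[of K] by simp
  qed (rule eventually_grid_union)
  also have "{\<omega> \<in> space M. \<omega> \<in> switched_event v i0 n i t y} = switched_event v i0 n i t y"
    by (auto simp: switched_event_def)
  finally show ?thesis .
qed

text \<open>Left continuity of the probability. The event itself can jump at a switching, but almost
  no path switches at the fixed time \<open>s\<close>.\<close>

lemma F_tendsto:
  assumes "0 < s" "filterlim f (at_left s) sequentially" "\<And>K. 0 \<le> f K"
  shows "(\<lambda>K. F (f K)) \<longlonglongrightarrow> F s"
proof (rule prob_tendsto)
  show "AE \<omega> in M. \<forall>\<^sub>F K in sequentially. \<omega> \<in> reach_event v i0 n i t y (f K) \<longleftrightarrow> \<omega> \<in> reach_event v i0 n i t y s"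
    using AE_isCont[OF assms(1)] AE_space
  proof eventually_elim
    case (elim \<omega>)
    interpret step_path "\<lambda>s. \<epsilon> s \<omega>"
      by (intro path elim)
    have "\<forall>\<^sub>F u in at_left s. (N u = n \<and> \<epsilon> u \<omega> = i \<and> reach v i t y u) \<longleftrightarrow> (N s = n \<and> \<epsilon> s \<omega> = i \<and> reach v i t y s)"
      by (rule eventually_left_event[OF assms(1) elim(1)])
    with assms(2) have "\<forall>\<^sub>F K in sequentially. (N (f K) = n \<and> \<epsilon> (f K) \<omega> = i \<and> reach v i t y (f K)) \<longleftrightarrow> (N s = n \<and> \<epsilon> s \<omega> = i \<and> reach v i t y s)"
      by (rule eventually_compose_filterlim[rotated])
    then show ?case
    proof eventually_elim
      case (elim K)
      then show ?case
        using \<open>\<omega> \<in> space M\<close> unfolding reach_event_def reach_def telegraph_def switch_count_def by blast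
    qed
  qed
  show "reach_event v i0 n i t y (f K) \<in> events" for K
    using reach_event_past[OF assms(3)] past_subset_events by blast
  show "reach_event v i0 n i t y s \<in> events"
    using reach_event_past[OF less_imp_le[OF assms(1)]] past_subset_events by blast
qed

text \<open>The grid probabilities sum to \<open>p h i (1 - i) / h\<close>, which tends to
  \<open>lam i\<close>, times a Riemann sum. Its step functions converge at every point by left
  continuity and are bounded by 1. As their limit is measurable, measurability of \<open>F\<close>
  is a by-product.\<close>

lemma last_switching_recursion:
  "set_borel_measurable lborel {0<..t} F"
  "prob (switched_event v i0 n i t y) = (LINT s:{0<..t}|lborel. lam i * exp (- lam (1 - i) * (t - s)) * F s)"
proof -
  define h where "h K = t / real (Suc K)" for K
  have h: "0 < h K" "real (Suc K) * h K = t" for K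
    using t by (auto simp: h_def)
  define k where "k K s = nat (\<lceil>s / h K\<rceil> - 1)" for K s
  have k: "real (k K s) * h K < s" "s \<le> real (k K s) * h K + h K" if "0 < s" for K s
  proof -
    have "0 < s / h K" using h that by simp
    then have "1 \<le> \<lceil>s / h K\<rceil>" by simp
    then have "real (k K s) = of_int \<lceil>s / h K\<rceil> - 1"
      by (simp add: k_def)
    then have "real (k K s) < s / h K" "s / h K \<le> real (k K s) + 1"
      by linarith+
    then show "real (k K s) * h K < s" "s \<le> real (k K s) * h K + h K"
      using h[of K] by (simp_all add: field_simps)
  qed
  have h_0: "h \<longlonglongrightarrow> 0"
    unfolding h_def[abs_def] using LIMSEQ_Suc[OF lim_const_over_n[of t]] by simp
  have k_left: "filterlim (\<lambda>K. real (k K s) * h K) (at_left s) sequentially" if "0 < s" for s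
    unfolding filterlim_at
  proof
    show "\<forall>\<^sub>F K in sequentially. real (k K s) * h K \<in> {..<s} \<and> real (k K s) * h K \<noteq> s"
      using k(1)[OF that] by (intro eventuallyI) (auto simp: less_le)
    have "(\<lambda>K. s - h K) \<longlonglongrightarrow> s - 0"
      by (intro tendsto_intros h_0)
    then have lower: "(\<lambda>K. s - h K) \<longlonglongrightarrow> s" by simp
    show "(\<lambda>K. real (k K s) * h K) \<longlonglongrightarrow> s"
    proof (rule tendsto_sandwich[OF _ _ lower tendsto_const])
      show "\<forall>\<^sub>F K in sequentially. s - h K \<le> real (k K s) * h K"
        using k(2)[OF that] by (intro eventuallyI) (auto simp: algebra_simps)
      show "\<forall>\<^sub>F K in sequentially. real (k K s) * h K \<le> s"
        using k(1)[OF that] by (intro eventuallyI less_imp_le) auto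
    qed
  qed
  have F_lim: "(\<lambda>K. F (real (k K s) * h K)) \<longlonglongrightarrow> F s" if "0 < s" for s
    using less_imp_le[OF h(1)] by (intro F_tendsto[OF that k_left[OF that]] mult_nonneg_nonneg) auto
  \<comment> \<open>On a cell, \<open>F\<close> is taken at the left end and the exponential at the
    right end: between the two lies the transition.\<close>
  define g where "g K j = exp (- lam (1 - i) * (t - real (Suc j) * h K)) * F (real j * h K)" for K j
  have step: "has_bochner_integral lborel (\<lambda>s. indicator {0<..t} s * g K (k K s)) (h K * (\<Sum>j<Suc K. g K j))" for K
    using has_bochner_integral_step_function[OF h(1)[of K], of "Suc K" "g K"] h(2)[of K] by (simp only: k_def)
  have g_lim: "(\<lambda>K. indicator {0<..t} s * g K (k K s)) \<longlonglongrightarrow> indicator {0<..t} s * (exp (- lam (1 - i) * (t - s)) * F s)" for s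
  proof (cases "0 < s")
    case True
    have "(\<lambda>K. real (k K s) * h K) \<longlonglongrightarrow> s"
      using k_left[OF True] by (simp add: filterlim_at)
    then have "(\<lambda>K. real (k K s) * h K + h K) \<longlonglongrightarrow> s + 0"
      by (intro tendsto_intros h_0)
    then have "(\<lambda>K. real (Suc (k K s)) * h K) \<longlonglongrightarrow> s"
      by (simp add: algebra_simps)
    then show ?thesis
      unfolding g_def by (intro tendsto_intros F_lim[OF True])
  qed simp
  have meas: "(\<lambda>s. indicator {0<..t} s * g K (k K s)) \<in> borel_measurable lborel" for K
    using step[of K] by (rule borel_measurable_has_bochner_integral)
  have limit_meas: "(\<lambda>s. indicator {0<..t} s * (exp (- lam (1 - i) * (t - s)) * F s)) \<in> borel_measurable lborel"
    by (rule borel_measurable_LIMSEQ_real[OF g_lim meas])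
  \<comment> \<open>Multiplication by the inverse exponential recovers \<open>F\<close> from the
    measurable limit.\<close>
  have "(\<lambda>s. exp (lam (1 - i) * (t - s)) * (indicator {0<..t} s * (exp (- lam (1 - i) * (t - s)) * F s))) \<in> borel_measurable lborel"
    by (intro borel_measurable_times limit_meas) measurable
  moreover have "exp (lam (1 - i) * (t - s)) * (indicator {0<..t} s * (exp (- lam (1 - i) * (t - s)) * F s)) = indicator {0<..t} s *\<^sub>R F s" for s
    by (simp add: mult_exp_exp flip: mult.assoc)
  ultimately show "set_borel_measurable lborel {0<..t} F"
    unfolding set_borel_measurable_def by (simp only:)
  have "(\<lambda>K. \<integral>s. indicator {0<..t} s * g K (k K s) \<partial>lborel) \<longlonglongrightarrow> (\<integral>s. indicator {0<..t} s * (exp (- lam (1 - i) * (t - s)) * F s) \<partial>lborel)"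
  proof (rule integral_dominated_convergence[where w = "indicator {0<..t}"])
    fix K
    have "norm (indicator {0<..t} s * g K (k K s)) \<le> indicator {0<..t} s" for s
    proof (cases "s \<in> {0<..t}")
      case True
      have "real (k K s) < real (Suc K)"
      proof -
        have "real (k K s) * h K < real (Suc K) * h K"
          unfolding h(2) using k(1)[of s K] True by simp
        then show ?thesis
          using h(1)[of K] by (simp only: mult_less_cancel_right_pos)
      qed
      then have "real (Suc (k K s)) \<le> real (Suc K)"
        by simp
      then have "real (Suc (k K s)) * h K \<le> real (Suc K) * h K"
        using h(1)[of K] by (intro mult_right_mono) auto
      then have "exp (- lam (1 - i) * (t - real (Suc (k K s)) * h K)) \<le> 1"
        using h(2)[of K] lam_pos i by (auto simp del: of_nat_Suc)
      then have "g K (k K s) \<le> 1 * 1"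
        unfolding g_def by (intro mult_mono) auto
      moreover have "0 \<le> g K (k K s)"
        unfolding g_def by (intro mult_nonneg_nonneg) auto
      ultimately show ?thesis using True by simp
    qed simp
    then show "AE s in lborel. norm (indicator {0<..t} s * g K (k K s)) \<le> indicator {0<..t} s"
      by (intro AE_I2)
  next
    show "integrable lborel (indicator {0<..t} :: real \<Rightarrow> real)"
      using t by (intro integrable_real_indicator) auto
  qed (use g_lim meas limit_meas in auto)
  then have 1: "(\<lambda>K. h K * (\<Sum>j<Suc K. g K j)) \<longlonglongrightarrow> (\<integral>s. indicator {0<..t} s * (exp (- lam (1 - i) * (t - s)) * F s) \<partial>lborel)"
    unfolding has_bochner_integral_integral_eq[OF step] .
  have "filterlim h (at_right 0) sequentially"
    using h_0 h(1) by (simp add: filterlim_at order_less_imp_not_eq2)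
  from filterlim_compose[OF transition_props(4)[OF i order_refl] this]
  have 2: "(\<lambda>K. p (h K) i (1 - i) / h K) \<longlonglongrightarrow> lam i" .
  have "(\<lambda>K. prob (\<Union>j<Suc K. grid_event (Suc K) j)) \<longlonglongrightarrow> prob (switched_event v i0 n i t y)"
  proof (rule LIMSEQ_Suc[of "\<lambda>K. prob (\<Union>j<K. grid_event K j)"], rule prob_tendsto)
    show "AE \<omega> in M. \<forall>\<^sub>F K in sequentially. \<omega> \<in> (\<Union>j<K. grid_event K j) \<longleftrightarrow> \<omega> \<in> switched_event v i0 n i t y"
      by (intro AE_I2 eventually_grid_union)
  qed (use grid_union_past switched_event_past past_subset_events in blast)+
  \<comment> \<open>Dividing and multiplying by the mesh separates the rate from the Riemann
    sum.\<close>
  moreover have "prob (\<Union>j<Suc K. grid_event (Suc K) j) = p (h K) i (1 - i) / h K * (h K * (\<Sum>j<Suc K. g K j))" for K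
  proof -
    have "prob (\<Union>j<Suc K. grid_event (Suc K) j) = (\<Sum>j<Suc K. prob (grid_event (Suc K) j))"
      using grid_event_past past_subset_events disjoint_grid_events
      by (intro finite_measure_finite_Union) blast+
    also have "\<dots> = (\<Sum>j<Suc K. p (h K) i (1 - i) * g K j)"
    proof (rule sum.cong[OF refl])
      fix j assume "j \<in> {..<Suc K}"
      then show "prob (grid_event (Suc K) j) = p (h K) i (1 - i) * g K j"
        using prob_grid_event[of j "Suc K"] by (simp only: lessThan_iff g_def h_def times_divide_eq_right)
    qed
    also have "\<dots> = p (h K) i (1 - i) / h K * (h K * (\<Sum>j<Suc K. g K j))"
      using h(1)[of K] by (simp add: sum_distrib_left[symmetric])
    finally show ?thesis .
  qed
  moreover have "(\<lambda>K. p (h K) i (1 - i) / h K * (h K * (\<Sum>j<Suc K. g K j)))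
      \<longlonglongrightarrow> lam i * (\<integral>s. indicator {0<..t} s * (exp (- lam (1 - i) * (t - s)) * F s) \<partial>lborel)"
    by (intro tendsto_mult 1 2)
  ultimately have "prob (switched_event v i0 n i t y) = lam i * (\<integral>s. indicator {0<..t} s * (exp (- lam (1 - i) * (t - s)) * F s) \<partial>lborel)"
    using LIMSEQ_unique by force
  then show "prob (switched_event v i0 n i t y) = (LINT s:{0<..t}|lborel. lam i * exp (- lam (1 - i) * (t - s)) * F s)"
    unfolding set_lebesgue_integral_def by (simp add: mult_ac flip: integral_mult_right_zero)
qed

end

end

section \<open>The densities\<close>

text \<open>The velocities are \<open>\<alpha>\<close> and \<open>- \<beta>\<close>;
  \<open>l\<close> and \<open>k\<close> are the rates of leaving the upward and the downward
  state.\<close>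

locale telegraph_density =
  fixes \<alpha> \<beta> l k :: real
  assumes pos: "0 < \<alpha>" "0 < \<beta>" "0 < l" "0 < k"
begin

text \<open>\<open>xa\<close> and \<open>xb\<close> are the times spent going up and going down
  until \<open>t\<close> by a path that is at \<open>x\<close> at time \<open>t\<close>.\<close>

definition xa :: "real \<Rightarrow> real \<Rightarrow> real" where
  "xa t x = (x + \<beta> * t) / (\<alpha> + \<beta>)"

definition xb :: "real \<Rightarrow> real \<Rightarrow> real" where
  "xb t x = (\<alpha> * t - x) / (\<alpha> + \<beta>)"

definition th :: "real \<Rightarrow> real \<Rightarrow> real" where
  "th t x = exp (- l * xa t x - k * xb t x) / (\<alpha> + \<beta>)"

text \<open>This belongs to \<open>2 * m + 1\<close> switchings, the last flight going down;
  \<open>q_even\<close> belongs to \<open>2 * m + 2\<close>.\<close>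

definition q_odd :: "nat \<Rightarrow> real \<Rightarrow> real \<Rightarrow> real" where
  "q_odd m t x = l / xa t x * ((l * k * xa t x * xb t x) ^ m / (fact m)\<^sup>2) * th t x
     * (1 / \<alpha> * (x + \<beta> / real (m + 1) * xb t x))"

definition q_even :: "nat \<Rightarrow> real \<Rightarrow> real \<Rightarrow> real" where
  "q_even m t x = l * k * ((l * k * xa t x * xb t x) ^ m / (fact m * fact (m + 1))) * th t x * (x / \<alpha>)"

text \<open>\<open>dens n\<close> is the density for \<open>Suc n\<close> switchings.\<close>

definition dens :: "nat \<Rightarrow> real \<Rightarrow> real \<Rightarrow> real" where
  "dens n t x = indicator {0<..<\<alpha> * t} x * (if even n then q_odd (n div 2) t x else q_even (n div 2) t x)"

lemma dens_measurable [measurable]: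
  assumes [measurable]: "f \<in> borel_measurable M" "g \<in> borel_measurable M"
  shows "(\<lambda>z. dens n (f z) (g z)) \<in> borel_measurable M"
proof -
  have "(\<lambda>z. (if 0 < g z \<and> g z < \<alpha> * f z then 1 else 0) *
      (if even n then q_odd (n div 2) (f z) (g z) else q_even (n div 2) (f z) (g z))) \<in> borel_measurable M"
    unfolding q_odd_def q_even_def th_def xa_def xb_def by measurable
  then show ?thesis
    unfolding dens_def indicator_def of_bool_def greaterThanLessThan_iff .
qed

lemma coords:
  shows "xa t x + xb t x = t" "\<alpha> * xa t x - \<beta> * xb t x = x"
proof -
  have "xa t x + xb t x = ((\<alpha> + \<beta>) * t) / (\<alpha> + \<beta>)"
    "\<alpha> * xa t x - \<beta> * xb t x = ((\<alpha> + \<beta>) * x) / (\<alpha> + \<beta>)"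
    unfolding xa_def xb_def times_divide_eq_right
    by (simp_all only: add_divide_distrib[symmetric] diff_divide_distrib[symmetric]) (simp_all add: algebra_simps)
  then show "xa t x + xb t x = t" "\<alpha> * xa t x - \<beta> * xb t x = x"
    using pos by simp_all
qed

lemma coords_pos:
  assumes "0 < x" "x < \<alpha> * t"
  shows "0 < t" "0 < xa t x" "0 < xb t x" "xa t x < t" "xb t x < t"
proof -
  have "0 < \<alpha> * t" using assms by simp
  then show t: "0 < t" using pos by (simp add: zero_less_mult_iff)
  show a: "0 < xa t x"
    unfolding xa_def using assms pos t by (intro divide_pos_pos add_pos_pos mult_pos_pos) auto
  show b: "0 < xb t x"
    unfolding xb_def using assms pos by simp
  show "xa t x < t" "xb t x < t"
    using coords(1)[of t x] a b by auto
qed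

lemma coords_unique:
  assumes "a + b = t" "\<alpha> * a - \<beta> * b = x"
  shows "xa t x = a" "xb t x = b"
proof -
  have "x + \<beta> * t = a * (\<alpha> + \<beta>)" "\<alpha> * t - x = b * (\<alpha> + \<beta>)"
    using assms by (auto simp: algebra_simps)
  then show "xa t x = a" "xb t x = b"
    unfolding xa_def xb_def using pos by simp_all
qed

text \<open>Puts the last factor of \<open>q_odd\<close> in terms of the two occupation times, the
  shape in which it can be integrated with one of them fixed.\<close>

lemma shift_quotient: "1 / \<alpha> * (\<alpha> * u - \<beta> * b + \<beta> / real (m + 1) * b) = u - \<beta> / \<alpha> * b * m / (m + 1)"
proof -
  define D where "D = real (m + 1)"
  have D: "real m = D - 1" "0 < D" by (auto simp: D_def)
  have "1 / \<alpha> * (\<alpha> * u - \<beta> * b + \<beta> / D * b) = u - \<beta> / \<alpha> * b * (D - 1) / D"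
    using D(2) pos by (simp add: field_simps)
  then show ?thesis
    unfolding D(1)[symmetric] unfolding D_def by simp
qed

lemma dens_nonneg: "0 \<le> dens n t x"
proof (cases "0 < x \<and> x < \<alpha> * t")
  case True
  with coords_pos[of x t] have "0 < xa t x" "0 < xb t x" by auto
  then show ?thesis
    using True pos unfolding dens_def q_odd_def q_even_def th_def
    by (auto intro!: mult_nonneg_nonneg divide_nonneg_nonneg add_nonneg_nonneg zero_le_power)
qed (auto simp: dens_def indicator_def)

section \<open>One step of the recursion, by the direction of the last flight\<close>

text \<open>The last flight goes up: the time \<open>b\<close> spent going down is final when it
  starts, and the time spent going up is then \<open>s - b\<close>. The flight starts above 0, which
  bounds \<open>s\<close> from below by \<open>s0\<close>.\<close>

lemma dens_step_even:
  assumes "even n" "0 < y"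
  shows "(\<integral>\<^sup>+s. ennreal (indicator {0<..t} s * (k * exp (- l * (t - s)) * dens n s (y - \<alpha> * (t - s)))) \<partial>lborel)
    = ennreal (dens (Suc n) t y)"
proof (cases "y < \<alpha> * t")
  case False
  have *: "dens n s (y - \<alpha> * (t - s)) = 0" for s
    using False by (auto simp: dens_def indicator_def algebra_simps)
  show ?thesis
    unfolding * using False by (simp add: dens_def)
next
  case True
  define m where "m = n div 2"
  define a where "a = xa t y"
  define b where "b = xb t y"
  define c where "c = \<beta> / \<alpha>"
  \<comment> \<open>The time at which the upward line that ends in \<open>y\<close> at time
    \<open>t\<close> crosses 0.\<close>
  define s0 where "s0 = t - y / \<alpha>"
  have ab: "0 < t" "0 < a" "0 < b" "a + b = t" "\<alpha> * a - \<beta> * b = y"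
    using coords_pos[OF \<open>0 < y\<close> True] coords[of t y] by (auto simp: a_def b_def)
  have "0 < c" using pos by (simp add: c_def)
  have s0: "0 < s0" "s0 < t"
    using pos True \<open>0 < y\<close> by (auto simp: s0_def field_simps)
  have s0_b: "s0 - b = c * b"
    using ab(4,5) pos by (auto simp: s0_def c_def field_simps)
  have yc: "y / \<alpha> = a - c * b"
    using ab(5) pos by (auto simp: c_def field_simps)
  define T where "T = exp (- l * a - k * b) / (\<alpha> + \<beta>)"
  define K where "K = k * l * (l * k) ^ m * b ^ m / (fact m)\<^sup>2 * T"
  have "0 \<le> K"
    using pos ab unfolding K_def T_def by simp
  \<comment> \<open>The quotient \<open>(s - b) ^ m / (s - b)\<close> stands for a power with
    exponent \<open>m - 1\<close> and is also right for \<open>m = 0\<close>, where truncated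
    subtraction would not be.\<close>
  define f where "f s = K * ((s - b) ^ m / (s - b) * ((s - b) - c * b * m / (m + 1)))" for s
  define \<Phi> where "\<Phi> s = K / (m + 1) * ((s - b) ^ m * ((s - b) - c * b))" for s
  have *: "indicator {0<..t} s * (k * exp (- l * (t - s)) * dens n s (y - \<alpha> * (t - s))) = f s * indicator {s0<..t} s" for s
  proof (cases "s0 < s \<and> s \<le> t")
    case False
    then show ?thesis
      using pos True \<open>0 < y\<close> by (auto simp: dens_def s0_def indicator_def field_simps)
  next
    case s: True
    define x where "x = y - \<alpha> * (t - s)"
    have x: "0 < x" "x < \<alpha> * s"
      using s True pos by (auto simp: x_def s0_def field_simps)
    have "s - b + b = s" "\<alpha> * (s - b) - \<beta> * b = x"
      by (simp_all add: x_def ab(4,5)[symmetric] algebra_simps)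
    note co = coords_unique[OF this]
    have u: "0 < s - b"
      using s s0_b \<open>0 < c\<close> ab by (smt (verit) mult_pos_pos)
    \<comment> \<open>The weights before and after the switching combine to the weight of the final
      occupation times, the same for all \<open>s\<close>.\<close>
    have E: "exp (- l * (t - s)) * exp (- l * (s - b) - k * b) = exp (- l * a - k * b)"
      unfolding mult_exp_exp by (simp add: ab(4)[symmetric] algebra_simps)
    have x_eq: "1 / \<alpha> * (x + \<beta> / real (m + 1) * b) = (s - b) - c * b * m / (m + 1)"
    proof -
      have "x = \<alpha> * (s - b) - \<beta> * b"
        using coords(2)[of s x] co by simp
      then show ?thesis
        using shift_quotient[of "s - b" b m] by (simp only: c_def)
    qed
    have "k * exp (- l * (t - s)) * dens n s x = k * (exp (- l * (t - s)) * (l / (s - b) * ((l * k * (s - b) * b) ^ m / (fact m)\<^sup>2)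
        * (exp (- l * (s - b) - k * b) / (\<alpha> + \<beta>)) * ((s - b) - c * b * m / (m + 1))))"
      using x assms(1) unfolding dens_def q_odd_def th_def co m_def[symmetric] x_eq by (simp only: mult.assoc) simp
    also have "\<dots> = k * (l / (s - b) * ((l * k * (s - b) * b) ^ m / (fact m)\<^sup>2)
        * (exp (- l * (t - s)) * exp (- l * (s - b) - k * b) / (\<alpha> + \<beta>)) * ((s - b) - c * b * m / (m + 1)))"
      by simp
    also have "\<dots> = f s"
      unfolding E f_def K_def T_def by (simp add: power_mult_distrib mult_ac)
    finally show ?thesis
      using s s0 by (simp add: x_def)
  qed
  have "(\<integral>\<^sup>+s. ennreal (indicator {0<..t} s * (k * exp (- l * (t - s)) * dens n s (y - \<alpha> * (t - s)))) \<partial>lborel)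
      = (\<integral>\<^sup>+s. ennreal (f s) * indicator {s0..t} s \<partial>lborel)"
    unfolding *
  proof (rule nn_integral_cong_AE)
    show "AE s in lborel. ennreal (f s * indicator {s0<..t} s) = ennreal (f s) * indicator {s0..t} s"
      using AE_lborel_singleton[of s0] by eventually_elim (auto simp: indicator_def)
  qed
  also have "\<dots> = \<Phi> t - \<Phi> s0"
  proof (rule nn_integral_FTC_Icc)
    show "f \<in> borel_measurable borel"
      unfolding f_def by measurable
    fix s assume "s \<in> {s0..t}"
    then have s: "s0 \<le> s" "s \<le> t" by auto
    have u: "c * b \<le> s - b" "0 < c * b"
      using s s0_b \<open>0 < c\<close> ab by auto
    then have u0: "s - b \<noteq> 0" by auto
    have "(\<Phi> has_real_derivative K / (m + 1) * (real m * (s - b) ^ (m - 1) * ((s - b) - c * b) + (s - b) ^ m)) (at s)"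
      unfolding \<Phi>_def by (auto intro!: derivative_eq_intros)
    moreover have "real m * (s - b) ^ (m - 1) = real m * ((s - b) ^ m / (s - b))"
      using u0 by (cases m) auto
    moreover have "K / (m + 1) * (real m * ((s - b) ^ m / (s - b)) * ((s - b) - c * b) + (s - b) ^ m) = f s"
    proof -
      have "(s - b) ^ m = (s - b) ^ m / (s - b) * (s - b)" using u0 by simp
      then have "real m * ((s - b) ^ m / (s - b)) * ((s - b) - c * b) + (s - b) ^ m
          = (s - b) ^ m / (s - b) * (real m * ((s - b) - c * b) + (s - b))"
        by (simp only: distrib_left mult.assoc mult.left_commute mult.commute)
      also have "real m * ((s - b) - c * b) + (s - b) = (m + 1) * ((s - b) - c * b * m / (m + 1))"
        by (simp add: field_simps)
      finally have eq: "real m * ((s - b) ^ m / (s - b)) * ((s - b) - c * b) + (s - b) ^ m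
          = (s - b) ^ m / (s - b) * ((m + 1) * ((s - b) - c * b * m / (m + 1)))" .
      have cancel: "D \<noteq> 0 \<Longrightarrow> K / D * (W * (D * X)) = K * (W * X)" for D W X :: real
        by simp
      show ?thesis
        unfolding eq f_def by (rule cancel) simp
    qed
    ultimately show "(\<Phi> has_real_derivative f s) (at s)"
      by simp
    have "c * b * m / (m + 1) \<le> c * b"
      using u by (simp add: field_simps)
    then show "0 \<le> f s"
      using u \<open>0 \<le> K\<close> unfolding f_def by (intro mult_nonneg_nonneg divide_nonneg_nonneg) auto
  qed (use s0 in auto)
  also have "\<Phi> t - \<Phi> s0 = dens (Suc n) t y"
  proof -
    have "\<Phi> s0 = 0" by (simp add: \<Phi>_def s0_b)
    moreover have "\<Phi> t = K / (m + 1) * (a ^ m * (y / \<alpha>))"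
      using ab(4) by (simp add: \<Phi>_def yc flip: ab(4))
    moreover have "dens (Suc n) t y = l * k * ((l * k * a * b) ^ m / (fact m * fact (m + 1))) * T * (y / \<alpha>)"
      using assms True by (simp add: dens_def q_even_def th_def a_def b_def T_def m_def)
    ultimately show ?thesis
      unfolding K_def by (simp add: power_mult_distrib power2_eq_square field_simps)
  qed
  finally show ?thesis .
qed

text \<open>The last flight goes down to \<open>y > 0\<close>, so it starts higher still and the
  constraint imposes no bound. The time \<open>a\<close> spent going up is fixed, and
  \<open>s - a\<close>, the time spent going down so far, runs up from 0.\<close>

lemma dens_step_odd:
  assumes "odd n" "0 < y"
  shows "(\<integral>\<^sup>+s. ennreal (indicator {0<..t} s * (l * exp (- k * (t - s)) * dens n s (y + \<beta> * (t - s)))) \<partial>lborel)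
    = ennreal (dens (Suc n) t y)"
proof (cases "y < \<alpha> * t")
  case False
  have *: "indicator {0<..t} s * (l * exp (- k * (t - s)) * dens n s (y + \<beta> * (t - s))) = 0" for s
  proof (cases "s \<le> t")
    case True
    have "\<alpha> * s \<le> \<alpha> * t" "0 \<le> \<beta> * (t - s)"
      using True pos by auto
    then show ?thesis
      using False by (auto simp: dens_def indicator_def)
  qed simp
  show ?thesis
    unfolding * using False by (simp add: dens_def)
next
  case True
  define m where "m = n div 2"
  define a where "a = xa t y"
  define b where "b = xb t y"
  define c where "c = \<beta> / \<alpha>"
  have ab: "0 < t" "0 < a" "0 < b" "a + b = t" "\<alpha> * a - \<beta> * b = y"
    using coords_pos[OF \<open>0 < y\<close> True] coords[of t y] by (auto simp: a_def b_def)
  have "0 < c" using pos by (simp add: c_def)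
  have yc: "y / \<alpha> = a - c * b"
    using ab(5) pos by (auto simp: c_def field_simps)
  define T where "T = exp (- l * a - k * b) / (\<alpha> + \<beta>)"
  define K where "K = l * (l * k) ^ (m + 1) * a ^ m / (fact m * fact (m + 1)) * T"
  have "0 \<le> K"
    using pos ab unfolding K_def T_def by simp
  define f where "f s = K * ((s - a) ^ m * (a - c * (s - a)))" for s
  define \<Phi> where "\<Phi> s = K * (a / (m + 1) * (s - a) ^ Suc m - c / (m + 2) * (s - a) ^ Suc (Suc m))" for s
  have *: "indicator {0<..t} s * (l * exp (- k * (t - s)) * dens n s (y + \<beta> * (t - s))) = f s * indicator {a<..t} s" for s
  proof (cases "a < s \<and> s \<le> t")
    case False
    have "y + \<beta> * (t - s) - \<alpha> * s = (a - s) * (\<alpha> + \<beta>)"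
      by (simp add: ab(4,5)[symmetric] algebra_simps)
    then have "s \<le> a \<Longrightarrow> \<alpha> * s \<le> y + \<beta> * (t - s)"
      using pos by (smt (verit) mult_nonneg_nonneg)
    then show ?thesis
      using False by (auto simp: dens_def indicator_def)
  next
    case s: True
    define x where "x = y + \<beta> * (t - s)"
    have "x - \<alpha> * s = (a - s) * (\<alpha> + \<beta>)"
      by (simp add: x_def ab(4,5)[symmetric] algebra_simps)
    moreover have "(a - s) * (\<alpha> + \<beta>) < 0"
      using s pos by (intro mult_neg_pos) auto
    moreover have "0 \<le> \<beta> * (t - s)"
      using s pos by simp
    ultimately have x: "0 < x" "x < \<alpha> * s"
      using \<open>0 < y\<close> by (auto simp: x_def)
    have "a + (s - a) = s" "\<alpha> * a - \<beta> * (s - a) = x"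
      by (simp_all add: x_def ab(4,5)[symmetric] algebra_simps)
    note co = coords_unique[OF this]
    have E: "exp (- k * (t - s)) * exp (- l * a - k * (s - a)) = exp (- l * a - k * b)"
      unfolding mult_exp_exp by (simp add: ab(4)[symmetric] algebra_simps)
    have x_eq: "x / \<alpha> = a - c * (s - a)"
    proof -
      have "x = \<alpha> * a - \<beta> * (s - a)"
        using coords(2)[of s x] co by simp
      then show ?thesis
        using pos by (simp add: c_def field_simps)
    qed
    have "l * exp (- k * (t - s)) * dens n s x = l * (exp (- k * (t - s)) * (l * k * ((l * k * a * (s - a)) ^ m / (fact m * fact (m + 1)))
        * (exp (- l * a - k * (s - a)) / (\<alpha> + \<beta>)) * (a - c * (s - a))))"
      using x assms(1) unfolding dens_def q_even_def th_def co m_def[symmetric] x_eq by (simp only: mult.assoc) simp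
    also have "\<dots> = l * (l * k * ((l * k * a * (s - a)) ^ m / (fact m * fact (m + 1)))
        * (exp (- k * (t - s)) * exp (- l * a - k * (s - a)) / (\<alpha> + \<beta>)) * (a - c * (s - a)))"
      by simp
    also have "\<dots> = f s"
      unfolding E f_def K_def T_def by (simp add: power_mult_distrib mult_ac)
    finally show ?thesis
      using s ab by (simp add: x_def)
  qed
  have "(\<integral>\<^sup>+s. ennreal (indicator {0<..t} s * (l * exp (- k * (t - s)) * dens n s (y + \<beta> * (t - s)))) \<partial>lborel)
      = (\<integral>\<^sup>+s. ennreal (f s) * indicator {a..t} s \<partial>lborel)"
    unfolding *
  proof (rule nn_integral_cong_AE)
    show "AE s in lborel. ennreal (f s * indicator {a<..t} s) = ennreal (f s) * indicator {a..t} s"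
      using AE_lborel_singleton[of a] by eventually_elim (auto simp: indicator_def)
  qed
  also have "\<dots> = \<Phi> t - \<Phi> a"
  proof (rule nn_integral_FTC_Icc)
    show "f \<in> borel_measurable borel"
      unfolding f_def by measurable
    fix s assume "s \<in> {a..t}"
    then have s: "a \<le> s" "s \<le> t" by auto
    have pow: "((\<lambda>s. (s - a) ^ Suc j) has_real_derivative real (Suc j) * (s - a) ^ j) (at s)" for j
      by (rule derivative_eq_intros refl | simp del: power_Suc)+
    have "(\<Phi> has_real_derivative K * (a / (m + 1) * (real (Suc m) * (s - a) ^ m)
        - c / (m + 2) * (real (Suc (Suc m)) * (s - a) ^ Suc m))) (at s)"
      unfolding \<Phi>_def by (intro DERIV_cmult DERIV_diff pow)
    moreover have "K * (a / (m + 1) * (real (Suc m) * (s - a) ^ m)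
        - c / (m + 2) * (real (Suc (Suc m)) * (s - a) ^ Suc m)) = f s"
    proof -
      have eq: "a / (m + 1) * (real (Suc m) * (s - a) ^ m) = a * (s - a) ^ m"
        "c / (m + 2) * (real (Suc (Suc m)) * (s - a) ^ Suc m) = c * (s - a) ^ Suc m"
        by (simp_all add: divide_simps)
      show ?thesis
        unfolding eq f_def by (simp add: algebra_simps)
    qed
    ultimately show "(\<Phi> has_real_derivative f s) (at s)"
      by simp
    have "c * (s - a) \<le> c * b"
      using s ab \<open>0 < c\<close> by (intro mult_left_mono) auto
    moreover have "0 < y / \<alpha>" using \<open>0 < y\<close> pos by simp
    ultimately have "0 \<le> a - c * (s - a)"
      using yc by linarith
    then show "0 \<le> f s"
      using s \<open>0 \<le> K\<close> unfolding f_def by (intro mult_nonneg_nonneg) auto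
  qed (use ab in auto)
  also have "\<Phi> t - \<Phi> a = dens (Suc n) t y"
  proof -
    have "\<Phi> a = 0" by (simp add: \<Phi>_def)
    moreover have "\<Phi> t = K * (b ^ (m + 1) / (m + 1) * (a - c * b * (m + 1) / (m + 2)))"
    proof -
      have tb: "t - a = b" using ab(4) by simp
      show ?thesis unfolding \<Phi>_def tb by (simp add: field_simps)
    qed
    moreover have "dens (Suc n) t y = l / a * ((l * k * a * b) ^ (m + 1) / (fact (m + 1))\<^sup>2) * T * (a - c * b * (m + 1) / (m + 2))"
    proof -
      have "1 / \<alpha> * (y + \<beta> / real (m + 1 + 1) * b) = a - c * b * (m + 1) / (m + 2)"
        unfolding ab(5)[symmetric] using shift_quotient[of a b "m + 1"] by (simp add: c_def)
      moreover have "Suc n div 2 = m + 1"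
        using assms(1) by (auto simp: m_def elim: oddE)
      ultimately show ?thesis
        using assms True by (simp add: dens_def q_odd_def th_def a_def b_def T_def)
    qed
    ultimately show ?thesis
      using ab unfolding K_def by (simp add: power_mult_distrib power2_eq_square field_simps)
  qed
  finally show ?thesis .
qed

text \<open>A path that goes up, turns once and ends above 0 never meets the constraint. Accordingly
  the bracket in \<open>q_odd 0\<close> equals \<open>xa\<close> and cancels the quotient.\<close>

lemma dens_0: "dens 0 t x = indicator {0<..<\<alpha> * t} x * (l * th t x)"
proof (cases "0 < x \<and> x < \<alpha> * t")
  case True
  with coords_pos[of x t] have "xa t x \<noteq> 0" by auto
  moreover have "1 / \<alpha> * (x + \<beta> * xb t x) = xa t x"
    using coords(2)[of t x] pos by (simp add: field_simps)
  ultimately show ?thesis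
    by (simp add: dens_def q_odd_def)
qed (auto simp: dens_def indicator_def)

end

section \<open>The law of the position\<close>

text \<open>Half-lines of either direction form an intersection-stable generator. The sign of
  \<open>w\<close> chooses the direction, so both kinds of last switching are served at
  once.\<close>

lemma measure_eqI_half_lines:
  fixes M N :: "real measure" and w :: real
  assumes "w \<noteq> 0" "finite_measure M" and sets: "sets M = sets borel" "sets N = sets borel"
    and eq: "\<And>y. emeasure M {x. w * y < w * x} = emeasure N {x. w * y < w * x}"
  shows "M = N"
proof (cases "0 < w")
  case True
  then have ioi: "{x. w * y < w * x} = {y<..}" for y by auto
  show ?thesis
  proof (rule measure_eqI_lessThan[OF sets])
    show "emeasure M {x<..} < \<infinity>" for x
      using finite_measure.emeasure_finite[OF assms(2)] by (simp add: less_top)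
    show "emeasure M {x<..} = emeasure N {x<..}" for x
      using eq[of x] by (simp only: ioi)
  qed
next
  case False
  then have iio: "{x. w * y < w * x} = {..<y}" for y
    using \<open>w \<noteq> 0\<close> by (auto simp: mult_less_cancel_left)
  show ?thesis
  proof (rule measure_eqI_generator_eq_countable)
    let ?E = "range lessThan :: real set set"
    have "{..<a} \<inter> {..<b} = {..<min a b}" for a b :: real
      by auto
    then show "Int_stable ?E"
      by (auto simp: Int_stable_def)
    show "?E \<subseteq> Pow UNIV" "sets M = sigma_sets UNIV ?E" "sets N = sigma_sets UNIV ?E"
      unfolding sets borel_Iio by auto
    show "lessThan ` Rats \<subseteq> ?E" "(\<Union>i\<in>Rats. {..<i::real}) = UNIV"
      by (auto intro: Rats_no_top_le less_le_trans) (metis Rats_no_top_le gt_ex less_le_trans)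
    show "\<And>a. a \<in> lessThan ` Rats \<Longrightarrow> emeasure M a \<noteq> \<infinity>"
      using finite_measure.emeasure_finite[OF assms(2)] by simp
    show "\<And>X. X \<in> ?E \<Longrightarrow> emeasure M X = emeasure N X"
      using eq iio by auto
  qed (auto intro: countable_rat)
qed

text \<open>To be used for \<open>\<gamma>\<close> started in 0 and for \<open>- \<gamma>\<close>
  started in 1.\<close>

locale one_sided_telegraph = two_state_transitions +
  fixes v :: "nat \<Rightarrow> real" and i0 :: nat
  assumes i0: "i0 \<in> {0,1}" and v_pos: "0 < v i0" and v_neg: "v (1 - i0) < 0"
begin

sublocale telegraph_density "v i0" "- v (1 - i0)" "lam i0" "lam (1 - i0)"
  using i0 v_pos v_neg lam_pos by unfold_locales auto

declare One_nat_def [simp del]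

abbreviation p0 :: real where
  "p0 \<equiv> prob {\<omega> \<in> space M. \<epsilon> 0 \<omega> = i0}"

definition position_event :: "nat \<Rightarrow> real \<Rightarrow> real set \<Rightarrow> 'a set" where
  "position_event n s B = {\<omega> \<in> space M. \<epsilon> 0 \<omega> = i0 \<and> switch_count \<epsilon> s \<omega> = n \<and>
     (\<forall>u\<in>{0..s}. 0 \<le> telegraph v \<epsilon> u \<omega>) \<and> telegraph v \<epsilon> s \<omega> \<in> B}"

lemma position_event_events:
  assumes "0 \<le> s" "B \<in> sets borel"
  shows "position_event n s B \<in> events"
proof -
  have "telegraph v \<epsilon> s -` B \<inter> space M \<in> events"
    by (rule measurable_sets[OF telegraph_measurable[OF assms(1)] assms(2)])
  then have "{\<omega> \<in> space M. telegraph v \<epsilon> s \<omega> \<in> B} \<in> events"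
    by (simp add: vimage_def Int_def conj_commute)
  with past_subset_events[OF switch_count_past[OF assms(1)]] past_subset_events[OF nonneg_past[OF assms(1)]]
    state_event[OF order_refl]
  show ?thesis
    unfolding position_event_def by (intro sets.sets_Collect_conj) auto
qed

text \<open>Without switchings the path is a line of positive slope, so the constraint holds by
  itself. This is the origin of the atom.\<close>

lemma position_event_0:
  assumes "0 \<le> s"
  shows "emeasure M (position_event 0 s B) = ennreal p0 * (ennreal (exp (- lam i0 * s)) * indicator B (v i0 * s))"
proof -
  have eq: "\<omega> \<in> position_event 0 s B \<longleftrightarrow> \<epsilon> 0 \<omega> = i0 \<and> (\<forall>u\<in>{0..s}. \<epsilon> u \<omega> = i0) \<and> v i0 * s \<in> B"
    if \<omega>: "\<omega> \<in> space M" for \<omega>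
  proof -
    interpret step_path "\<lambda>s. \<epsilon> s \<omega>"
      by (intro path \<omega>)
    have tel: "telegraph v \<epsilon> u \<omega> = v i0 * u" if "\<forall>u\<in>{0..s}. \<epsilon> u \<omega> = i0" "0 \<le> u" "u \<le> s" for u
    proof -
      have "\<forall>x\<in>{0..<u}. \<epsilon> x \<omega> = i0"
        using that by (metis atLeastAtMost_iff atLeastLessThan_iff less_imp_le order.trans)
      from G_linear[OF order_refl that(2) this] show ?thesis
        by (simp add: telegraph_def)
    qed
    have count: "switch_count \<epsilon> s \<omega> = 0 \<longleftrightarrow> (\<forall>u\<in>{0..s}. \<epsilon> u \<omega> = \<epsilon> 0 \<omega>)"
      unfolding switch_count_def by (rule N_eq_0_iff[OF assms])
    show ?thesis
    proof (cases "\<epsilon> 0 \<omega> = i0 \<and> (\<forall>u\<in>{0..s}. \<epsilon> u \<omega> = i0)")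
      case True
      then have "switch_count \<epsilon> s \<omega> = 0"
        unfolding count by simp
      moreover have "\<forall>u\<in>{0..s}. 0 \<le> telegraph v \<epsilon> u \<omega>" "telegraph v \<epsilon> s \<omega> = v i0 * s"
        using tel True v_pos assms by simp_all
      ultimately show ?thesis
        using \<omega> True unfolding position_event_def by simp
    next
      case False
      have "\<omega> \<notin> position_event 0 s B"
      proof
        assume "\<omega> \<in> position_event 0 s B"
        then have "\<epsilon> 0 \<omega> = i0" "switch_count \<epsilon> s \<omega> = 0"
          by (simp_all add: position_event_def)
        then show False
          using False unfolding count by metis
      qed
      then show ?thesis using False by blast
    qed
  qed
  show ?thesis
  proof (cases "v i0 * s \<in> B")
    case True
    have "{\<omega> \<in> space M. \<epsilon> 0 \<omega> = i0} \<in> sets (past 0)"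
      by (rule state_past) auto
    from prob_stay[OF this order_refl assms i0]
    have "prob {\<omega> \<in> space M. \<epsilon> 0 \<omega> = i0 \<and> (\<forall>u\<in>{0..s}. \<epsilon> u \<omega> = i0)} = p0 * exp (- lam i0 * s)"
      by (simp add: conj_ac cong: conj_cong)
    moreover have "position_event 0 s B = {\<omega> \<in> space M. \<epsilon> 0 \<omega> = i0 \<and> (\<forall>u\<in>{0..s}. \<epsilon> u \<omega> = i0)}"
    proof (rule set_eqI)
      fix \<omega>
      show "\<omega> \<in> position_event 0 s B \<longleftrightarrow> \<omega> \<in> {\<omega> \<in> space M. \<epsilon> 0 \<omega> = i0 \<and> (\<forall>u\<in>{0..s}. \<epsilon> u \<omega> = i0)}"
        using eq[of \<omega>] True unfolding position_event_def by blast
    qed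
    ultimately show ?thesis
      using True by (simp add: emeasure_eq_measure ennreal_mult)
  next
    case False
    then have "position_event 0 s B = {}"
      using eq unfolding position_event_def by blast
    then show ?thesis using False by simp
  qed
qed

definition last_state :: "nat \<Rightarrow> nat" where
  "last_state n = (if even n then i0 else 1 - i0)"

lemma last_state_01: "last_state n \<in> {0,1}"
  using i0 by (auto simp: last_state_def)

lemma state_after_switchings:
  assumes "\<omega> \<in> space M" "0 \<le> s" "\<epsilon> 0 \<omega> = i0"
  shows "\<epsilon> s \<omega> = last_state (switch_count \<epsilon> s \<omega>)"
proof -
  interpret step_path "\<lambda>s. \<epsilon> s \<omega>"
    by (intro path assms)
  show ?thesis
    using parity[OF assms(2)] assms(3) by (simp add: last_state_def switch_count_def)
qed

text \<open>The count implies the state, so the event becomes one about the position at time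
  \<open>s\<close> and a shifted half-line. This closes the recursion on the laws of the
  position.\<close>

lemma reach_event_eq:
  assumes "0 \<le> s"
  shows "reach_event v i0 n (last_state n) t y s = position_event n s
    {x. (v (last_state n) - v (1 - last_state n)) * y < (v (last_state n) - v (1 - last_state n)) * (x + v (1 - last_state n) * (t - s))}"
  unfolding reach_event_def position_event_def
  using state_after_switchings[OF _ assms] by fastforce

text \<open>The recursion in nonnegative integrals, so that the order of integration over time and
  position can be exchanged by Tonelli.\<close>

lemma emeasure_switched_event:
  assumes "0 < t" "i \<in> {0,1}"
  shows "emeasure M (switched_event v i0 n i t y) =
    (\<integral>\<^sup>+s. ennreal (indicator {0<..t} s * (lam i * exp (- lam (1 - i) * (t - s)))) * emeasure M (reach_event v i0 n i t y s) \<partial>lborel)"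
proof -
  define F where "F s = prob (reach_event v i0 n i t y s)" for s
  define f where "f s = indicator {0<..t} s * (lam i * exp (- lam (1 - i) * (t - s)) * F s)" for s
  have lam: "0 \<le> lam i" "0 \<le> lam (1 - i)"
    using lam_pos assms(2) by auto
  have F_meas: "(\<lambda>s. indicator {0<..t} s * F s) \<in> borel_measurable lborel"
    using last_switching_recursion(1)[OF assms] unfolding set_borel_measurable_def F_def by simp
  have f_meas: "f \<in> borel_measurable lborel"
  proof -
    have "(\<lambda>s. (lam i * exp (- lam (1 - i) * (t - s))) * (indicator {0<..t} s * F s)) \<in> borel_measurable lborel"
      by (intro borel_measurable_times[OF _ F_meas]) measurable
    then show ?thesis
      by (simp add: f_def[abs_def] mult_ac)
  qed
  have f_nonneg: "0 \<le> f s" for s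
    using lam by (simp add: f_def F_def)
  have "integrable lborel f"
  proof (rule Bochner_Integration.integrable_bound[OF _ f_meas])
    show "integrable lborel (\<lambda>s. indicator {0<..t} s * lam i)"
      using assms(1) by (intro integrable_mult_left integrable_real_indicator) auto
    show "AE s in lborel. norm (f s) \<le> norm (indicator {0<..t} s * lam i)"
    proof (intro AE_I2)
      fix s
      have "lam i * exp (- lam (1 - i) * (t - s)) * F s \<le> lam i * 1 * 1" if "s \<le> t"
        unfolding F_def using lam that by (intro mult_mono mult_nonneg_nonneg) auto
      then show "norm (f s) \<le> norm (indicator {0<..t} s * lam i)"
        using f_nonneg[of s] lam by (auto simp: f_def indicator_def)
    qed
  qed
  then have "ennreal (\<integral>s. f s \<partial>lborel) = (\<integral>\<^sup>+s. ennreal (f s) \<partial>lborel)"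
    using f_nonneg by (intro nn_integral_eq_integral[symmetric]) auto
  moreover have "prob (switched_event v i0 n i t y) = (\<integral>s. f s \<partial>lborel)"
    unfolding last_switching_recursion(2)[OF assms] set_lebesgue_integral_def f_def F_def by simp
  moreover have "ennreal (f s) = ennreal (indicator {0<..t} s * (lam i * exp (- lam (1 - i) * (t - s)))) * emeasure M (reach_event v i0 n i t y s)" for s
    unfolding f_def F_def emeasure_eq_measure using lam by (simp add: mult.assoc flip: ennreal_mult)
  ultimately show ?thesis
    by (simp add: emeasure_eq_measure)
qed

lemma velocity_jump: "v (last_state n) - v (1 - last_state n) \<noteq> 0"
  using v_pos v_neg i0 by (auto simp: last_state_def)

text \<open>
  The law of the position is computed first without the constraint at the final time, on the whole
  line, so that it is seen to have no atom at \<open>0\<close>.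
\<close>

lemma position_density_if_switched:
  assumes "0 < t" and [measurable]: "r \<in> borel_measurable borel" and B[measurable]: "B \<in> sets borel"
    and eq: "\<And>y. emeasure M (switched_event v i0 n (last_state n) t y) =
      (\<integral>\<^sup>+x. r x * indicator {x. (v (last_state n) - v (1 - last_state n)) * y < (v (last_state n) - v (1 - last_state n)) * x} x \<partial>lborel)"
    and r: "AE x in lborel. 0 < x \<longrightarrow> r x = ennreal p0 * d x"
    and d: "\<And>x. x \<le> 0 \<Longrightarrow> d x = 0" and [measurable]: "d \<in> borel_measurable borel"
  shows "emeasure M (position_event (Suc n) t B) = ennreal p0 * (\<integral>\<^sup>+x. d x * indicator B x \<partial>lborel)"
proof -
  define w where "w = v (last_state n) - v (1 - last_state n)"
  have "w \<noteq> 0" unfolding w_def by (rule velocity_jump)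
  have X[measurable]: "telegraph v \<epsilon> t \<in> borel_measurable M"
    using assms(1) by (intro telegraph_measurable) auto
  define C where "C = {\<omega> \<in> space M. \<epsilon> 0 \<omega> = i0 \<and> switch_count \<epsilon> t \<omega> = Suc n \<and> \<epsilon> t \<omega> = 1 - last_state n \<and>
     (\<forall>u\<in>{0..t}. switch_count \<epsilon> u \<omega> \<le> n \<longrightarrow> 0 \<le> telegraph v \<epsilon> u \<omega>)}"
  have switched: "switched_event v i0 n (last_state n) t y = C \<inter> (telegraph v \<epsilon> t -` {x. w * y < w * x} \<inter> space M)" for y
    by (auto simp: switched_event_def C_def w_def)
  \<comment> \<open>The level \<open>- real k / w\<close> turns the half-line condition into
    \<open>- real k < w * x\<close>, so these half-lines exhaust the line and \<open>C\<close>
    inherits measurability.\<close>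
  have "C = (\<Union>k. switched_event v i0 n (last_state n) t (- real k / w))"
  proof -
    have "\<exists>k. w * (- real k / w) < w * telegraph v \<epsilon> t \<omega>" for \<omega>
    proof -
      obtain k where "- (w * telegraph v \<epsilon> t \<omega>) < real k"
        using reals_Archimedean2 by blast
      then show ?thesis
        using \<open>w \<noteq> 0\<close> by (intro exI[of _ k]) simp
    qed
    then show ?thesis
      unfolding switched by (auto simp: C_def)
  qed
  moreover have "switched_event v i0 n (last_state n) t y \<in> events" for y
    using switched_event_past[OF assms(1) last_state_01] past_subset_events by blast
  ultimately have C[measurable]: "C \<in> events" by auto
  have "distr (density M (indicator C)) borel (telegraph v \<epsilon> t) = density lborel r"
  proof (rule measure_eqI_half_lines[OF \<open>w \<noteq> 0\<close>])
    show "finite_measure (distr (density M (indicator C)) borel (telegraph v \<epsilon> t))"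
      by (rule finite_measureI) (simp add: emeasure_distr emeasure_density nn_integral_indicator emeasure_eq_measure)
    fix y
    have H: "{x. w * y < w * x} \<in> sets borel" by measurable
    have "emeasure (distr (density M (indicator C)) borel (telegraph v \<epsilon> t)) {x. w * y < w * x}
      = emeasure M (switched_event v i0 n (last_state n) t y)"
      unfolding switched using H measurable_sets[OF X H]
      by (simp add: emeasure_distr emeasure_density indicator_inter_arith[symmetric])
    then show "emeasure (distr (density M (indicator C)) borel (telegraph v \<epsilon> t)) {x. w * y < w * x} = emeasure (density lborel r) {x. w * y < w * x}"
      using H by (simp add: eq w_def emeasure_density)
  qed simp_all
  note law = this
  have B': "B \<inter> {0..} \<in> sets borel" using B by simp
  \<comment> \<open>Here the constraint at the final time enters, as a restriction of
    \<open>B\<close> to nonnegative positions.\<close>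
  have "position_event (Suc n) t B = C \<inter> (telegraph v \<epsilon> t -` (B \<inter> {0..}) \<inter> space M)"
  proof (rule set_eqI)
    fix \<omega>
    show "\<omega> \<in> position_event (Suc n) t B \<longleftrightarrow> \<omega> \<in> C \<inter> (telegraph v \<epsilon> t -` (B \<inter> {0..}) \<inter> space M)"
    proof (cases "\<omega> \<in> space M \<and> \<epsilon> 0 \<omega> = i0 \<and> switch_count \<epsilon> t \<omega> = Suc n")
      case True
      then interpret step_path "\<lambda>s. \<epsilon> s \<omega>"
        by (intro path) simp
      have "(\<forall>u\<in>{0..t}. 0 \<le> telegraph v \<epsilon> u \<omega>) \<longleftrightarrow>
        (\<forall>u\<in>{0..t}. switch_count \<epsilon> u \<omega> \<le> n \<longrightarrow> 0 \<le> telegraph v \<epsilon> u \<omega>) \<and> 0 \<le> telegraph v \<epsilon> t \<omega>"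
        using nonneg_iff[of t n v] True assms(1)
        unfolding nonneg_until_last_def telegraph_def switch_count_def by simp
      moreover have "\<epsilon> t \<omega> = 1 - last_state n"
        using state_after_switchings[of \<omega> t] True assms(1) i0 by (auto simp: last_state_def)
      ultimately show ?thesis
        using True unfolding position_event_def C_def by auto
    qed (auto simp: position_event_def C_def)
  qed
  then have "emeasure M (position_event (Suc n) t B) = emeasure (distr (density M (indicator C)) borel (telegraph v \<epsilon> t)) (B \<inter> {0..})"
    using B' measurable_sets[OF X B']
    by (simp add: emeasure_distr emeasure_density indicator_inter_arith[symmetric])
  also have "\<dots> = (\<integral>\<^sup>+x. r x * indicator (B \<inter> {0..}) x \<partial>lborel)"
    unfolding law using B' by (simp add: emeasure_density)
  also have "\<dots> = (\<integral>\<^sup>+x. ennreal p0 * (d x * indicator B x) \<partial>lborel)"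
  proof (rule nn_integral_cong_AE)
    show "AE x in lborel. r x * indicator (B \<inter> {0..}) x = ennreal p0 * (d x * indicator B x)"
      \<comment> \<open>\<open>r\<close> is known only to the right of 0; the point 0 is negligible
        because the law before the cut has a density.\<close>
      using r AE_lborel_singleton[of 0]
    proof eventually_elim
      case (elim x)
      then show ?case
        using d[of x] by (cases "0 < x") (auto simp: indicator_def mult_ac)
    qed
  qed
  also have "\<dots> = ennreal p0 * (\<integral>\<^sup>+x. d x * indicator B x \<partial>lborel)"
    using B by (intro nn_integral_cmult) measurable
  finally show ?thesis .
qed

lemma dens_nonpos: "x \<le> 0 \<Longrightarrow> dens n t x = 0"
  by (simp add: dens_def)

text \<open>Before the only switching the position is deterministic, so there is no earlier density
  to integrate. The density arises instead by substituting the end point for the switching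
  time.\<close>

lemma position_density_0:
  assumes "0 < t" "B \<in> sets borel"
  shows "emeasure M (position_event (Suc 0) t B) = ennreal p0 * (\<integral>\<^sup>+x. ennreal (dens 0 t x) * indicator B x \<partial>lborel)"
proof -
  define \<alpha> where "\<alpha> = v i0"
  define \<beta> where "\<beta> = - v (1 - i0)"
  have pos': "0 < \<alpha> + \<beta>" using pos by (simp add: \<alpha>_def \<beta>_def)
  \<comment> \<open>Not yet cut at 0: the interval is the range of end points for switching times in
    \<open>{0<..t}\<close>.\<close>
  define g where "g x = indicator {- \<beta> * t<..\<alpha> * t} x * (lam i0 * th t x)" for x
  have g_meas[measurable]: "g \<in> borel_measurable borel"
    unfolding g_def[abs_def] th_def xa_def xb_def by measurable
  show ?thesis
  proof (rule position_density_if_switched[where r = "\<lambda>x. ennreal p0 * ennreal (g x)", OF assms(1) _ assms(2)])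
    fix y
    define w where "w = v i0 - v (1 - i0)"
    have ls: "last_state 0 = i0" by (simp add: last_state_def)
    have "emeasure M (switched_event v i0 0 i0 t y) =
      (\<integral>\<^sup>+s. ennreal p0 * (ennreal (indicator {0<..t} s * (lam i0 * exp (- lam (1 - i0) * (t - s) + - lam i0 * s)))
        * indicator {x. w * y < w * x} (- \<beta> * t + (\<alpha> + \<beta>) * s)) \<partial>lborel)"
      unfolding emeasure_switched_event[OF assms(1) i0]
    proof (rule nn_integral_cong)
      fix s
      show "ennreal (indicator {0<..t} s * (lam i0 * exp (- lam (1 - i0) * (t - s)))) * emeasure M (reach_event v i0 0 i0 t y s)
         = ennreal p0 * (ennreal (indicator {0<..t} s * (lam i0 * exp (- lam (1 - i0) * (t - s) + - lam i0 * s)))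
        * indicator {x. w * y < w * x} (- \<beta> * t + (\<alpha> + \<beta>) * s))"
      proof (cases "s \<in> {0<..t}")
        case True
        have "v i0 * s + v (1 - i0) * (t - s) = - \<beta> * t + (\<alpha> + \<beta>) * s"
          by (simp add: \<alpha>_def \<beta>_def algebra_simps)
        then have R: "emeasure M (reach_event v i0 0 i0 t y s) =
            ennreal p0 * (ennreal (exp (- lam i0 * s)) * indicator {x. w * y < w * x} (- \<beta> * t + (\<alpha> + \<beta>) * s))"
          using reach_event_eq[of s 0 t y] position_event_0[of s] True unfolding ls w_def[symmetric]
          by (simp add: indicator_def)
        show ?thesis
          unfolding R exp_add using True pos by (simp add: ennreal_mult mult_ac)
      qed simp
    qed
    \<comment> \<open>Delaying the switching by one unit raises the end point by
      \<open>\<alpha> + \<beta>\<close>; this Jacobian is the denominator of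
      \<open>th\<close>.\<close>
    also have "\<dots> = (\<integral>\<^sup>+s. ennreal (\<alpha> + \<beta>) * (ennreal p0 * ennreal (g (- \<beta> * t + (\<alpha> + \<beta>) * s)) * indicator {x. w * y < w * x} (- \<beta> * t + (\<alpha> + \<beta>) * s)) \<partial>lborel)"
    proof (rule nn_integral_cong)
      fix s
      define z where "z = - \<beta> * t + (\<alpha> + \<beta>) * s"
      have ind: "indicator {- \<beta> * t<..\<alpha> * t} z = (indicator {0<..t} s :: real)"
      proof -
        have "z \<le> \<alpha> * t \<longleftrightarrow> (\<alpha> + \<beta>) * s \<le> (\<alpha> + \<beta>) * t"
          by (simp add: z_def algebra_simps)
        moreover have "- \<beta> * t < z \<longleftrightarrow> 0 < (\<alpha> + \<beta>) * s"
          by (simp add: z_def)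
        ultimately show ?thesis
          using pos' by (simp add: indicator_def zero_less_mult_iff)
      qed
      have "s + (t - s) = t" "v i0 * s - - v (1 - i0) * (t - s) = z"
        by (simp_all add: z_def \<alpha>_def \<beta>_def algebra_simps)
      note co = coords_unique[OF this]
      have exponent: "- lam i0 * s - lam (1 - i0) * (t - s) = - lam (1 - i0) * (t - s) + - lam i0 * s"
        by simp
      have "(\<alpha> + \<beta>) * th t z = exp (- lam (1 - i0) * (t - s) + - lam i0 * s)"
        unfolding th_def co exponent using pos' unfolding \<alpha>_def \<beta>_def by simp
      moreover have "(\<alpha> + \<beta>) * g z = indicator {- \<beta> * t<..\<alpha> * t} z * (lam i0 * ((\<alpha> + \<beta>) * th t z))"
        by (simp add: g_def)
      ultimately have g_z: "indicator {0<..t} s * (lam i0 * exp (- lam (1 - i0) * (t - s) + - lam i0 * s)) = (\<alpha> + \<beta>) * g z"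
        by (simp only: ind)
      show "ennreal p0 * (ennreal (indicator {0<..t} s * (lam i0 * exp (- lam (1 - i0) * (t - s) + - lam i0 * s)))
        * indicator {x. w * y < w * x} (- \<beta> * t + (\<alpha> + \<beta>) * s))
        = ennreal (\<alpha> + \<beta>) * (ennreal p0 * ennreal (g (- \<beta> * t + (\<alpha> + \<beta>) * s)) * indicator {x. w * y < w * x} (- \<beta> * t + (\<alpha> + \<beta>) * s))"
        unfolding z_def[symmetric] g_z ennreal_mult'[OF less_imp_le[OF pos']] by (simp add: mult_ac)
    qed
    also have "\<dots> = ennreal (\<alpha> + \<beta>) * (\<integral>\<^sup>+s. ennreal p0 * ennreal (g (- \<beta> * t + (\<alpha> + \<beta>) * s)) * indicator {x. w * y < w * x} (- \<beta> * t + (\<alpha> + \<beta>) * s) \<partial>lborel)"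
      by (rule nn_integral_cmult) measurable
    also have "\<dots> = (\<integral>\<^sup>+x. ennreal p0 * ennreal (g x) * indicator {x. w * y < w * x} x \<partial>lborel)"
      using pos' nn_integral_real_affine[of "\<lambda>x. ennreal p0 * ennreal (g x) * indicator {x. w * y < w * x} x" "\<alpha> + \<beta>" "- \<beta> * t"]
      by simp
    finally show "emeasure M (switched_event v i0 0 (last_state 0) t y) =
      (\<integral>\<^sup>+x. ennreal p0 * ennreal (g x) * indicator {x. (v (last_state 0) - v (1 - last_state 0)) * y < (v (last_state 0) - v (1 - last_state 0)) * x} x \<partial>lborel)"
      unfolding ls w_def .
  next
    show "AE x in lborel. 0 < x \<longrightarrow> ennreal p0 * ennreal (g x) = ennreal p0 * ennreal (dens 0 t x)"
      using AE_lborel_singleton[of "\<alpha> * t"]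
    proof eventually_elim
      case (elim x)
      have "- \<beta> * t < 0" using pos assms(1) by (simp add: \<beta>_def mult_neg_pos)
      then show ?case
        using elim by (auto simp: g_def dens_0 \<alpha>_def indicator_def)
    qed
  qed (auto simp: dens_nonpos)
qed

text \<open>After translation by the last flight, the switching time is integrated out for each
  fixed end point, which is the one-dimensional integral of the two step lemmas.\<close>

lemma position_density_Suc:
  assumes "0 < t" "B \<in> sets borel"
    and IH: "\<And>s B. 0 < s \<Longrightarrow> B \<in> sets borel \<Longrightarrow> emeasure M (position_event (Suc n) s B)
      = ennreal p0 * (\<integral>\<^sup>+x. ennreal (dens n s x) * indicator B x \<partial>lborel)"
  shows "emeasure M (position_event (Suc (Suc n)) t B) = ennreal p0 * (\<integral>\<^sup>+x. ennreal (dens (Suc n) t x) * indicator B x \<partial>lborel)"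
proof -
  define i where "i = last_state (Suc n)"
  define w where "w = v i - v (1 - i)"
  have i: "i \<in> {0,1}" unfolding i_def by (rule last_state_01)
  \<comment> \<open>The joint density of the last switching time and the end point, up to the factor
    \<open>p0\<close>.\<close>
  define h where "h s x = ennreal (indicator {0<..t} s * (lam i * exp (- lam (1 - i) * (t - s)) * dens n s (x - v (1 - i) * (t - s))))" for s x
  have h_meas[measurable]: "(\<lambda>z. h (fst z) (snd z)) \<in> borel_measurable (borel \<Otimes>\<^sub>M borel)"
    unfolding h_def by measurable
  have h_meas2[measurable]: "(\<lambda>s. h s x) \<in> borel_measurable borel" "(\<lambda>x. h s x) \<in> borel_measurable borel" for s x
    unfolding h_def by measurable
  have int_meas[measurable]: "(\<lambda>x. \<integral>\<^sup>+s. h s x \<partial>lborel) \<in> borel_measurable borel"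
    unfolding h_def by measurable
  show ?thesis
  proof (rule position_density_if_switched[where r = "\<lambda>x. ennreal p0 * (\<integral>\<^sup>+s. h s x \<partial>lborel)", OF assms(1) _ assms(2)])
    fix y
    have H[measurable]: "{x. w * y < w * x} \<in> sets borel" by measurable
    have "emeasure M (switched_event v i0 (Suc n) i t y) =
      (\<integral>\<^sup>+s. (\<integral>\<^sup>+x. ennreal p0 * (h s x * indicator {x. w * y < w * x} x) \<partial>lborel) \<partial>lborel)"
      unfolding emeasure_switched_event[OF assms(1) i]
    proof (rule nn_integral_cong)
      fix s
      show "ennreal (indicator {0<..t} s * (lam i * exp (- lam (1 - i) * (t - s)))) * emeasure M (reach_event v i0 (Suc n) i t y s)
        = (\<integral>\<^sup>+x. ennreal p0 * (h s x * indicator {x. w * y < w * x} x) \<partial>lborel)"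
      proof (cases "s \<in> {0<..t}")
        case True
        define e where "e = v (1 - i) * (t - s)"
        have H': "{x. w * y < w * (x + e)} \<in> sets borel" by measurable
        have "emeasure M (reach_event v i0 (Suc n) i t y s) = ennreal p0 * (\<integral>\<^sup>+x. ennreal (dens n s x) * indicator {x. w * y < w * (x + e)} x \<partial>lborel)"
          using reach_event_eq[of s "Suc n" t y] IH[OF _ H', of s] True unfolding i_def[symmetric] w_def[symmetric] e_def by simp
        also have "(\<integral>\<^sup>+x. ennreal (dens n s x) * indicator {x. w * y < w * (x + e)} x \<partial>lborel)
          = (\<integral>\<^sup>+x. ennreal (dens n s (- e + 1 * x)) * indicator {x. w * y < w * (x + e)} (- e + 1 * x) \<partial>lborel)"
          using nn_integral_real_affine[of "\<lambda>x. ennreal (dens n s x) * indicator {x. w * y < w * (x + e)} x" 1 "- e"] H' by simp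
        also have "\<dots> = (\<integral>\<^sup>+x. ennreal (dens n s (x - e)) * indicator {x. w * y < w * x} x \<partial>lborel)"
          by (intro nn_integral_cong) (simp add: indicator_def)
        finally have R: "emeasure M (reach_event v i0 (Suc n) i t y s) = ennreal p0 * (\<integral>\<^sup>+x. ennreal (dens n s (x - e)) * indicator {x. w * y < w * x} x \<partial>lborel)" .
        have "ennreal (lam i * exp (- lam (1 - i) * (t - s))) * (ennreal p0 * (\<integral>\<^sup>+x. ennreal (dens n s (x - e)) * indicator {x. w * y < w * x} x \<partial>lborel))
          = (\<integral>\<^sup>+x. ennreal (lam i * exp (- lam (1 - i) * (t - s))) * (ennreal p0 * (ennreal (dens n s (x - e)) * indicator {x. w * y < w * x} x)) \<partial>lborel)"
          by (simp add: nn_integral_cmult)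
        also have "\<dots> = (\<integral>\<^sup>+x. ennreal p0 * (h s x * indicator {x. w * y < w * x} x) \<partial>lborel)"
        proof (rule nn_integral_cong)
          fix x
          have "h s x = ennreal (lam i * exp (- lam (1 - i) * (t - s))) * ennreal (dens n s (x - e))"
            using True lam_pos i by (auto simp: h_def e_def ennreal_mult dens_nonneg)
          then show "ennreal (lam i * exp (- lam (1 - i) * (t - s))) * (ennreal p0 * (ennreal (dens n s (x - e)) * indicator {x. w * y < w * x} x))
            = ennreal p0 * (h s x * indicator {x. w * y < w * x} x)"
            by (simp add: mult_ac)
        qed
        finally show ?thesis
          unfolding R using True by simp
      qed (simp add: h_def)
    qed
    also have "\<dots> = (\<integral>\<^sup>+x. (\<integral>\<^sup>+s. ennreal p0 * (h s x * indicator {x. w * y < w * x} x) \<partial>lborel) \<partial>lborel)"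
    proof (rule lborel_pair.Fubini')
      have "(\<lambda>z. ennreal p0 * (h (snd z) (fst z) * indicator {x. w * y < w * x} (fst z))) \<in> borel_measurable (borel \<Otimes>\<^sub>M borel)"
        unfolding h_def by measurable
      then show "(\<lambda>(x, s). ennreal p0 * (h s x * indicator {x. w * y < w * x} x)) \<in> borel_measurable (lborel \<Otimes>\<^sub>M lborel)"
        by (simp add: case_prod_beta')
    qed
    also have "\<dots> = (\<integral>\<^sup>+x. ennreal p0 * (\<integral>\<^sup>+s. h s x \<partial>lborel) * indicator {x. w * y < w * x} x \<partial>lborel)"
      by (intro nn_integral_cong) (simp add: nn_integral_cmult nn_integral_multc mult.assoc)
    finally show "emeasure M (switched_event v i0 (Suc n) (last_state (Suc n)) t y) =
      (\<integral>\<^sup>+x. ennreal p0 * (\<integral>\<^sup>+s. h s x \<partial>lborel) * indicator {x. (v (last_state (Suc n)) - v (1 - last_state (Suc n))) * y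
         < (v (last_state (Suc n)) - v (1 - last_state (Suc n))) * x} x \<partial>lborel)"
      unfolding i_def w_def .
  next
    have "(\<integral>\<^sup>+s. h s x \<partial>lborel) = ennreal (dens (Suc n) t x)" if "0 < x" for x
    proof (cases "even n")
      case True
      then have "i = 1 - i0" "1 - i = i0"
        using i0 by (auto simp: i_def last_state_def)
      then show ?thesis
        unfolding h_def using dens_step_even[OF True that, of t] by simp
    next
      case False
      then have "i = i0"
        by (simp add: i_def last_state_def)
      then show ?thesis
        unfolding h_def using dens_step_odd[OF False that, of t] by simp
    qed
    then show "AE x in lborel. 0 < x \<longrightarrow> ennreal p0 * (\<integral>\<^sup>+s. h s x \<partial>lborel) = ennreal p0 * ennreal (dens (Suc n) t x)"
      by simp
  qed (auto simp: dens_nonpos)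
qed

lemma position_density:
  assumes "0 < t" "B \<in> sets borel"
  shows "emeasure M (position_event (Suc n) t B) = ennreal p0 * (\<integral>\<^sup>+x. ennreal (dens n t x) * indicator B x \<partial>lborel)"
  using assms
proof (induction n arbitrary: t B)
  case 0
  then show ?case by (rule position_density_0)
next
  case (Suc n)
  then show ?case by (intro position_density_Suc)
qed

end

section \<open>Summation and reflection\<close>

text \<open>Lebesgue measure is invariant under reflection; this carries a law for
  \<open>- \<gamma>\<close> back to \<open>\<gamma>\<close>.\<close>

lemma atom_plus_density_on_reflect:
  assumes "atom_plus_density_on T \<mu> c a f" "T = {x. - x \<in> S}"
  shows "atom_plus_density_on S (\<lambda>A. \<mu> {x. - x \<in> A}) c (- a) (\<lambda>x. f (- x))"
  unfolding atom_plus_density_on_def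
proof (intro conjI ballI impI)
  have "integrable lborel (\<lambda>x. indicator T (0 + - 1 * x) *\<^sub>R f (0 + - 1 * x))"
    using assms(1) unfolding atom_plus_density_on_def set_integrable_def
    by (intro lborel_integrable_real_affine) auto
  then show "set_integrable lborel S (\<lambda>x. f (- x))"
    unfolding set_integrable_def assms(2) by (simp add: indicator_def)
next
  fix A assume A: "A \<in> sets borel" "A \<subseteq> S"
  have "uminus -` A \<inter> space borel \<in> sets borel"
    by (rule measurable_sets[OF _ A(1)]) measurable
  then have "{x. - x \<in> A} \<in> sets borel" "{x. - x \<in> A} \<subseteq> T"
    using A(2) unfolding assms(2) by (auto simp: vimage_def)
  then have "\<mu> {x. - x \<in> A} = c * indicator {x. - x \<in> A} a + (LINT x:{x. - x \<in> A}|lborel. f x)"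
    using assms(1) by (auto simp: atom_plus_density_on_def)
  moreover have "(LINT x:{x. - x \<in> A}|lborel. f x) = (LINT x:A|lborel. f (- x))"
    using lborel_integral_real_affine[of "- 1" "\<lambda>x. indicator {x. - x \<in> A} x *\<^sub>R f x" 0]
    unfolding set_lebesgue_integral_def by (simp add: indicator_def)
  ultimately show "\<mu> {x. - x \<in> A} = c * indicator A (- a) + (LINT x:A|lborel. f (- x))"
    by (simp add: indicator_def)
qed

lemma atom_plus_density_on_cong:
  assumes "atom_plus_density_on S \<mu> c a f"
    and "\<And>A. A \<in> sets borel \<Longrightarrow> A \<subseteq> S \<Longrightarrow> \<mu> A = \<nu> A" "\<And>x. x \<in> S \<Longrightarrow> f x = g x"
  shows "atom_plus_density_on S \<nu> c a g"
proof -
  have "set_integrable lborel S f = set_integrable lborel S g"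
    unfolding set_integrable_def using assms(3) by (intro arg_cong[where f = "integrable lborel"]) (auto simp: indicator_def)
  moreover have "(LINT x:A|lborel. f x) = (LINT x:A|lborel. g x)" if "A \<subseteq> S" for A
    unfolding set_lebesgue_integral_def using assms(3) that
    by (intro Bochner_Integration.integral_cong) (auto simp: indicator_def)
  ultimately show ?thesis
    using assms(1,2) unfolding atom_plus_density_on_def by metis
qed

lemma density_on_iff_atom: "density_on S \<mu> f \<longleftrightarrow> atom_plus_density_on S \<mu> 0 a f"
  by (simp add: density_on_def atom_plus_density_on_def)

text \<open>Integrability comes for free: the nonnegative integral is bounded by the real number on
  the left of \<open>eq\<close>.\<close>

lemma atom_plus_density_on_if_emeasure:
  assumes f: "f \<in> borel_measurable borel" "\<And>x. 0 \<le> f x" and "0 \<le> c" and \<mu>: "\<And>A. 0 \<le> \<mu> A"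
    and eq: "\<And>A. A \<in> sets borel \<Longrightarrow> ennreal (\<mu> A) = ennreal c * indicator A a + (\<integral>\<^sup>+x. ennreal (f x) * indicator A x \<partial>lborel)"
    and S: "S \<in> sets borel"
  shows "atom_plus_density_on S \<mu> c a f"
proof -
  have fin: "(\<integral>\<^sup>+x. ennreal (f x) * indicator A x \<partial>lborel) < \<infinity>" if "A \<in> sets borel" for A
    using eq[OF that] ennreal_less_top[of "\<mu> A"] by (metis ennreal_add_less_top infinity_ennreal_def)
  have int: "integrable lborel (\<lambda>x. f x * indicator A x)" if "A \<in> sets borel" for A
  proof (rule integrableI_nonneg)
    have "ennreal (f x * indicator A x) = ennreal (f x) * indicator A x" for x
      by (simp add: indicator_def)
    then show "(\<integral>\<^sup>+x. ennreal (f x * indicator A x) \<partial>lborel) < \<infinity>"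
      using fin[OF that] by simp
  qed (use f that in auto)
  have "\<mu> A = c * indicator A a + (LINT x:A|lborel. f x)" if A: "A \<in> sets borel" for A
  proof -
    have "(\<integral>\<^sup>+x. ennreal (f x) * indicator A x \<partial>lborel) = (\<integral>\<^sup>+x. ennreal (f x * indicator A x) \<partial>lborel)"
      by (intro nn_integral_cong) (simp add: indicator_def)
    also have "\<dots> = ennreal (\<integral>x. f x * indicator A x \<partial>lborel)"
      using f by (intro nn_integral_eq_integral int A) auto
    finally have "ennreal (\<mu> A) = ennreal (c * indicator A a + (\<integral>x. f x * indicator A x \<partial>lborel))"
      unfolding eq[OF A] using f \<open>0 \<le> c\<close> by (simp add: ennreal_plus ennreal_mult' ennreal_indicator)
    then have "\<mu> A = c * indicator A a + (\<integral>x. f x * indicator A x \<partial>lborel)"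
      using \<mu>[of A] f \<open>0 \<le> c\<close> by (subst (asm) ennreal_inj) (auto intro!: add_nonneg_nonneg mult_nonneg_nonneg integral_nonneg)
    then show ?thesis
      by (simp add: set_lebesgue_integral_def mult.commute)
  qed
  then show ?thesis
    using int[OF S] unfolding atom_plus_density_on_def set_integrable_def by (simp add: mult.commute)
qed

context telegraph_density
begin

definition z :: "real \<Rightarrow> real \<Rightarrow> real" where
  "z t x = l * k * xa t x * xb t x"

text \<open>The two series are the modified Bessel functions of order 0 and 1 at
  \<open>2 * sqrt z\<close>, the second divided by \<open>sqrt z\<close>.\<close>

definition total_dens :: "real \<Rightarrow> real \<Rightarrow> real" where
  "total_dens t x = indicator {0<..<\<alpha> * t} x * (l / \<alpha> *
     (x / xa t x * (\<Sum>n. z t x ^ n / (fact n)\<^sup>2)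
       + (k * x + \<beta> * (xb t x / xa t x)) * (\<Sum>n. z t x ^ n / (fact n * fact (n + 1)))) * th t x)"

text \<open>The second factorial is at least 1, so the exponential series dominates.\<close>

lemma summable_bessel:
  fixes y :: real
  shows "summable (\<lambda>n. y ^ n / (fact n)\<^sup>2)" "summable (\<lambda>n. y ^ n / (fact n * fact (n + 1)))"
proof -
  have exp: "summable (\<lambda>n. \<bar>y\<bar> ^ n / fact n)"
    using summable_exp[of "\<bar>y\<bar>"] by (simp add: field_simps)
  have le: "norm (y ^ n / (fact n * D)) \<le> \<bar>y\<bar> ^ n / fact n" if "1 \<le> D" for n and D :: real
  proof -
    have "fact n * 1 \<le> fact n * D"
      using that by (intro mult_left_mono) auto
    then show ?thesis
      using that by (simp add: abs_mult power_abs) (intro divide_left_mono; simp)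
  qed
  have "norm (y ^ n / (fact n)\<^sup>2) \<le> \<bar>y\<bar> ^ n / fact n" for n
    using le[of "fact n" n] fact_ge_1[of n, where 'a = real] by (simp add: power2_eq_square)
  then show "summable (\<lambda>n. y ^ n / (fact n)\<^sup>2)"
    by (intro summable_comparison_test'[OF exp])
  have "norm (y ^ n / (fact n * fact (n + 1))) \<le> \<bar>y\<bar> ^ n / fact n" for n
    using le[of "fact (n + 1)" n] fact_ge_1[of "n + 1", where 'a = real] by blast
  then show "summable (\<lambda>n. y ^ n / (fact n * fact (n + 1)))"
    by (intro summable_comparison_test'[OF exp])
qed

lemma dens_sums: "(\<lambda>n. dens n t x) sums total_dens t x"
proof -
  define A where "A n = z t x ^ n / (fact n)\<^sup>2" for n
  define B where "B n = z t x ^ n / (fact n * fact (n + 1))" for n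
  have A: "A sums suminf A" and B: "B sums suminf B"
    unfolding A_def[abs_def] B_def[abs_def] by (intro summable_sums summable_bessel)+
  have odd: "q_odd n t x = l / \<alpha> * th t x / xa t x * (x * A n + \<beta> * xb t x * B n)" for n
  proof -
    \<comment> \<open>The divisor \<open>n + 1\<close> in the last factor of \<open>q_odd\<close>
      moves that summand from the first series to the second.\<close>
    have "A n / real (n + 1) = B n"
      by (simp add: A_def B_def power2_eq_square)
    then have B_eq: "B n = A n / real (n + 1)" ..
    have "l / a * An * T * (1 / \<alpha> * (x + \<beta> / D * b)) = l / \<alpha> * T / a * (x * An + \<beta> * b * (An / D))" for a An T D b
      by (simp add: divide_inverse algebra_simps)
    then show ?thesis
      unfolding q_odd_def z_def[symmetric] A_def[symmetric] B_eq .
  qed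
  have even: "q_even n t x = l * k * th t x * (x / \<alpha>) * B n" for n
    unfolding q_even_def z_def[symmetric] B_def[symmetric] by simp
  have odd_sum: "(\<lambda>n. q_odd n t x) sums (l / \<alpha> * th t x / xa t x * (x * suminf A + \<beta> * xb t x * suminf B))"
    unfolding odd by (intro sums_mult sums_add A B)
  have even_sum: "(\<lambda>n. q_even n t x) sums (l * k * th t x * (x / \<alpha>) * suminf B)"
    unfolding even by (intro sums_mult B)
  \<comment> \<open>Interleaving the two sums places the second at the odd indices, where
    \<open>(n - 1) div 2\<close> and \<open>n div 2\<close> agree.\<close>
  have "(\<lambda>n. if even n then q_odd (n div 2) t x else q_even ((n - 1) div 2) t x)
      sums (l * k * th t x * (x / \<alpha>) * suminf B + l / \<alpha> * th t x / xa t x * (x * suminf A + \<beta> * xb t x * suminf B))"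
    by (rule sums_if[OF even_sum odd_sum])
  also have "(\<lambda>n. if even n then q_odd (n div 2) t x else q_even ((n - 1) div 2) t x)
     = (\<lambda>n. if even n then q_odd (n div 2) t x else q_even (n div 2) t x)"
    by (auto simp: fun_eq_iff elim!: oddE)
  also have "l * k * th t x * (x / \<alpha>) * suminf B + l / \<alpha> * th t x / xa t x * (x * suminf A + \<beta> * xb t x * suminf B)
     = l / \<alpha> * (x / xa t x * suminf A + (k * x + \<beta> * (xb t x / xa t x)) * suminf B) * th t x"
    by (simp add: algebra_simps add_divide_distrib)
  finally show ?thesis
    unfolding dens_def total_dens_def A_def[abs_def] B_def[abs_def] by (rule sums_mult)
qed

lemma total_dens_nonneg: "0 \<le> total_dens t x"
  using sums_le[OF _ sums_zero dens_sums] dens_nonneg by blast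

lemma total_dens_measurable: "total_dens t \<in> borel_measurable borel"
proof -
  have "total_dens t = (\<lambda>x. \<Sum>n. dens n t x)"
    using sums_unique[OF dens_sums] by auto
  then show ?thesis by simp
qed

lemma suminf_dens: "(\<Sum>n. ennreal (dens n t x)) = ennreal (total_dens t x)"
  using suminf_ennreal2[OF dens_nonneg sums_summable[OF dens_sums]] sums_unique[OF dens_sums] by simp

end

context one_sided_telegraph
begin

text \<open>Summation over the disjoint values of the count: the term 0 is the atom, and the others
  add up under the integral by monotone convergence.\<close>

lemma position_law_total:
  assumes "0 < t" "B \<in> sets borel"
  shows "emeasure M {\<omega> \<in> space M. \<epsilon> 0 \<omega> = i0 \<and> (\<forall>u\<in>{0..t}. 0 \<le> telegraph v \<epsilon> u \<omega>) \<and> telegraph v \<epsilon> t \<omega> \<in> B}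
    = ennreal p0 * (ennreal (exp (- lam i0 * t)) * indicator B (v i0 * t) + (\<integral>\<^sup>+x. ennreal (total_dens t x) * indicator B x \<partial>lborel))"
    (is "emeasure M ?E = _")
proof -
  note [measurable] = assms(2)
  have "emeasure M ?E = emeasure M (\<Union>n. position_event n t B)"
    by (rule arg_cong[where f = "emeasure M"]) (auto simp: position_event_def)
  also have "\<dots> = (\<Sum>n. emeasure M (position_event n t B))"
  proof (rule suminf_emeasure[symmetric])
    show "range (\<lambda>n. position_event n t B) \<subseteq> events"
      using position_event_events[OF less_imp_le[OF assms(1)] assms(2)] by blast
  qed (auto simp: disjoint_family_on_def position_event_def)
  also have "\<dots> = emeasure M (position_event 0 t B) + (\<Sum>n. emeasure M (position_event (Suc n) t B))"
    using sums_unique[OF sums_Suc[OF summable_sums[OF summableI]], of "\<lambda>n. emeasure M (position_event n t B)"]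
    by (simp add: add.commute)
  also have "(\<Sum>n. emeasure M (position_event (Suc n) t B)) = ennreal p0 * (\<Sum>n. \<integral>\<^sup>+x. ennreal (dens n t x) * indicator B x \<partial>lborel)"
    unfolding position_density[OF assms] by (rule ennreal_suminf_cmult)
  also have "(\<Sum>n. \<integral>\<^sup>+x. ennreal (dens n t x) * indicator B x \<partial>lborel) = (\<integral>\<^sup>+x. (\<Sum>n. ennreal (dens n t x) * indicator B x) \<partial>lborel)"
    by (rule nn_integral_suminf[symmetric]) measurable
  also have "(\<lambda>x. \<Sum>n. ennreal (dens n t x) * indicator B x) = (\<lambda>x. ennreal (total_dens t x) * indicator B x)"
    by (simp add: suminf_dens)
  finally show ?thesis
    using position_event_0[of t B] assms(1) by (simp add: distrib_left)
qed

lemma cond_prob_density: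
  assumes "0 < t" "0 < p0" "S \<in> sets borel"
  shows "density_on S (\<lambda>A. \<P>(\<omega> in M. telegraph v \<epsilon> t \<omega> \<in> A \<and> (\<forall>u\<in>{0..t}. 0 \<le> telegraph v \<epsilon> u \<omega>) \<and> switch_count \<epsilon> t \<omega> = Suc n \<bar> \<epsilon> 0 \<omega> = i0)) (dens n t)"
  unfolding density_on_iff_atom[where a = 0]
proof (rule atom_plus_density_on_if_emeasure)
  fix A :: "real set" assume A: "A \<in> sets borel"
  have "\<P>(\<omega> in M. telegraph v \<epsilon> t \<omega> \<in> A \<and> (\<forall>u\<in>{0..t}. 0 \<le> telegraph v \<epsilon> u \<omega>) \<and> switch_count \<epsilon> t \<omega> = Suc n \<bar> \<epsilon> 0 \<omega> = i0)
     = prob (position_event (Suc n) t A) / p0"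
    unfolding cond_prob_def position_event_def by (simp add: conj_ac)
  then have "ennreal (\<P>(\<omega> in M. telegraph v \<epsilon> t \<omega> \<in> A \<and> (\<forall>u\<in>{0..t}. 0 \<le> telegraph v \<epsilon> u \<omega>) \<and> switch_count \<epsilon> t \<omega> = Suc n \<bar> \<epsilon> 0 \<omega> = i0))
     = emeasure M (position_event (Suc n) t A) / ennreal p0"
    using assms(2) by (simp add: emeasure_eq_measure divide_ennreal)
  also have "\<dots> = (\<integral>\<^sup>+x. ennreal (dens n t x) * indicator A x \<partial>lborel)"
    unfolding position_density[OF assms(1) A] using assms(2)
    by (simp add: ennreal_times_divide[symmetric] mult_divide_eq_ennreal mult.commute[of "ennreal p0"])
  finally show "ennreal (\<P>(\<omega> in M. telegraph v \<epsilon> t \<omega> \<in> A \<and> (\<forall>u\<in>{0..t}. 0 \<le> telegraph v \<epsilon> u \<omega>) \<and> switch_count \<epsilon> t \<omega> = Suc n \<bar> \<epsilon> 0 \<omega> = i0))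
     = ennreal 0 * indicator A 0 + (\<integral>\<^sup>+x. ennreal (dens n t x) * indicator A x \<partial>lborel)"
    by simp
qed (use assms dens_nonneg in \<open>auto simp: cond_prob_def\<close>)

lemma cond_prob_total:
  assumes "0 < t" "0 < p0" "S \<in> sets borel"
  shows "atom_plus_density_on S (\<lambda>A. \<P>(\<omega> in M. telegraph v \<epsilon> t \<omega> \<in> A \<and> (\<forall>u\<in>{0..t}. 0 \<le> telegraph v \<epsilon> u \<omega>) \<bar> \<epsilon> 0 \<omega> = i0))
    (exp (- lam i0 * t)) (v i0 * t) (total_dens t)"
proof (rule atom_plus_density_on_if_emeasure)
  fix A :: "real set" assume A: "A \<in> sets borel"
  define E where "E = {\<omega> \<in> space M. \<epsilon> 0 \<omega> = i0 \<and> (\<forall>u\<in>{0..t}. 0 \<le> telegraph v \<epsilon> u \<omega>) \<and> telegraph v \<epsilon> t \<omega> \<in> A}"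
  have "\<P>(\<omega> in M. telegraph v \<epsilon> t \<omega> \<in> A \<and> (\<forall>u\<in>{0..t}. 0 \<le> telegraph v \<epsilon> u \<omega>) \<bar> \<epsilon> 0 \<omega> = i0) = prob E / p0"
    unfolding cond_prob_def E_def by (simp add: conj_ac)
  then have "ennreal (\<P>(\<omega> in M. telegraph v \<epsilon> t \<omega> \<in> A \<and> (\<forall>u\<in>{0..t}. 0 \<le> telegraph v \<epsilon> u \<omega>) \<bar> \<epsilon> 0 \<omega> = i0))
     = emeasure M E / ennreal p0"
    using assms(2) by (simp add: emeasure_eq_measure divide_ennreal)
  also have "\<dots> = ennreal (exp (- lam i0 * t)) * indicator A (v i0 * t) + (\<integral>\<^sup>+x. ennreal (total_dens t x) * indicator A x \<partial>lborel)"
    unfolding E_def position_law_total[OF assms(1) A] using assms(2)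
    by (simp add: ennreal_times_divide[symmetric] mult_divide_eq_ennreal mult.commute[of "ennreal p0"])
  finally show "ennreal (\<P>(\<omega> in M. telegraph v \<epsilon> t \<omega> \<in> A \<and> (\<forall>u\<in>{0..t}. 0 \<le> telegraph v \<epsilon> u \<omega>) \<bar> \<epsilon> 0 \<omega> = i0))
     = ennreal (exp (- lam i0 * t)) * indicator A (v i0 * t) + (\<integral>\<^sup>+x. ennreal (total_dens t x) * indicator A x \<partial>lborel)" .
qed (use assms total_dens_nonneg total_dens_measurable in \<open>auto simp: cond_prob_def\<close>)

end

section \<open>Return to the running minimum and maximum\<close>

text \<open>The path starts at 0, so its minimum is at most 0. Compactness bounds the values from
  below, without which the real infimum would say nothing about them.\<close>

lemma (in two_state_transitions) running_min_eq_0_iff: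
  assumes "\<omega> \<in> space M" "0 \<le> t"
  shows "running_min (telegraph \<gamma> \<epsilon>) t \<omega> = 0 \<longleftrightarrow> (\<forall>u\<in>{0..t}. 0 \<le> telegraph \<gamma> \<epsilon> u \<omega>)"
proof -
  interpret step_path "\<lambda>s. \<epsilon> s \<omega>"
    by (intro path assms)
  have "compact ((\<lambda>u. telegraph \<gamma> \<epsilon> u \<omega>) ` {0..t})"
    using G_continuous[of t \<gamma>] unfolding telegraph_def by (intro compact_continuous_image) auto
  then have bdd: "bdd_below ((\<lambda>u. telegraph \<gamma> \<epsilon> u \<omega>) ` {0..t})"
    by (intro bounded_imp_bdd_below compact_imp_bounded)
  have "0 = telegraph \<gamma> \<epsilon> 0 \<omega>" by (simp add: telegraph_def)
  then have zero: "0 \<in> (\<lambda>u. telegraph \<gamma> \<epsilon> u \<omega>) ` {0..t}"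
    using assms(2) by (rule_tac image_eqI) auto
  show ?thesis
  proof
    assume "running_min (telegraph \<gamma> \<epsilon>) t \<omega> = 0"
    then show "\<forall>u\<in>{0..t}. 0 \<le> telegraph \<gamma> \<epsilon> u \<omega>"
      using cINF_lower[OF bdd] unfolding running_min_def by metis
  next
    assume "\<forall>u\<in>{0..t}. 0 \<le> telegraph \<gamma> \<epsilon> u \<omega>"
    then show "running_min (telegraph \<gamma> \<epsilon>) t \<omega> = 0"
      unfolding running_min_def by (intro cInf_eq_minimum zero) auto
  qed
qed

lemma telegraph_uminus: "telegraph (\<lambda>j. - \<gamma> j) \<epsilon> u \<omega> = - telegraph \<gamma> \<epsilon> u \<omega>"
  by (simp add: telegraph_def)

lemma running_max_uminus: "running_max (telegraph \<gamma> \<epsilon>) t \<omega> = - running_min (telegraph (\<lambda>j. - \<gamma> j) \<epsilon>) t \<omega>"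
  unfolding running_max_def running_min_def telegraph_uminus Inf_real_def
  by (simp add: image_image)

theorem mainTheorem4:
  fixes M :: "'a measure" and lam \<gamma> :: "nat \<Rightarrow> real"
    and \<epsilon> :: "real \<Rightarrow> 'a \<Rightarrow> nat" and t :: real
    and \<Gamma> m Mx :: "real \<Rightarrow> 'a \<Rightarrow> real" and N :: "real \<Rightarrow> 'a \<Rightarrow> nat"
  assumes "two_state_markov_process M lam \<epsilon>"
    and "lam 0 > 0" and "lam 1 > 0"
    and "\<gamma> 0 > 0" and "0 > \<gamma> 1"
    and "t > 0"
  defines "\<Gamma> \<equiv> telegraph \<gamma> \<epsilon>"
    and "m \<equiv> running_min (telegraph \<gamma> \<epsilon>)"
    and "Mx \<equiv> running_max (telegraph \<gamma> \<epsilon>)"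
    and "N \<equiv> switch_count \<epsilon>"
  shows
    "(\<P>(\<omega> in M. \<epsilon> 0 \<omega> = 0) > 0 \<longrightarrow>
        atom_plus_density_on {0<..}
          (\<lambda>A. \<P>(\<omega> in M. \<Gamma> t \<omega> \<in> A \<and> m t \<omega> = 0 \<bar> \<epsilon> 0 \<omega> = 0))
          (exp (- lam 0 * t)) (\<gamma> 0 * t)
          (\<lambda>x. lam 0 / \<gamma> 0 *
             (x / xi0 \<gamma> t x * I0 lam \<gamma> t x
               + (lam 1 * x - \<gamma> 1 * (xi1 \<gamma> t x / xi0 \<gamma> t x)) * I1 lam \<gamma> t x)
             * theta lam \<gamma> t x * indicator {0<..<\<gamma> 0 * t} x))
     \<and>
     (\<P>(\<omega> in M. \<epsilon> 0 \<omega> = 1) > 0 \<longrightarrow>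
        (\<forall>n. density_on {\<gamma> 1 * t<..<0}
          (\<lambda>A. \<P>(\<omega> in M. \<Gamma> t \<omega> \<in> A \<and> Mx t \<omega> = 0 \<and> N t \<omega> = 2 * n + 1 \<bar> \<epsilon> 0 \<omega> = 1))
          (\<lambda>x. lam 1 / xi1 \<gamma> t x * (zfun lam \<gamma> t x ^ n / (fact n)\<^sup>2) * theta lam \<gamma> t x
             * (1 / \<gamma> 1 * (x - \<gamma> 0 / real (n + 1) * xi0 \<gamma> t x)))) \<and>
        (\<forall>n. density_on {\<gamma> 1 * t<..<0}
          (\<lambda>A. \<P>(\<omega> in M. \<Gamma> t \<omega> \<in> A \<and> Mx t \<omega> = 0 \<and> N t \<omega> = 2 * n + 2 \<bar> \<epsilon> 0 \<omega> = 1))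
          (\<lambda>x. lam 0 * lam 1 * (zfun lam \<gamma> t x ^ n / (fact n * fact (n + 1)))
             * theta lam \<gamma> t x * (x / \<gamma> 1))) \<and>
        atom_plus_density_on {..<0}
          (\<lambda>A. \<P>(\<omega> in M. \<Gamma> t \<omega> \<in> A \<and> Mx t \<omega> = 0 \<bar> \<epsilon> 0 \<omega> = 1))
          (exp (- lam 1 * t)) (\<gamma> 1 * t)
          (\<lambda>x. lam 1 / \<gamma> 1 *
             (x / xi1 \<gamma> t x * I0 lam \<gamma> t x
               + (lam 0 * x - \<gamma> 0 * (xi0 \<gamma> t x / xi1 \<gamma> t x)) * I1 lam \<gamma> t x)
             * theta lam \<gamma> t x * indicator {\<gamma> 1 * t<..<0} x))"
proof -
  note lam = assms(2,3) and \<gamma> = assms(4,5) and t = assms(6)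
  interpret two_state_markov_process M lam \<epsilon>
    by (fact assms(1))
  obtain p where "transition_function lam p" and p: "\<forall>n (\<tau> :: nat \<Rightarrow> real) (i :: nat \<Rightarrow> nat). \<forall>j\<in>{0,1}.
       0 \<le> \<tau> 0 \<longrightarrow> (\<forall>k\<le>n. \<tau> k < \<tau> (Suc k)) \<longrightarrow>
       \<P>(\<omega> in M. \<forall>k\<le>n. \<epsilon> (\<tau> k) \<omega> = i k) > 0 \<longrightarrow>
       \<P>(\<omega> in M. \<epsilon> (\<tau> (Suc n)) \<omega> = j \<bar> \<forall>k\<le>n. \<epsilon> (\<tau> k) \<omega> = i k) = p (\<tau> (Suc n) - \<tau> n) (i n) j"
    using markov by auto
  interpret two_state_transitions M lam \<epsilon> p
    using \<open>transition_function lam p\<close> p lam by unfold_locales blast+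
  interpret up: one_sided_telegraph M lam \<epsilon> p \<gamma> 0
    using \<gamma> by unfold_locales auto
  interpret down: one_sided_telegraph M lam \<epsilon> p "\<lambda>j. - \<gamma> j" 1
    using \<gamma> by unfold_locales auto
  have up_coords: "up.xa t x = xi0 \<gamma> t x" "up.xb t x = xi1 \<gamma> t x" "up.th t x = theta lam \<gamma> t x" "up.z t x = zfun lam \<gamma> t x" for x
  proof -
    show xa: "up.xa t x = xi0 \<gamma> t x"
      unfolding up.xa_def xi0_def by simp
    show xb: "up.xb t x = xi1 \<gamma> t x"
      using up.coords(1)[of t x] unfolding xa xi1_def by linarith
    show "up.th t x = theta lam \<gamma> t x"
      unfolding up.th_def theta_def xa xb by simp
    show "up.z t x = zfun lam \<gamma> t x"
      unfolding up.z_def zfun_def xa xb by simp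
  qed
  \<comment> \<open>Under reflection state 1 becomes the upward state, so the two occupation times
    change places.\<close>
  have down_coords: "down.xa t (- x) = xi1 \<gamma> t x" "down.xb t (- x) = xi0 \<gamma> t x" "down.th t (- x) = theta lam \<gamma> t x" "down.z t (- x) = zfun lam \<gamma> t x" for x
  proof -
    have "down.xb t (- x) = (x - \<gamma> 1 * t) / (\<gamma> 0 - \<gamma> 1)"
      unfolding down.xb_def by (simp add: algebra_simps)
    then show xb: "down.xb t (- x) = xi0 \<gamma> t x"
      unfolding xi0_def .
    show xa: "down.xa t (- x) = xi1 \<gamma> t x"
      using down.coords(1)[of t "- x"] unfolding xb xi1_def by linarith
    show "down.th t (- x) = theta lam \<gamma> t x"
      unfolding down.th_def theta_def xa xb by (simp add: algebra_simps)
    show "down.z t (- x) = zfun lam \<gamma> t x"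
      unfolding down.z_def zfun_def xa xb by simp
  qed
  have z_swap: "lam 1 * lam 0 * xi1 \<gamma> t x * xi0 \<gamma> t x = zfun lam \<gamma> t x" for x
    by (simp add: zfun_def)
  have min: "m t \<omega> = 0 \<longleftrightarrow> (\<forall>u\<in>{0..t}. 0 \<le> telegraph \<gamma> \<epsilon> u \<omega>)" if "\<omega> \<in> space M" for \<omega>
    unfolding m_def using that t by (intro running_min_eq_0_iff) auto
  have max: "Mx t \<omega> = 0 \<longleftrightarrow> (\<forall>u\<in>{0..t}. 0 \<le> telegraph (\<lambda>j. - \<gamma> j) \<epsilon> u \<omega>)" if "\<omega> \<in> space M" for \<omega>
    unfolding Mx_def running_max_uminus using running_min_eq_0_iff[OF that, of t "\<lambda>j. - \<gamma> j"] t by simp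
  show ?thesis
  proof (intro conjI impI allI)
    assume p0: "\<P>(\<omega> in M. \<epsilon> 0 \<omega> = 0) > 0"
    show "atom_plus_density_on {0<..}
          (\<lambda>A. \<P>(\<omega> in M. \<Gamma> t \<omega> \<in> A \<and> m t \<omega> = 0 \<bar> \<epsilon> 0 \<omega> = 0))
          (exp (- lam 0 * t)) (\<gamma> 0 * t)
          (\<lambda>x. lam 0 / \<gamma> 0 *
             (x / xi0 \<gamma> t x * I0 lam \<gamma> t x
               + (lam 1 * x - \<gamma> 1 * (xi1 \<gamma> t x / xi0 \<gamma> t x)) * I1 lam \<gamma> t x)
             * theta lam \<gamma> t x * indicator {0<..<\<gamma> 0 * t} x)"
    proof (rule atom_plus_density_on_cong[OF up.cond_prob_total[OF t p0]])
      show "\<P>(\<omega> in M. telegraph \<gamma> \<epsilon> t \<omega> \<in> A \<and> (\<forall>u\<in>{0..t}. 0 \<le> telegraph \<gamma> \<epsilon> u \<omega>) \<bar> \<epsilon> 0 \<omega> = 0)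
        = \<P>(\<omega> in M. \<Gamma> t \<omega> \<in> A \<and> m t \<omega> = 0 \<bar> \<epsilon> 0 \<omega> = 0)" for A
        unfolding cond_prob_def \<Gamma>_def using min by (simp cong: conj_cong)
      show "up.total_dens t x = lam 0 / \<gamma> 0 *
             (x / xi0 \<gamma> t x * I0 lam \<gamma> t x
               + (lam 1 * x - \<gamma> 1 * (xi1 \<gamma> t x / xi0 \<gamma> t x)) * I1 lam \<gamma> t x)
             * theta lam \<gamma> t x * indicator {0<..<\<gamma> 0 * t} x" for x
        unfolding up.total_dens_def up_coords I0_def I1_def by simp
    qed simp
  next
    fix n
    assume p1: "\<P>(\<omega> in M. \<epsilon> 0 \<omega> = 1) > 0"
    have refl: "{0<..<- \<gamma> 1 * t} = {x. - x \<in> {\<gamma> 1 * t<..<0}}" "{0<..<- \<gamma> 1 * t} \<in> sets borel"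
      by auto
    \<comment> \<open>Both parities are instances: \<open>n\<close> is one less than the number of
      switchings.\<close>
    have count: "density_on {\<gamma> 1 * t<..<0} (\<lambda>A. \<P>(\<omega> in M. \<Gamma> t \<omega> \<in> A \<and> Mx t \<omega> = 0 \<and> N t \<omega> = Suc n \<bar> \<epsilon> 0 \<omega> = 1)) g"
      if g: "\<And>x. \<gamma> 1 * t < x \<Longrightarrow> x < 0 \<Longrightarrow> down.dens n t (- x) = g x" for n g
      unfolding density_on_iff_atom[where a = "- 0"]
    proof (rule atom_plus_density_on_cong[OF atom_plus_density_on_reflect[OF
            down.cond_prob_density[OF t p1 refl(2), of n, unfolded density_on_iff_atom[where a = 0]] refl(1)]])
      show "\<P>(\<omega> in M. telegraph (\<lambda>j. - \<gamma> j) \<epsilon> t \<omega> \<in> {x. - x \<in> A} \<and> (\<forall>u\<in>{0..t}. 0 \<le> telegraph (\<lambda>j. - \<gamma> j) \<epsilon> u \<omega>)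
            \<and> switch_count \<epsilon> t \<omega> = Suc n \<bar> \<epsilon> 0 \<omega> = 1)
        = \<P>(\<omega> in M. \<Gamma> t \<omega> \<in> A \<and> Mx t \<omega> = 0 \<and> N t \<omega> = Suc n \<bar> \<epsilon> 0 \<omega> = 1)" for A
        unfolding cond_prob_def \<Gamma>_def N_def using max by (simp add: telegraph_uminus cong: conj_cong)
      show "down.dens n t (- x) = g x" if "x \<in> {\<gamma> 1 * t<..<0}" for x
        using that by (intro g) auto
    qed
    show "density_on {\<gamma> 1 * t<..<0}
          (\<lambda>A. \<P>(\<omega> in M. \<Gamma> t \<omega> \<in> A \<and> Mx t \<omega> = 0 \<and> N t \<omega> = 2 * n + 1 \<bar> \<epsilon> 0 \<omega> = 1))
          (\<lambda>x. lam 1 / xi1 \<gamma> t x * (zfun lam \<gamma> t x ^ n / (fact n)\<^sup>2) * theta lam \<gamma> t x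
             * (1 / \<gamma> 1 * (x - \<gamma> 0 / real (n + 1) * xi0 \<gamma> t x)))"
    proof -
      have "down.dens (2 * n) t (- x) = lam 1 / xi1 \<gamma> t x * (zfun lam \<gamma> t x ^ n / (fact n)\<^sup>2) * theta lam \<gamma> t x
             * (1 / \<gamma> 1 * (x - \<gamma> 0 / real (n + 1) * xi0 \<gamma> t x))" if "\<gamma> 1 * t < x" "x < 0" for x
      proof -
        \<comment> \<open>Reflection changes the sign of both factors.\<close>
        have "1 / - \<gamma> 1 * (- x + \<gamma> 0 / real (n + 1) * xi0 \<gamma> t x) = 1 / \<gamma> 1 * (x - \<gamma> 0 / real (n + 1) * xi0 \<gamma> t x)"
          by (simp add: divide_inverse algebra_simps)
        then show ?thesis
          using that unfolding down.dens_def down.q_odd_def down_coords by (simp add: z_swap)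
      qed
      from count[OF this] show ?thesis by (simp only: Suc_eq_plus1)
    qed
    show "density_on {\<gamma> 1 * t<..<0}
          (\<lambda>A. \<P>(\<omega> in M. \<Gamma> t \<omega> \<in> A \<and> Mx t \<omega> = 0 \<and> N t \<omega> = 2 * n + 2 \<bar> \<epsilon> 0 \<omega> = 1))
          (\<lambda>x. lam 0 * lam 1 * (zfun lam \<gamma> t x ^ n / (fact n * fact (n + 1)))
             * theta lam \<gamma> t x * (x / \<gamma> 1))"
    proof -
      have "down.dens (2 * n + 1) t (- x) = lam 0 * lam 1 * (zfun lam \<gamma> t x ^ n / (fact n * fact (n + 1)))
             * theta lam \<gamma> t x * (x / \<gamma> 1)" if "\<gamma> 1 * t < x" "x < 0" for x
        using that unfolding down.dens_def down.q_even_def down_coords by (simp add: z_swap)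
      from count[OF this] show ?thesis by (simp only: Suc_eq_plus1 add.assoc one_add_one)
    qed
  next
    assume p1: "\<P>(\<omega> in M. \<epsilon> 0 \<omega> = 1) > 0"
    have refl: "{0<..} = {x. - x \<in> {..<0::real}}" "{0<..} \<in> sets (borel :: real measure)"
      by auto
    show "atom_plus_density_on {..<0}
          (\<lambda>A. \<P>(\<omega> in M. \<Gamma> t \<omega> \<in> A \<and> Mx t \<omega> = 0 \<bar> \<epsilon> 0 \<omega> = 1))
          (exp (- lam 1 * t)) (\<gamma> 1 * t)
          (\<lambda>x. lam 1 / \<gamma> 1 *
             (x / xi1 \<gamma> t x * I0 lam \<gamma> t x
               + (lam 0 * x - \<gamma> 0 * (xi0 \<gamma> t x / xi1 \<gamma> t x)) * I1 lam \<gamma> t x)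
             * theta lam \<gamma> t x * indicator {\<gamma> 1 * t<..<0} x)"
    proof -
      \<comment> \<open>The double minus is the form in which reflection delivers the place of the
        atom.\<close>
      have "atom_plus_density_on {..<0}
          (\<lambda>A. \<P>(\<omega> in M. \<Gamma> t \<omega> \<in> A \<and> Mx t \<omega> = 0 \<bar> \<epsilon> 0 \<omega> = 1))
          (exp (- lam 1 * t)) (- (- \<gamma> 1 * t))
          (\<lambda>x. lam 1 / \<gamma> 1 *
             (x / xi1 \<gamma> t x * I0 lam \<gamma> t x
               + (lam 0 * x - \<gamma> 0 * (xi0 \<gamma> t x / xi1 \<gamma> t x)) * I1 lam \<gamma> t x)
             * theta lam \<gamma> t x * indicator {\<gamma> 1 * t<..<0} x)"
      proof (rule atom_plus_density_on_cong[OF atom_plus_density_on_reflect[OF down.cond_prob_total[OF t p1 refl(2)] refl(1)]])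
        show "\<P>(\<omega> in M. telegraph (\<lambda>j. - \<gamma> j) \<epsilon> t \<omega> \<in> {x. - x \<in> A} \<and> (\<forall>u\<in>{0..t}. 0 \<le> telegraph (\<lambda>j. - \<gamma> j) \<epsilon> u \<omega>) \<bar> \<epsilon> 0 \<omega> = 1)
          = \<P>(\<omega> in M. \<Gamma> t \<omega> \<in> A \<and> Mx t \<omega> = 0 \<bar> \<epsilon> 0 \<omega> = 1)" for A
          unfolding cond_prob_def \<Gamma>_def using max by (simp add: telegraph_uminus cong: conj_cong)
        fix x :: real
        have bracket: "lam 1 / - \<gamma> 1 * (- x / xi1 \<gamma> t x * I0 lam \<gamma> t x + (lam 0 * - x + \<gamma> 0 * (xi0 \<gamma> t x / xi1 \<gamma> t x)) * I1 lam \<gamma> t x)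
           = lam 1 / \<gamma> 1 * (x / xi1 \<gamma> t x * I0 lam \<gamma> t x + (lam 0 * x - \<gamma> 0 * (xi0 \<gamma> t x / xi1 \<gamma> t x)) * I1 lam \<gamma> t x)"
        proof -
          have neg: "- x / xi1 \<gamma> t x * I0 lam \<gamma> t x + (lam 0 * - x + \<gamma> 0 * (xi0 \<gamma> t x / xi1 \<gamma> t x)) * I1 lam \<gamma> t x
            = - (x / xi1 \<gamma> t x * I0 lam \<gamma> t x + (lam 0 * x - \<gamma> 0 * (xi0 \<gamma> t x / xi1 \<gamma> t x)) * I1 lam \<gamma> t x)"
            by (simp add: algebra_simps)
          have "q / - r * - s = q / r * s" for q r s :: real
            by simp
          then show ?thesis
            unfolding neg .
        qed
        have ind: "indicator {0<..<- \<gamma> 1 * t} (- x) = (indicator {\<gamma> 1 * t<..<0} x :: real)"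
          by (auto simp: indicator_def)
        have "down.total_dens t (- x) = indicator {0<..<- \<gamma> 1 * t} (- x) * (lam 1 / - \<gamma> 1 *
             (- x / xi1 \<gamma> t x * I0 lam \<gamma> t x
               + (lam 0 * - x + \<gamma> 0 * (xi0 \<gamma> t x / xi1 \<gamma> t x)) * I1 lam \<gamma> t x) * theta lam \<gamma> t x)"
          unfolding down.total_dens_def down_coords I0_def I1_def by simp
        then show "down.total_dens t (- x) = lam 1 / \<gamma> 1 *
             (x / xi1 \<gamma> t x * I0 lam \<gamma> t x
               + (lam 0 * x - \<gamma> 0 * (xi0 \<gamma> t x / xi1 \<gamma> t x)) * I1 lam \<gamma> t x)
             * theta lam \<gamma> t x * indicator {\<gamma> 1 * t<..<0} x"
          unfolding bracket ind by (simp only: mult.commute)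
      qed
      then show ?thesis by simp
    qed
  qed
qed

end
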